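(* Let $1<p<+\infty$, let $a\in C[0,1]$ be positive, put $a_0=\min_{x\in[0,1]}a(x)$, and let $F:(0,1)\times\mathbb{R}^2\to\mathbb{R}$ be a continuous function of the form $F=f+g$, where (i) there is a positive constant $M$ such that $|f(x,s,\lambda)|\le M|\varphi_p(s)|$ for all $x\in(0,1)$, $0<|s|\le 1$ and $\lambda\in\mathbb{R}$; (ii) $g(x,s,\lambda)=o(|s|^{p-1})$ near $s=0$, uniformly in $x\in(0,1)$ and on bounded $\lambda$ intervals. Consider the problem $$(P)\qquad \left(|u'|^{p-2}u'\right)'+\lambda a(x)\varphi_p(u)+F(x,u,\lambda)=0,\ x\in(0,1),\qquad u(0)=u(1)=0 .$$ Let $d=M/a_0$ and, for every $k\in\mathbb{N}$, let $I_k=[\lambda_k-d,\lambda_k+d]$. Then for every $k\in\mathbb{N}$ the component $\mathscr{D}_k^+$ of $\mathscr{S}_k^+\cup(I_k\times\{0\})$ containing $I_k\times\{0\}$ is unbounded and lies in $\Phi_k^+\cup(I_k\times\{0\})$, and the component $\mathscr{D}_k^-$ of $\mathscr{S}_k^-\cup(I_k\times\{0\})$ containing $I_k\times\{0\}$ is unbounded and lies in $\Phi_k^-\cup(I_k\times\{0\})$.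
   Context: $\varphi_p(s)=|s|^{p-2}s$ (with $\varphi_p(0)=0$). $E=\{u\in C^1[0,1] : u(0)=u(1)=0\}$ with norm $\|u\|=\max_{[0,1]}|u|+\max_{[0,1]}|u'|$. For $k\in\mathbb{N}=\{1,2,\dots\}$, $S_k^+$ is the set of functions in $E$ which have exactly $k-1$ interior nodal (i.e. non-degenerate) zeros in $(0,1)$ (all zeros in $[0,1]$ being non-degenerate) and are positive near $x=0$; $S_k^-=-S_k^+$. The sets $S_k^{\pm}$ are disjoint and open in $E$. $\Phi_k^{\pm}=\mathbb{R}\times S_k^{\pm}$. A solution of problem $(P)$ is a pair $(\lambda,u)\in\mathbb{R}\times E$ satisfying $(P)$; it is nontrivial if $u\not\equiv0$. $\mathscr{S}$ is the closure in $\mathbb{R}\times E$ of the set of nontrivial solutions of $(P)$, and $\mathscr{S}_k^{\pm}$ is the subset of those $(\lambda,u)\in\mathscr{S}$ with $u\in S_k^{\pm}$. $\lambda_k$ is the $k$th eigenvalue of $$-\left(|u'|^{p-2}u'\right)'=\lambda a(x)\varphi_p(u),\ x\in(0,1),\qquad u(0)=u(1)=0$$ (the eigenvalues are $\lambda_1<\lambda_2<\cdots$, with $\lambda_k$ having eigenfunctions in $S_k^+\cup S_k^-$). "Unbounded" means unbounded in $\mathbb{R}\times E$. *)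

theory Defs
  imports "HOL-Analysis.Analysis"
begin

text \<open>
  The space \<open>E = {u \<in> C\<^sup>1[0,1]. u(0) = u(1) = 0}\<close>. Its elements are represented by total
  functions on the reals that vanish outside \<open>[0,1]\<close>, so that equality in the type is equality
  on \<open>[0,1]\<close>. Derivatives at the endpoints are one-sided.
\<close>

typedef c1_zero = "{u :: real \<Rightarrow> real.
    (\<exists>u'. continuous_on {0..1} u' \<and>
          (\<forall>x\<in>{0..1}. (u has_real_derivative u' x) (at x within {0..1}))) \<and>
    u 0 = 0 \<and> u 1 = 0 \<and> (\<forall>x. x \<notin> {0..1} \<longrightarrow> u x = 0)}"
  morphisms fn Abs_c1_zero
  by (rule exI[of _ "\<lambda>_. 0"]) (auto intro!: exI[of _ "\<lambda>_. 0"])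

setup_lifting type_definition_c1_zero

definition dfn :: "c1_zero \<Rightarrow> real \<Rightarrow> real" where
  "dfn u x = vector_derivative (fn u) (at x within {0..1})"

lemma dfn_unique:
  assumes "x \<in> {0..1}" "(fn u has_real_derivative d) (at x within {0..1})"
  shows "dfn u x = d"
  unfolding dfn_def
  using assms vector_derivative_within_cbox[of 0 1 x "fn u" d]
  by (simp add: has_real_derivative_iff_has_vector_derivative)

lemma fn_has_derivative:
  assumes "x \<in> {0..1}"
  shows "(fn u has_real_derivative dfn u x) (at x within {0..1})"
proof -
  obtain d where "(fn u has_real_derivative d) (at x within {0..1})"
    using fn[of u] assms by blast
  with dfn_unique[OF assms this] show ?thesis by simp
qed

lemma continuous_on_dfn: "continuous_on {0..1} (dfn u)"
proof -
  obtain u' where "continuous_on {0..1} u'"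
    "\<forall>x\<in>{0..1}. (fn u has_real_derivative u' x) (at x within {0..1})"
    using fn[of u] by auto
  then show ?thesis
    using dfn_unique continuous_on_cong[of "{0..1}" "{0..1}" "dfn u" u'] by auto
qed

lemma continuous_on_fn: "continuous_on {0..1} (fn u)"
  using fn_has_derivative by (meson DERIV_continuous continuous_on_eq_continuous_within)

lemma fn_0 [simp]: "fn u 0 = 0"
  and fn_1 [simp]: "fn u 1 = 0"
  and fn_outside: "x \<notin> {0..1} \<Longrightarrow> fn u x = 0"
  using fn[of u] by auto

instantiation c1_zero :: real_vector
begin

lift_definition zero_c1_zero :: c1_zero is "\<lambda>_. 0"
  by (auto intro!: exI[of _ "\<lambda>_. 0"])

lift_definition plus_c1_zero :: "c1_zero \<Rightarrow> c1_zero \<Rightarrow> c1_zero" is "\<lambda>u v x. u x + v x"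
proof (clarsimp, goal_cases)
  case (1 u v u' v')
  then show ?case
    by (intro exI[of _ "\<lambda>x. u' x + v' x"]) (auto intro!: continuous_intros derivative_eq_intros)
qed

lift_definition minus_c1_zero :: "c1_zero \<Rightarrow> c1_zero \<Rightarrow> c1_zero" is "\<lambda>u v x. u x - v x"
proof (clarsimp, goal_cases)
  case (1 u v u' v')
  then show ?case
    by (intro exI[of _ "\<lambda>x. u' x - v' x"]) (auto intro!: continuous_intros derivative_eq_intros)
qed

lift_definition uminus_c1_zero :: "c1_zero \<Rightarrow> c1_zero" is "\<lambda>u x. - u x"
proof (clarsimp, goal_cases)
  case (1 u u')
  then show ?case
    by (intro exI[of _ "\<lambda>x. - u' x"]) (auto intro!: continuous_intros derivative_eq_intros)
qed

lift_definition scaleR_c1_zero :: "real \<Rightarrow> c1_zero \<Rightarrow> c1_zero" is "\<lambda>r u x. r * u x"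
proof (clarsimp, goal_cases)
  case (1 r u u')
  then show ?case
    by (intro exI[of _ "\<lambda>x. r * u' x"]) (auto intro!: continuous_intros derivative_eq_intros)
qed

instance
  by standard (transfer; simp add: fun_eq_iff algebra_simps)+

end

lemma dfn_0: "x \<in> {0..1} \<Longrightarrow> dfn 0 x = 0"
  by (rule dfn_unique) (auto simp: zero_c1_zero.rep_eq)

lemma dfn_add: "x \<in> {0..1} \<Longrightarrow> dfn (u + v) x = dfn u x + dfn v x"
  by (rule dfn_unique) (auto simp: plus_c1_zero.rep_eq intro!: derivative_eq_intros fn_has_derivative)

lemma dfn_scaleR: "x \<in> {0..1} \<Longrightarrow> dfn (r *\<^sub>R u) x = r * dfn u x"
  by (rule dfn_unique) (auto simp: scaleR_c1_zero.rep_eq intro!: derivative_eq_intros fn_has_derivative)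

lemma bdd_above_abs_image:
  fixes h :: "real \<Rightarrow> real"
  assumes "continuous_on {0..1} h"
  shows "bdd_above ((\<lambda>x. \<bar>h x\<bar>) ` {0..1})"
  using assms
  by (intro bounded_imp_bdd_above compact_imp_bounded compact_continuous_image continuous_intros) auto

lemma SUP_abs_upper:
  fixes h :: "real \<Rightarrow> real"
  assumes "continuous_on {0..1} h" "x \<in> {0..1}"
  shows "\<bar>h x\<bar> \<le> (SUP x\<in>{0..1}. \<bar>h x\<bar>)"
  using bdd_above_abs_image[OF assms(1)] assms(2) by (rule cSUP_upper2) auto

lemma SUP_abs_nonneg:
  fixes h :: "real \<Rightarrow> real"
  assumes "continuous_on {0..1} h"
  shows "0 \<le> (SUP x\<in>{0..1}. \<bar>h x\<bar>)"
  using SUP_abs_upper[OF assms, of 0] by auto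

lemma SUP_abs_triangle:
  fixes h k l :: "real \<Rightarrow> real"
  assumes "continuous_on {0..1} h" "continuous_on {0..1} k"
    and "\<And>x. x \<in> {0..1} \<Longrightarrow> l x = h x + k x"
  shows "(SUP x\<in>{0..1}. \<bar>l x\<bar>) \<le> (SUP x\<in>{0..1}. \<bar>h x\<bar>) + (SUP x\<in>{0..1}. \<bar>k x\<bar>)"
proof (rule cSUP_least)
  fix x :: real assume x: "x \<in> {0..1}"
  show "\<bar>l x\<bar> \<le> (SUP x\<in>{0..1}. \<bar>h x\<bar>) + (SUP x\<in>{0..1}. \<bar>k x\<bar>)"
    using SUP_abs_upper[OF assms(1) x] SUP_abs_upper[OF assms(2) x] assms(3)[OF x] by linarith
qed simp

lemma SUP_abs_mult_le:
  fixes h l :: "real \<Rightarrow> real"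
  assumes "continuous_on {0..1} h" "\<And>x. x \<in> {0..1} \<Longrightarrow> l x = r * h x"
  shows "(SUP x\<in>{0..1}. \<bar>l x\<bar>) \<le> \<bar>r\<bar> * (SUP x\<in>{0..1}. \<bar>h x\<bar>)"
  by (rule cSUP_least)
    (auto simp: assms(2) abs_mult intro!: mult_left_mono SUP_abs_upper[OF assms(1)])

text \<open>The supremum below is a maximum, both functions being continuous on \<open>[0,1]\<close>.\<close>

instantiation c1_zero :: real_normed_vector
begin

definition norm_c1_zero :: "c1_zero \<Rightarrow> real" where
  "norm u = (SUP x\<in>{0..1}. \<bar>fn u x\<bar>) + (SUP x\<in>{0..1}. \<bar>dfn u x\<bar>)"

definition dist_c1_zero :: "c1_zero \<Rightarrow> c1_zero \<Rightarrow> real" where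
  "dist (u :: c1_zero) v = norm (u - v)"

definition sgn_c1_zero :: "c1_zero \<Rightarrow> c1_zero" where
  "sgn (u :: c1_zero) = u /\<^sub>R norm u"

definition uniformity_c1_zero :: "(c1_zero \<times> c1_zero) filter" where
  "uniformity = (INF e\<in>{0<..}. principal {(u :: c1_zero, v). dist u v < e})"

definition open_c1_zero :: "c1_zero set \<Rightarrow> bool" where
  "open (U :: c1_zero set) \<longleftrightarrow> (\<forall>u\<in>U. \<forall>\<^sub>F (u', v) in uniformity. u' = u \<longrightarrow> v \<in> U)"

instance
proof
  fix u v :: c1_zero and r :: real
  show "norm u = 0 \<longleftrightarrow> u = 0"
  proof
    assume "norm u = 0"
    then have S: "(SUP x\<in>{0..1}. \<bar>fn u x\<bar>) = 0"
      using SUP_abs_nonneg[OF continuous_on_fn[of u]] SUP_abs_nonneg[OF continuous_on_dfn[of u]]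
      unfolding norm_c1_zero_def by linarith
    have "fn u x = 0" for x
      using SUP_abs_upper[OF continuous_on_fn[of u], of x] S fn_outside[of x u]
      by (cases "x \<in> {0..1}") auto
    then show "u = 0"
      by (metis fn_inject zero_c1_zero.rep_eq ext)
  next
    assume "u = 0"
    then show "norm u = 0"
      by (simp add: norm_c1_zero_def zero_c1_zero.rep_eq dfn_0)
  qed
  show "norm (u + v) \<le> norm u + norm v"
    using SUP_abs_triangle[OF continuous_on_fn continuous_on_fn, of "fn (u + v)" u v]
      SUP_abs_triangle[OF continuous_on_dfn continuous_on_dfn, of "dfn (u + v)" u v]
    unfolding norm_c1_zero_def by (simp add: plus_c1_zero.rep_eq dfn_add)
  have le: "norm (r *\<^sub>R u) \<le> \<bar>r\<bar> * norm u" for r and u :: c1_zero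
    using SUP_abs_mult_le[OF continuous_on_fn, of "fn (r *\<^sub>R u)" r u]
      SUP_abs_mult_le[OF continuous_on_dfn, of "dfn (r *\<^sub>R u)" r u]
    unfolding norm_c1_zero_def by (simp add: scaleR_c1_zero.rep_eq dfn_scaleR distrib_left)
  have nonneg: "0 \<le> norm u" for u :: c1_zero
    using SUP_abs_nonneg[OF continuous_on_fn[of u]] SUP_abs_nonneg[OF continuous_on_dfn[of u]]
    unfolding norm_c1_zero_def by linarith
  show "norm (r *\<^sub>R u) = \<bar>r\<bar> * norm u"
  proof (cases "r = 0")
    case True
    then show ?thesis using le[of r u] nonneg[of "r *\<^sub>R u"] by simp
  next
    case False
    have "norm u \<le> \<bar>inverse r\<bar> * norm (r *\<^sub>R u)"
      using le[of "inverse r" "r *\<^sub>R u"] False by simp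
    then have "\<bar>r\<bar> * norm u \<le> norm (r *\<^sub>R u)"
      using False by (simp add: abs_inverse field_simps)
    then show ?thesis using le[of r u] by simp
  qed
qed (rule dist_c1_zero_def sgn_c1_zero_def uniformity_c1_zero_def open_c1_zero_def)+

end

text \<open>The value at \<open>s = 0\<close> is \<open>0\<close>, also for \<open>p < 2\<close>.\<close>

definition phi :: "real \<Rightarrow> real \<Rightarrow> real" where
  "phi p s = \<bar>s\<bar> powr (p - 2) * s"

text \<open>
  \<open>plap_solution p a F l u\<close> says that \<open>(l, u)\<close> solves
  \<open>(|u'|\<^sup>p\<^sup>-\<^sup>2 u')' + l a(x) \<phi>\<^sub>p(u) + F(x,u,l) = 0\<close> in \<open>(0,1)\<close>; the boundary conditions are part
  of the type \<^typ>\<open>c1_zero\<close>. The arguments of \<open>F\<close> are \<open>x, s, l\<close>, in this order.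
\<close>

definition plap_solution ::
  "real \<Rightarrow> (real \<Rightarrow> real) \<Rightarrow> (real \<Rightarrow> real \<Rightarrow> real \<Rightarrow> real) \<Rightarrow> real \<Rightarrow> c1_zero \<Rightarrow> bool" where
  "plap_solution p a F l u \<longleftrightarrow>
     (\<forall>x\<in>{0<..<1}.
        (\<lambda>t. phi p (dfn u t)) differentiable (at x) \<and>
        deriv (\<lambda>t. phi p (dfn u t)) x + l * a x * phi p (fn u x) + F x (fn u x) l = 0)"

definition plap_eigenvalue :: "real \<Rightarrow> (real \<Rightarrow> real) \<Rightarrow> real \<Rightarrow> bool" where
  "plap_eigenvalue p a l \<longleftrightarrow> (\<exists>u. u \<noteq> 0 \<and> plap_solution p a (\<lambda>_ _ _. 0) l u)"

text \<open>
  The \<open>k\<close>-th eigenvalue in increasing order, for \<open>k \<ge> 1\<close>: the eigenvalue that has exactly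
  \<open>k - 1\<close> eigenvalues below it.
\<close>

definition plap_eig :: "real \<Rightarrow> (real \<Rightarrow> real) \<Rightarrow> nat \<Rightarrow> real" where
  "plap_eig p a k = (THE l. plap_eigenvalue p a l \<and>
     finite {m. plap_eigenvalue p a m \<and> m < l} \<and>
     card {m. plap_eigenvalue p a m \<and> m < l} = k - 1)"

definition S_plus :: "nat \<Rightarrow> c1_zero set" where
  "S_plus k = {u.
     (\<forall>x\<in>{0..1}. fn u x = 0 \<longrightarrow> dfn u x \<noteq> 0) \<and>
     finite {x\<in>{0<..<1}. fn u x = 0} \<and>
     card {x\<in>{0<..<1}. fn u x = 0} = k - 1 \<and>
     (\<forall>\<^sub>F x in at_right 0. fn u x > 0)}"

definition S_minus :: "nat \<Rightarrow> c1_zero set" where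
  "S_minus k = uminus ` S_plus k"

definition solution_set ::
  "real \<Rightarrow> (real \<Rightarrow> real) \<Rightarrow> (real \<Rightarrow> real \<Rightarrow> real \<Rightarrow> real) \<Rightarrow> (real \<times> c1_zero) set" where
  "solution_set p a F = closure {(l, u). u \<noteq> 0 \<and> plap_solution p a F l u}"

definition nodal_solution_set ::
  "real \<Rightarrow> (real \<Rightarrow> real) \<Rightarrow> (real \<Rightarrow> real \<Rightarrow> real \<Rightarrow> real) \<Rightarrow> c1_zero set \<Rightarrow> (real \<times> c1_zero) set"
  where
  "nodal_solution_set p a F S = {(l, u). (l, u) \<in> solution_set p a F \<and> u \<in> S}"

end

theory Submission
  imports Defs "HOL-Complex_Analysis.Great_Picard"
begin

text \<open>
  A solution in \<open>S\<^sub>k\<^sup>+\<close> starts at \<open>u(0) = 0\<close> with a slope \<open>\<alpha> > 0\<close>. Its nodal class is recorded by the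
  angle \<open>\<theta>\<close> of \<open>(u, \<phi>\<^sub>p(u'))\<close> in the phase plane, lifted from \<open>\<theta>(0) = 0\<close>: the angle passes every
  multiple of \<open>\<pi>\<close> once and upwards, so \<open>u\<close> is in \<open>S\<^sub>k\<^sup>+\<close> exactly if \<open>\<theta>(1) = k\<pi>\<close> (\<open>S_plus_of_angle\<close>,
  \<open>angle_of_S_plus\<close>). If initial value problems were uniquely solvable, the solutions in \<open>S\<^sub>k\<^sup>+\<close> would
  form a level set of a continuous function of the two parameters \<open>(l, \<alpha>)\<close>. For small \<open>\<alpha>\<close> this
  function is below \<open>k\<pi>\<close> to the left of \<open>I\<^sub>k\<close> and above \<open>k\<pi>\<close> to the right, and a connected piece of
  the level set has to run from \<open>I\<^sub>k\<close> to infinity. This is a fact about the plane, for which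
  Brouwer's theorem in the form of Poincare and Miranda suffices in place of a degree in function
  spaces. Three things have to be supplied.

  The signs near \<open>I\<^sub>k\<close>. Dividing by \<open>\<phi>\<^sub>p(u)\<close> turns the equation into a half-linear one with the
  coefficient \<open>l a + F/\<phi>\<^sub>p(u)\<close>, and for small \<open>u\<close> the second term is at most \<open>M + o(1)\<close>, where
  \<open>M \<le> d a\<close>. For \<open>l\<close> outside \<open>I\<^sub>k\<close> the coefficient is thus strictly above or strictly below
  \<open>\<lambda>\<^sub>k a\<close>, and Sturm comparison with the eigenfunction, proved by the Picone identity, gives the sign
  of \<open>\<theta>(1) - k\<pi>\<close> (\<open>sturm_angle_strict\<close>, \<open>small_angle\<close>). It also shows that the branch can meet the
  trivial line only in \<open>I\<^sub>k\<close> (\<open>branch_closed\<close>). Sturm comparison and an intermediate value argument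
  for \<open>\<theta>(1)\<close> identify the \<open>k\<close>th eigenvalue as the one with an eigenfunction in \<open>S\<^sub>k\<^sup>+\<close>
  (\<open>eigen_class_plap_eig\<close>).

  The lack of uniqueness. As \<open>F\<close> is only continuous, the initial value problem is replaced by
  Tonelli's delayed approximations, which depend continuously on \<open>(l, \<alpha>)\<close> and have a continuous
  angle; all their limits are true trajectories with the limit angle (\<open>shooting_family\<close>). Thus it
  suffices to find zeros of continuous functions for the approximations and to pass to the limit.

  From zeros to components. A bounded component of the branch is enclosed in a compact set \<open>K\<close> such
  that the branch contains no point at distance exactly \<open>\<delta>\<close> from \<open>K\<close>
  (\<open>bounded_component_separated\<close>). But for every bounded \<open>K\<close> around \<open>I\<^sub>k \<times> {0}\<close> and small \<open>\<delta>\<close> the two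
  equations \<open>\<theta>(1) = k\<pi>\<close> and \<open>dist = \<delta>\<close> have a common solution in the parameter plane
  (\<open>branch_meets_level\<close>). So the component of \<open>I\<^sub>k \<times> {0}\<close> is unbounded.

  The statement for \<open>S\<^sub>k\<^sup>-\<close> is the one for \<open>S\<^sub>k\<^sup>+\<close> applied to \<open>-F(x,-s,l)\<close>.
\<close>

section \<open>The power nonlinearity\<close>

lemma phi_eq_sgn: "phi p s = sgn s * \<bar>s\<bar> powr (p - 1)"
proof (cases "s = 0")
  case False
  then have "\<bar>s\<bar> powr (p - 1) = \<bar>s\<bar> powr (p - 2) * \<bar>s\<bar>"
    by (smt (verit) powr_add powr_one)
  then show ?thesis by (auto simp: phi_def sgn_if)
qed (auto simp: phi_def)

lemma phi_0 [simp]: "phi p 0 = 0"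
  by (simp add: phi_def)

lemma phi_minus [simp]: "phi p (- s) = - phi p s"
  by (simp add: phi_def)

lemma phi_eq_0_iff [simp]: "phi p s = 0 \<longleftrightarrow> s = 0"
  by (auto simp: phi_def)

lemma abs_phi: "\<bar>phi p s\<bar> = \<bar>s\<bar> powr (p - 1)"
  by (auto simp: phi_eq_sgn abs_mult sgn_if)

lemma sgn_phi [simp]: "sgn (phi p s) = sgn s"
  by (auto simp: phi_eq_sgn sgn_mult sgn_if)

lemma phi_pos_iff [simp]: "0 < phi p s \<longleftrightarrow> 0 < s"
  and phi_neg_iff [simp]: "phi p s < 0 \<longleftrightarrow> s < 0"
  using sgn_phi[of p s] by (metis sgn_1_pos, metis sgn_1_neg)

lemma phi_of_pos: "0 < s \<Longrightarrow> phi p s = s powr (p - 1)"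
  by (simp add: phi_eq_sgn)

lemma phi_mult: "phi p (s * t) = phi p s * phi p t"
  by (simp add: phi_def abs_mult powr_mult)

lemma phi_divide: "phi p (s / t) = phi p s / phi p t"
  by (simp add: phi_def powr_divide)

lemma phi_mult_self: "phi p s * s = \<bar>s\<bar> powr p"
proof (cases "s = 0")
  case False
  have "phi p s * s = \<bar>s\<bar> powr (p - 1) * \<bar>s\<bar> powr 1"
    using False by (auto simp: phi_eq_sgn sgn_if)
  also have "\<dots> = \<bar>s\<bar> powr p" by (simp only: powr_add [symmetric]) simp
  finally show ?thesis .
qed simp

lemma continuous_on_phi:
  assumes "1 < p" shows "continuous_on S (phi p)"
proof -
  have "continuous (at s) (phi p)" for s
  proof (cases "s = 0")
    case True
    have "((\<lambda>s. \<bar>s\<bar> powr (p - 1)) \<longlongrightarrow> \<bar>0\<bar> powr (p - 1)) (at 0)"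
      by (intro tendsto_powr' tendsto_intros) (use assms in auto)
    then have "((\<lambda>s. \<bar>phi p s\<bar>) \<longlongrightarrow> 0) (at 0)" by (simp add: abs_phi)
    then show ?thesis using True by (simp add: isCont_def tendsto_rabs_zero_iff)
  next
    case False
    then show ?thesis unfolding phi_def [abs_def]
      by (intro continuous_intros) auto
  qed
  then show ?thesis by (simp add: continuous_at_imp_continuous_on)
qed

lemma continuous_on_phi_comp [continuous_intros]:
  assumes "1 < p" "continuous_on S g" shows "continuous_on S (\<lambda>x. phi p (g x))"
  using continuous_on_compose2[OF continuous_on_phi[OF assms(1), of UNIV] assms(2)] by simp

lemma tendsto_phi [tendsto_intros]:
  assumes "1 < p" "(g \<longlongrightarrow> l) F" shows "((\<lambda>x. phi p (g x)) \<longlongrightarrow> phi p l) F"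
  using continuous_on_phi[OF assms(1), of UNIV] assms(2)
  by (simp add: continuous_on_eq_continuous_at isCont_tendsto_compose)

lemma has_real_derivative_phi:
  assumes "s \<noteq> 0"
  shows "(phi p has_real_derivative (p - 1) * \<bar>s\<bar> powr (p - 2)) (at s)"
proof -
  show ?thesis
  proof (cases "s > 0")
    case True
    have "((\<lambda>s. s powr (p - 1)) has_real_derivative (p - 1) * s powr (p - 1 - 1)) (at s)"
      using True by (rule has_real_derivative_powr)
    then have "(phi p has_real_derivative (p - 1) * s powr (p - 1 - 1)) (at s)"
      by (rule has_field_derivative_transform_within [where d = s])
         (use True in \<open>auto simp: dist_real_def phi_of_pos\<close>)
    then show ?thesis using True by simp
  next
    case False
    then have "s < 0" using assms by simp
    have "((\<lambda>s. - ((- s) powr (p - 1))) has_real_derivative - (((p - 1) * (- s) powr (p - 1 - 1)) * (-1))) (at s)"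
      using \<open>s < 0\<close>
      by (intro DERIV_minus DERIV_chain2[OF has_real_derivative_powr]) (auto intro!: derivative_eq_intros)
    then have "(phi p has_real_derivative - (((p - 1) * (- s) powr (p - 1 - 1)) * (-1))) (at s)"
      by (rule has_field_derivative_transform_within [where d = "-s"])
         (use \<open>s < 0\<close> in \<open>auto simp: dist_real_def phi_eq_sgn\<close>)
    then show ?thesis using \<open>s < 0\<close> by simp
  qed
qed

lemma has_real_derivative_abs_powr:
  assumes p: "1 < p"
  shows "((\<lambda>s. \<bar>s\<bar> powr p) has_real_derivative p * phi p s) (at s)"
proof (cases "s = 0")
  case True
  have "((\<lambda>h. phi p h) \<longlongrightarrow> phi p 0) (at 0)"
    using p by (intro tendsto_intros)
  moreover have "\<forall>\<^sub>F h in at 0. phi p h = \<bar>h\<bar> powr p / h"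
    by (auto simp: eventually_at_filter phi_mult_self [symmetric])
  ultimately have "((\<lambda>h. \<bar>h\<bar> powr p / h) \<longlongrightarrow> phi p 0) (at 0)"
    by (rule Lim_transform_eventually)
  then show ?thesis using True p by (simp add: DERIV_def)
next
  case False
  have "((\<lambda>s. phi p s * s) has_real_derivative
          ((p - 1) * \<bar>s\<bar> powr (p - 2) * s + 1 * phi p s)) (at s)"
    by (auto intro!: derivative_eq_intros has_real_derivative_phi False)
  moreover have "(p - 1) * \<bar>s\<bar> powr (p - 2) * s + 1 * phi p s = p * phi p s"
    by (simp add: phi_def algebra_simps)
  ultimately show ?thesis by (simp add: phi_mult_self)
qed

definition conj_exp :: "real \<Rightarrow> real" where
  "conj_exp p = p / (p - 1)"

lemma conj_exp_gt_1: "1 < p \<Longrightarrow> 1 < conj_exp p"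
  by (simp add: conj_exp_def)

lemma conj_exp_minus_1: "1 < p \<Longrightarrow> conj_exp p - 1 = 1 / (p - 1)"
  by (simp add: conj_exp_def field_simps)

lemma phi_phi_inverse:
  assumes "(p - 1) * (q - 1) = 1"
  shows "phi p (phi q s) = s"
proof (cases "s = 0")
  case False
  have "phi p (phi q s) = sgn (phi q s) * \<bar>phi q s\<bar> powr (p - 1)"
    by (rule phi_eq_sgn)
  also have "\<dots> = sgn s * \<bar>s\<bar> powr ((q - 1) * (p - 1))"
    by (simp only: sgn_phi abs_phi powr_powr)
  also have "(q - 1) * (p - 1) = 1" using assms by (simp add: mult.commute)
  also have "sgn s * \<bar>s\<bar> powr 1 = s" using False by (simp add: sgn_mult_abs)
  finally show ?thesis .
qed simp

lemma phi_inverse: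
  assumes "1 < p"
  shows "phi p (phi (conj_exp p) s) = s" "phi (conj_exp p) (phi p s) = s"
  using assms by (auto intro!: phi_phi_inverse simp: conj_exp_minus_1)

lemma abs_phi_conj_powr:
  assumes "1 < p"
  shows "\<bar>phi (conj_exp p) y\<bar> powr p = \<bar>y\<bar> powr conj_exp p"
  using assms by (simp add: abs_phi powr_powr conj_exp_minus_1) (simp add: conj_exp_def)

lemma powr_pminus1_mult_le:
  fixes a b p :: real
  assumes "0 \<le> a" "0 \<le> b" "1 < p"
  shows "a powr (p - 1) * b \<le> a powr p + b powr p"
proof -
  have split: "x powr (p - 1) * x = x powr p" if "0 \<le> x" for x
    using phi_mult_self[of p x] that by (cases "x = 0") (auto simp: phi_of_pos)
  show ?thesis
  proof (cases "b \<le> a")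
    case True
    then have "a powr (p - 1) * b \<le> a powr (p - 1) * a" by (simp add: mult_left_mono)
    then show ?thesis using split[OF assms(1)] by (simp add: add_increasing2)
  next
    case False
    then have "a powr (p - 1) * b \<le> b powr (p - 1) * b"
      using assms by (intro mult_right_mono powr_mono2) auto
    then show ?thesis using split[OF assms(2)] by (simp add: add_increasing)
  qed
qed

text \<open>Young's inequality, in the form that makes the Picone identity one-signed.\<close>

lemma young_phi:
  assumes p: "1 < p"
  shows "p * phi p t * y \<le> \<bar>y\<bar> powr p + (p - 1) * \<bar>t\<bar> powr p"
proof -
  have "\<bar>y\<bar> * \<bar>t\<bar> powr (p - 1) \<le> \<bar>y\<bar> powr p / p + (\<bar>t\<bar> powr (p - 1)) powr conj_exp p / conj_exp p"
    using p by (intro Youngs_inequality conj_exp_gt_1) (auto simp: conj_exp_def field_simps)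
  moreover have "(\<bar>t\<bar> powr (p - 1)) powr conj_exp p = \<bar>t\<bar> powr p"
    using p by (simp add: powr_powr conj_exp_def)
  ultimately have "p * (\<bar>y\<bar> * \<bar>t\<bar> powr (p - 1)) \<le> p * (\<bar>y\<bar> powr p / p + \<bar>t\<bar> powr p / conj_exp p)"
    using p by (intro mult_left_mono) auto
  also have "\<dots> = \<bar>y\<bar> powr p + (p - 1) * \<bar>t\<bar> powr p"
    using p by (simp add: conj_exp_def field_simps)
  finally have "p * (\<bar>y\<bar> * \<bar>t\<bar> powr (p - 1)) \<le> \<bar>y\<bar> powr p + (p - 1) * \<bar>t\<bar> powr p" .
  moreover have "phi p t * y \<le> \<bar>y\<bar> * \<bar>t\<bar> powr (p - 1)"
    using abs_ge_self[of "phi p t * y"] by (simp add: abs_mult abs_phi mult.commute)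
  then have "p * phi p t * y \<le> p * (\<bar>y\<bar> * \<bar>t\<bar> powr (p - 1))"
    using p by (simp add: mult.assoc)
  ultimately show ?thesis by linarith
qed

section \<open>Half-linear equations and Sturm comparison\<close>

text \<open>
  The equation \<open>(\<phi>\<^sub>p(u'))' + q(x) \<phi>\<^sub>p(u) = 0\<close> as a first-order system for \<open>u\<close> and \<open>v = \<phi>\<^sub>p(u')\<close>.
  The coefficient \<open>q\<close> may depend on the solution: a nonlinear problem becomes half-linear by
  dividing its right-hand side by \<open>\<phi>\<^sub>p(u)\<close>, and then \<open>q\<close> may jump at the zeros of \<open>u\<close>.
\<close>

definition half_linear :: "real \<Rightarrow> (real \<Rightarrow> real) \<Rightarrow> (real \<Rightarrow> real) \<Rightarrow> (real \<Rightarrow> real) \<Rightarrow> bool" where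
  "half_linear p q u v \<longleftrightarrow>
     (\<forall>x\<in>{0..1}. (u has_real_derivative phi (conj_exp p) (v x)) (at x within {0..1})) \<and>
     continuous_on {0..1} v \<and>
     (\<forall>x\<in>{0<..<1}. (v has_real_derivative - (q x * phi p (u x))) (at x))"

lemma half_linear_derivs:
  assumes "half_linear p q u v"
  shows "x \<in> {0..1} \<Longrightarrow> (u has_real_derivative phi (conj_exp p) (v x)) (at x within {0..1})"
    and "x \<in> {0<..<1} \<Longrightarrow> (u has_real_derivative phi (conj_exp p) (v x)) (at x)"
    and "x \<in> {0<..<1} \<Longrightarrow> (v has_real_derivative - (q x * phi p (u x))) (at x)"
proof -
  show 1: "x \<in> {0..1} \<Longrightarrow> (u has_real_derivative phi (conj_exp p) (v x)) (at x within {0..1})" for x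
    using assms unfolding half_linear_def by blast
  show "x \<in> {0<..<1} \<Longrightarrow> (u has_real_derivative phi (conj_exp p) (v x)) (at x)"
    using 1[of x] at_within_Icc_at[of 0 x 1] by simp
  show "x \<in> {0<..<1} \<Longrightarrow> (v has_real_derivative - (q x * phi p (u x))) (at x)"
    using assms unfolding half_linear_def by blast
qed

lemma half_linear_continuous:
  assumes "half_linear p q u v"
  shows "continuous_on {0..1} u" "continuous_on {0..1} v"
proof -
  show "continuous_on {0..1} u"
    using half_linear_derivs(1)[OF assms] DERIV_continuous continuous_on_eq_continuous_within by blast
  show "continuous_on {0..1} v"
    using assms by (simp add: half_linear_def)
qed

lemma half_linear_uminus:
  assumes "half_linear p q u v"
  shows "half_linear p q (\<lambda>x. - u x) (\<lambda>x. - v x)"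
  using assms unfolding half_linear_def
  by (auto intro!: continuous_intros derivative_eq_intros)

text \<open>
  The energy \<open>|u|\<^sup>p + |v|\<^sup>p\<^sup>'\<close> is, by homogeneity, its own Gronwall majorant. Hence a solution cannot
  reach the origin of the phase plane, and solutions with a small initial slope stay small.
\<close>

definition energy :: "real \<Rightarrow> (real \<Rightarrow> real) \<Rightarrow> (real \<Rightarrow> real) \<Rightarrow> real \<Rightarrow> real" where
  "energy p u v x = \<bar>u x\<bar> powr p + \<bar>v x\<bar> powr conj_exp p"

lemma energy_growth:
  assumes p: "1 < p" and hl: "half_linear p q u v"
    and q: "\<And>x. x \<in> {0<..<1} \<Longrightarrow> \<bar>q x\<bar> \<le> C"
    and xy: "0 \<le> x" "x \<le> y" "y \<le> 1"
  defines "K \<equiv> p + conj_exp p * C"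
  shows "energy p u v y \<le> exp (K * (y - x)) * energy p u v x"
    and "energy p u v x \<le> exp (K * (y - x)) * energy p u v y"
proof -
  let ?E = "energy p u v"
  define E' where "E' t = phi p (u t) * phi (conj_exp p) (v t) * (p - conj_exp p * q t)" for t
  have p': "1 < conj_exp p" using p by (rule conj_exp_gt_1)
  have dE: "(?E has_real_derivative E' t) (at t)" if "t \<in> {0<..<1}" for t
  proof -
    have "((\<lambda>t. \<bar>u t\<bar> powr p) has_real_derivative (p * phi p (u t)) * phi (conj_exp p) (v t)) (at t)"
      by (rule DERIV_chain2[OF has_real_derivative_abs_powr[OF p] half_linear_derivs(2)[OF hl that]])
    moreover have "((\<lambda>t. \<bar>v t\<bar> powr conj_exp p) has_real_derivative
        (conj_exp p * phi (conj_exp p) (v t)) * (- (q t * phi p (u t)))) (at t)"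
      by (rule DERIV_chain2[OF has_real_derivative_abs_powr[OF p'] half_linear_derivs(3)[OF hl that]])
    ultimately have "(?E has_real_derivative (p * phi p (u t)) * phi (conj_exp p) (v t) +
        (conj_exp p * phi (conj_exp p) (v t)) * (- (q t * phi p (u t)))) (at t)"
      unfolding energy_def [abs_def] by (rule DERIV_add)
    then show ?thesis by (rule DERIV_cong) (simp add: E'_def algebra_simps)
  qed
  have E'_le: "\<bar>E' t\<bar> \<le> K * ?E t" if "t \<in> {0<..<1}" for t
  proof -
    have "\<bar>conj_exp p * q t\<bar> \<le> conj_exp p * C"
      using q[OF that] p' by (simp add: abs_mult)
    then have K: "\<bar>p - conj_exp p * q t\<bar> \<le> K" using p unfolding K_def by linarith
    have "\<bar>E' t\<bar> = (\<bar>u t\<bar> powr (p - 1) * \<bar>phi (conj_exp p) (v t)\<bar>) * \<bar>p - conj_exp p * q t\<bar>"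
      by (simp add: E'_def abs_mult abs_phi[of p "u t"])
    also have "\<dots> \<le> ?E t * K"
    proof (rule mult_mono[OF _ K])
      show "\<bar>u t\<bar> powr (p - 1) * \<bar>phi (conj_exp p) (v t)\<bar> \<le> ?E t"
        using powr_pminus1_mult_le[OF abs_ge_zero abs_ge_zero p] abs_phi_conj_powr[OF p]
        unfolding energy_def by metis
    qed (simp_all add: energy_def)
    finally show ?thesis by (simp add: mult.commute)
  qed
  have cE: "continuous_on {0..1} ?E"
    unfolding energy_def [abs_def] using p p'
    by (intro continuous_intros continuous_on_powr' half_linear_continuous[OF hl]) auto
  have "exp (- K * y) * ?E y \<le> exp (- K * x) * ?E x"
  proof (rule DERIV_nonpos_imp_decreasing_open[OF xy(2)])
    fix t assume "x < t" "t < y"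
    then have t: "t \<in> {0<..<1}" using xy by auto
    have "((\<lambda>t. exp (- K * t) * ?E t) has_real_derivative
            exp (- K * t) * (E' t - K * ?E t)) (at t)"
      by (auto intro!: derivative_eq_intros dE[OF t] simp: algebra_simps)
    moreover have "exp (- K * t) * (E' t - K * ?E t) \<le> 0"
      using E'_le[OF t] by (intro mult_nonneg_nonpos) auto
    ultimately show "\<exists>d. ((\<lambda>t. exp (- K * t) * ?E t) has_real_derivative d) (at t) \<and> d \<le> 0" by blast
  next
    show "continuous_on {x..y} (\<lambda>t. exp (- K * t) * ?E t)"
      using xy by (intro continuous_intros continuous_on_subset[OF cE]) auto
  qed
  then have "exp (K * y) * (exp (- K * y) * ?E y) \<le> exp (K * y) * (exp (- K * x) * ?E x)"
    by (intro mult_left_mono) auto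
  then show "?E y \<le> exp (K * (y - x)) * ?E x"
    by (simp add: mult.assoc [symmetric] exp_add [symmetric] algebra_simps)
  have "exp (K * x) * ?E x \<le> exp (K * y) * ?E y"
  proof (rule DERIV_nonneg_imp_increasing_open[OF xy(2)])
    fix t assume "x < t" "t < y"
    then have t: "t \<in> {0<..<1}" using xy by auto
    have "((\<lambda>t. exp (K * t) * ?E t) has_real_derivative
            exp (K * t) * (E' t + K * ?E t)) (at t)"
      by (auto intro!: derivative_eq_intros dE[OF t] simp: algebra_simps)
    moreover have "0 \<le> exp (K * t) * (E' t + K * ?E t)"
      using E'_le[OF t] by (intro mult_nonneg_nonneg) auto
    ultimately show "\<exists>d. ((\<lambda>t. exp (K * t) * ?E t) has_real_derivative d) (at t) \<and> d \<ge> 0" by blast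
  next
    show "continuous_on {x..y} (\<lambda>t. exp (K * t) * ?E t)"
      using xy by (intro continuous_intros continuous_on_subset[OF cE]) auto
  qed
  then have "exp (- K * x) * (exp (K * x) * ?E x) \<le> exp (- K * x) * (exp (K * y) * ?E y)"
    by (intro mult_left_mono) auto
  then show "?E x \<le> exp (K * (y - x)) * ?E y"
    by (simp add: mult.assoc [symmetric] exp_add [symmetric] algebra_simps)
qed

lemma energy_pos_iff: "0 < energy p u v x \<longleftrightarrow> u x \<noteq> 0 \<or> v x \<noteq> 0"
  by (auto simp: energy_def add_pos_nonneg add_nonneg_pos)

lemma half_linear_nonvanishing:
  assumes p: "1 < p" and hl: "half_linear p q u v"
    and q: "\<And>x. x \<in> {0<..<1} \<Longrightarrow> \<bar>q x\<bar> \<le> C"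
    and y: "y \<in> {0..1}" "u y \<noteq> 0 \<or> v y \<noteq> 0" and x: "x \<in> {0..1}"
  shows "u x \<noteq> 0 \<or> v x \<noteq> 0"
proof -
  have "0 < energy p u v y" using y by (simp add: energy_pos_iff)
  moreover have "\<exists>c>0. energy p u v y \<le> c * energy p u v x"
    using energy_growth[OF p hl q, of y x] energy_growth[OF p hl q, of x y] x y
    by (cases "x \<le> y") (auto intro!: exI[of _ "exp _"])
  ultimately have "0 < energy p u v x" by (metis less_le_trans zero_less_mult_pos)
  then show ?thesis by (simp add: energy_pos_iff)
qed

lemma half_linear_small:
  assumes p: "1 < p" and hl: "half_linear p q u v"
    and q: "\<And>x. x \<in> {0<..<1} \<Longrightarrow> \<bar>q x\<bar> \<le> C"
    and init: "u 0 = 0" "v 0 = phi p \<alpha>" "0 < \<alpha>" and x: "x \<in> {0..1}" and C: "0 \<le> C"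
  shows "\<bar>u x\<bar> \<le> \<alpha> * exp ((p + conj_exp p * C) / p)"
    and "\<bar>phi (conj_exp p) (v x)\<bar> \<le> \<alpha> * exp ((p + conj_exp p * C) / p)"
proof -
  define K where "K = p + conj_exp p * C"
  have K: "0 \<le> K" unfolding K_def using p conj_exp_gt_1[OF p] C by simp
  have cancel: "a \<le> b" if "a powr p \<le> b powr p" "0 \<le> a" "0 \<le> b" for a b :: real
    using that p powr_less_mono2[of p b a] by linarith
  have bound: "energy p u v x \<le> (\<alpha> * exp (K / p)) powr p"
  proof -
    have "energy p u v x \<le> exp (K * (x - 0)) * energy p u v 0"
      using energy_growth(1)[OF p hl q, of 0 x] x unfolding K_def by auto
    also have "energy p u v 0 = \<alpha> powr p"
      using init p abs_phi_conj_powr[OF p, of "phi p \<alpha>"] by (simp add: energy_def phi_inverse)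
    also have "exp (K * (x - 0)) * \<alpha> powr p \<le> exp K * \<alpha> powr p"
      using x K by (intro mult_right_mono) (auto intro: mult_left_le)
    also have "exp K * \<alpha> powr p = (\<alpha> * exp (K / p)) powr p"
      using init p by (simp add: powr_mult exp_powr_real)
    finally show ?thesis .
  qed
  have "\<bar>u x\<bar> powr p \<le> (\<alpha> * exp (K / p)) powr p"
    by (rule order_trans[OF _ bound]) (simp add: energy_def)
  then show "\<bar>u x\<bar> \<le> \<alpha> * exp ((p + conj_exp p * C) / p)"
    using init unfolding K_def by - (rule cancel, auto)
  have "\<bar>phi (conj_exp p) (v x)\<bar> powr p \<le> (\<alpha> * exp (K / p)) powr p"
    by (rule order_trans[OF _ bound]) (simp add: energy_def abs_phi_conj_powr[OF p])
  then show "\<bar>phi (conj_exp p) (v x)\<bar> \<le> \<alpha> * exp ((p + conj_exp p * C) / p)"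
    using init unfolding K_def by - (rule cancel, auto)
qed

text \<open>
  The Picone function \<open>|w|\<^sup>p v / \<phi>\<^sub>p(u)\<close>, written as \<open>w \<phi>\<^sub>p(w/u) v\<close>. In this form it visibly
  tends to \<open>0\<close> at a common zero of \<open>w\<close> and \<open>u\<close>, as \<open>w/u\<close> stays bounded there; with the
  convention \<open>w/0 = 0\<close> it also has the value \<open>0\<close>.
\<close>

definition picone :: "real \<Rightarrow> (real \<Rightarrow> real) \<Rightarrow> (real \<Rightarrow> real) \<Rightarrow> (real \<Rightarrow> real) \<Rightarrow> real \<Rightarrow> real" where
  "picone p w u v x = w x * phi p (w x / u x) * v x"

lemma picone_endpoint:
  assumes p: "1 < p"
    and w: "(w has_real_derivative w') (at z within S)" "w z = 0"
    and u: "(u has_real_derivative u') (at z within S)" "u z \<noteq> 0 \<or> u' \<noteq> 0"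
    and v: "(v \<longlongrightarrow> v z) (at z within S)"
  shows "(picone p w u v \<longlongrightarrow> 0) (at z within S)"
proof -
  have w0: "(w \<longlongrightarrow> 0) (at z within S)"
    using DERIV_continuous[OF w(1)] w(2) by (simp add: continuous_within)
  obtain l where l: "((\<lambda>x. w x / u x) \<longlongrightarrow> l) (at z within S)"
  proof (cases "u z = 0")
    case False
    have "(u \<longlongrightarrow> u z) (at z within S)"
      using DERIV_continuous[OF u(1)] by (simp add: continuous_within)
    from tendsto_divide[OF w0 this False] show ?thesis by (rule that)
  next
    case True
    have "((\<lambda>x. ((w x - w z) / (x - z)) / ((u x - u z) / (x - z))) \<longlongrightarrow> w' / u') (at z within S)"
      using w(1) u True unfolding has_field_derivative_iff by (intro tendsto_divide) auto
    moreover have "\<forall>\<^sub>F x in at z within S. ((w x - w z) / (x - z)) / ((u x - u z) / (x - z)) = w x / u x"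
      using True w(2) by (auto simp: eventually_at_filter)
    ultimately have "((\<lambda>x. w x / u x) \<longlongrightarrow> w' / u') (at z within S)"
      by (rule Lim_transform_eventually)
    then show ?thesis by (rule that)
  qed
  have "((\<lambda>x. w x * phi p (w x / u x) * v x) \<longlongrightarrow> 0 * phi p l * v z) (at z within S)"
    using p by (intro tendsto_intros w0 l v)
  then show ?thesis unfolding picone_def [abs_def] by simp
qed

lemma picone_derivative:
  assumes p: "1 < p" and hl: "half_linear p q u v" and x: "x \<in> {0<..<1}" and u: "0 < u x"
    and w: "(w has_real_derivative w') (at x)"
  defines "t \<equiv> w x * phi (conj_exp p) (v x) / u x"
  shows "(picone p w u v has_real_derivative
           (p * phi p t * w' - (p - 1) * \<bar>t\<bar> powr p - q x * \<bar>w x\<bar> powr p)) (at x)"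
proof -
  let ?\<psi> = "phi (conj_exp p) (v x)"
  have eq: "picone p w u v = (\<lambda>x. \<bar>w x\<bar> powr p * (v x / phi p (u x)))"
    by (auto simp: picone_def phi_divide phi_mult_self [symmetric])
  have v: "v x = phi p ?\<psi>" using p by (simp add: phi_inverse)
  have "((\<lambda>x. \<bar>w x\<bar> powr p) has_real_derivative (p * phi p (w x)) * w') (at x)"
    by (rule DERIV_chain2[OF has_real_derivative_abs_powr[OF p] w])
  moreover have "((\<lambda>x. phi p (u x)) has_real_derivative ((p - 1) * \<bar>u x\<bar> powr (p - 2)) * ?\<psi>) (at x)"
    by (rule DERIV_chain2[OF has_real_derivative_phi half_linear_derivs(2)[OF hl x]]) (use u in auto)
  ultimately have "(picone p w u v has_real_derivative
      (p * phi p (w x)) * w' * (v x / phi p (u x)) +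
      ((- (q x * phi p (u x)) * phi p (u x) - v x * (((p - 1) * \<bar>u x\<bar> powr (p - 2)) * ?\<psi>))
        / (phi p (u x) * phi p (u x))) * \<bar>w x\<bar> powr p) (at x)" (is "(_ has_real_derivative ?D) _")
    unfolding eq by (intro DERIV_mult DERIV_divide half_linear_derivs(3)[OF hl x]) (use u in auto)
  moreover have "?D = p * phi p t * w' - (p - 1) * \<bar>t\<bar> powr p - q x * \<bar>w x\<bar> powr p"
  proof -
    have 1: "phi p t = phi p (w x) * v x / phi p (u x)"
      using v by (simp add: t_def phi_divide phi_mult)
    have 2: "\<bar>t\<bar> powr p = \<bar>w x\<bar> powr p * (v x * ?\<psi>) / \<bar>u x\<bar> powr p"
    proof -
      have "v x * ?\<psi> = \<bar>?\<psi>\<bar> powr p" by (metis v phi_mult_self)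
      then show ?thesis by (simp add: t_def abs_mult powr_mult powr_divide)
    qed
    have 3: "\<bar>u x\<bar> powr (p - 2) / (phi p (u x) * phi p (u x)) = 1 / \<bar>u x\<bar> powr p"
    proof -
      have "phi p (u x) * u x = \<bar>u x\<bar> powr p" by (rule phi_mult_self)
      moreover have "phi p (u x) = \<bar>u x\<bar> powr (p - 2) * u x" by (simp add: phi_def)
      ultimately show ?thesis using u by (auto simp: field_simps)
    qed
    have pos: "phi p (u x) \<noteq> 0" using u by simp
    have "?D = p * (phi p (w x) * v x / phi p (u x)) * w' - q x * \<bar>w x\<bar> powr p
       - (p - 1) * (\<bar>w x\<bar> powr p * (v x * ?\<psi>)) * (\<bar>u x\<bar> powr (p - 2) / (phi p (u x) * phi p (u x)))"
      using pos by (simp add: field_simps)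
    also have "\<dots> = p * phi p t * w' - (p - 1) * \<bar>t\<bar> powr p - q x * \<bar>w x\<bar> powr p"
      unfolding 1 2 3 by simp
    finally show ?thesis .
  qed
  ultimately show ?thesis by simp
qed

lemma picone_continuous:
  assumes p: "1 < p" and hl: "half_linear p q u v"
    and ce: "0 \<le> c" "c < e" "e \<le> 1" and u: "\<And>x. c < x \<Longrightarrow> x < e \<Longrightarrow> 0 < u x"
    and nd: "\<And>x. x \<in> {0..1} \<Longrightarrow> u x \<noteq> 0 \<or> v x \<noteq> 0"
    and w: "\<And>x. x \<in> {c..e} \<Longrightarrow> (w has_real_derivative w' x) (at x within {c..e})"
    and w0: "w c = 0" "w e = 0"
  shows "continuous_on {c..e} (picone p w u v)"
  unfolding continuous_on_def
proof
  fix x assume x: "x \<in> {c..e}"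
  have du: "(u has_real_derivative phi (conj_exp p) (v x)) (at x within {c..e})"
    using x ce by (intro DERIV_subset[OF half_linear_derivs(1)[OF hl]]) auto
  have v: "(v \<longlongrightarrow> v x) (at x within {c..e})"
    using continuous_on_subset[OF half_linear_continuous(2)[OF hl], of "{c..e}"] x ce
    unfolding continuous_on_def by auto
  show "(picone p w u v \<longlongrightarrow> picone p w u v x) (at x within {c..e})"
  proof (cases "w x = 0")
    case True
    have "(picone p w u v \<longlongrightarrow> 0) (at x within {c..e})"
      using nd[of x] x ce by (intro picone_endpoint[OF p w[OF x] True du _ v]) auto
    then show ?thesis using True by (simp add: picone_def)
  next
    case False
    then have "c < x" "x < e" using w0 x by (auto simp: order_less_le)
    then have "u x \<noteq> 0" using u by fastforce
    then show ?thesis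
      using DERIV_continuous[OF du] DERIV_continuous[OF w[OF x]] v p
      unfolding picone_def [abs_def] continuous_within by (intro tendsto_intros) auto
  qed
qed

text \<open>
  The Wronskian-like difference of \<open>u\<^sub>1 v\<^sub>1\<close> and the Picone function is monotone if
  \<open>q\<^sub>1 \<le> q\<^sub>2\<close>, because its derivative is \<open>(q\<^sub>2 - q\<^sub>1) u\<^sub>1\<^sup>p\<close> plus the Young defect, and it vanishes
  at both ends of a nodal interval of \<open>u\<^sub>1\<close>.
\<close>

lemma picone_difference:
  assumes p: "1 < p" and hl1: "half_linear p q1 u1 v1" and hl2: "half_linear p q2 u2 v2"
    and ce: "0 \<le> c" "c < e" "e \<le> 1"
    and u1: "u1 c = 0" "u1 e = 0"
    and u2': "\<forall>x. c < x \<and> x < e \<longrightarrow> 0 < u2 x"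
    and nd2': "\<forall>x\<in>{0..1}. u2 x \<noteq> 0 \<or> v2 x \<noteq> 0"
    and D_def: "D = (\<lambda>x. u1 x * v1 x - picone p u1 u2 v2 x)"
    and t_def: "t = (\<lambda>x. u1 x * phi (conj_exp p) (v2 x) / u2 x)"
  shows "continuous_on {c..e} D" "D c = 0" "D e = 0"
    and "\<And>x. c < x \<Longrightarrow> x < e \<Longrightarrow> (D has_real_derivative
           (q2 x - q1 x) * \<bar>u1 x\<bar> powr p + (\<bar>phi (conj_exp p) (v1 x)\<bar> powr p
             + (p - 1) * \<bar>t x\<bar> powr p - p * phi p (t x) * phi (conj_exp p) (v1 x))) (at x)"
proof -
  have u2: "\<And>x. c < x \<Longrightarrow> x < e \<Longrightarrow> 0 < u2 x"
    and nd2: "\<And>x. x \<in> {0..1} \<Longrightarrow> u2 x \<noteq> 0 \<or> v2 x \<noteq> 0"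
    using u2' nd2' by auto
  have du1: "(u1 has_real_derivative phi (conj_exp p) (v1 x)) (at x within {c..e})" if "x \<in> {c..e}" for x
    using that ce by (intro DERIV_subset[OF half_linear_derivs(1)[OF hl1]]) auto
  have "continuous_on {c..e} (picone p u1 u2 v2)"
    by (rule picone_continuous[OF p hl2 ce u2 nd2 du1 u1])
  moreover have "{c..e} \<subseteq> {0..1}" using ce by auto
  ultimately show "continuous_on {c..e} D"
    unfolding D_def
    by (intro continuous_intros) (auto intro: continuous_on_subset half_linear_continuous[OF hl1])
  show "D c = 0" "D e = 0" using u1 by (auto simp: D_def picone_def)
  fix x assume xce: "c < x" "x < e"
  then have x: "x \<in> {0<..<1}" using ce by auto
  let ?\<psi> = "phi (conj_exp p) (v1 x)"
  have "v1 x * ?\<psi> = \<bar>?\<psi>\<bar> powr p" by (metis phi_inverse(1)[OF p] phi_mult_self)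
  then have "((\<lambda>x. u1 x * v1 x) has_real_derivative \<bar>?\<psi>\<bar> powr p - q1 x * \<bar>u1 x\<bar> powr p) (at x)"
    by (auto intro!: derivative_eq_intros half_linear_derivs[OF hl1] x
        simp: phi_mult_self [symmetric] algebra_simps)
  from DERIV_diff[OF this picone_derivative[OF p hl2 x u2[OF xce] half_linear_derivs(2)[OF hl1 x]]]
  show "(D has_real_derivative (q2 x - q1 x) * \<bar>u1 x\<bar> powr p + (\<bar>?\<psi>\<bar> powr p
       + (p - 1) * \<bar>t x\<bar> powr p - p * phi p (t x) * ?\<psi>)) (at x)"
    unfolding D_def t_def by (rule DERIV_cong) (simp add: algebra_simps)
qed

text \<open>
  The difference above would be strictly increasing, but it is \<open>0\<close> at both ends.
\<close>

lemma sturm_strict_pos: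
  assumes p: "1 < p" and hl1: "half_linear p q1 u1 v1" and hl2: "half_linear p q2 u2 v2"
    and ce: "0 \<le> c" "c < e" "e \<le> 1"
    and u1: "u1 c = 0" "u1 e = 0" "\<And>x. c < x \<Longrightarrow> x < e \<Longrightarrow> u1 x \<noteq> 0"
    and u2: "\<And>x. c < x \<Longrightarrow> x < e \<Longrightarrow> 0 < u2 x"
    and nd2: "\<And>x. x \<in> {0..1} \<Longrightarrow> u2 x \<noteq> 0 \<or> v2 x \<noteq> 0"
    and q: "\<And>x. c < x \<Longrightarrow> x < e \<Longrightarrow> q1 x < q2 x"
  shows False
proof -
  define D where "D = (\<lambda>x. u1 x * v1 x - picone p u1 u2 v2 x)"
  have "\<forall>x. c < x \<and> x < e \<longrightarrow> 0 < u2 x" "\<forall>x\<in>{0..1}. u2 x \<noteq> 0 \<or> v2 x \<noteq> 0"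
    using u2 nd2 by auto
  note D = picone_difference[OF p hl1 hl2 ce u1(1,2) this D_def refl]
  have "D c < D e"
  proof (rule DERIV_pos_imp_increasing_open[OF ce(2) _ D(1)])
    fix x assume x: "c < x" "x < e"
    have "0 < (q2 x - q1 x) * \<bar>u1 x\<bar> powr p"
      using q[OF x] u1(3)[OF x] by simp
    then show "\<exists>y. (D has_real_derivative y) (at x) \<and> 0 < y"
      using D(4)[OF x] young_phi[OF p] by (metis add_pos_nonneg diff_ge_0_iff_ge)
  qed
  then show False using D by simp
qed

text \<open>
  For \<open>q\<^sub>1 = q\<^sub>2\<close> the difference may be constant, which forces equality in Young's inequality. The
  half-open interval in the hypothesis on \<open>u\<^sub>2\<close> rules this out at the end \<open>e\<close>.
\<close>

lemma sturm_weak_pos: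
  assumes p: "1 < p" and hl1: "half_linear p q1 u1 v1" and hl2: "half_linear p q2 u2 v2"
    and ce: "0 \<le> c" "c < e" "e \<le> 1"
    and u1: "u1 c = 0" "u1 e = 0" "v1 e \<noteq> 0"
    and u2: "\<And>x. c < x \<Longrightarrow> x \<le> e \<Longrightarrow> 0 < u2 x"
    and nd2: "\<And>x. x \<in> {0..1} \<Longrightarrow> u2 x \<noteq> 0 \<or> v2 x \<noteq> 0"
    and q: "\<And>x. c < x \<Longrightarrow> x < e \<Longrightarrow> q1 x \<le> q2 x"
  shows False
proof -
  define D where "D = (\<lambda>x. u1 x * v1 x - picone p u1 u2 v2 x)"
  define t where "t = (\<lambda>x. u1 x * phi (conj_exp p) (v2 x) / u2 x)"
  define Y where "Y x = \<bar>phi (conj_exp p) (v1 x)\<bar> powr p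
      + (p - 1) * \<bar>t x\<bar> powr p - p * phi p (t x) * phi (conj_exp p) (v1 x)" for x
  have "\<forall>x. c < x \<and> x < e \<longrightarrow> 0 < u2 x" "\<forall>x\<in>{0..1}. u2 x \<noteq> 0 \<or> v2 x \<noteq> 0"
    using u2 nd2 by auto
  note D = picone_difference[OF p hl1 hl2 ce u1(1,2) this D_def t_def, folded Y_def]
  have nonneg: "0 \<le> (q2 x - q1 x) * \<bar>u1 x\<bar> powr p" "0 \<le> Y x" if "c < x" "x < e" for x
    using q[OF that] young_phi[OF p, of "t x" "phi (conj_exp p) (v1 x)"] by (auto simp: Y_def)
  have mono: "D x \<le> D y" if "c \<le> x" "x \<le> y" "y \<le> e" for x y
  proof (rule DERIV_nonneg_imp_increasing_open[OF that(2)])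
    fix z assume "x < z" "z < y"
    then have "c < z" "z < e" using that by auto
    then show "\<exists>d. (D has_real_derivative d) (at z) \<and> 0 \<le> d"
      using D(4)[of z] nonneg[of z] by (meson add_nonneg_nonneg)
  qed (rule continuous_on_subset[OF D(1)], use that in auto)
  have D0: "D x = 0" if "c \<le> x" "x \<le> e" for x
    using mono[of c x] mono[of x e] D(2,3) that by auto
  have Y0: "Y x \<le> 0" if x: "c < x" "x < e" for x
  proof -
    have "(D has_real_derivative 0) (at x)"
      by (rule has_field_derivative_transform_within_open[OF DERIV_const, of "{c<..<e}" _ 0])
         (use x D0 in auto)
    then show ?thesis using D(4)[OF x] nonneg[OF x] DERIV_unique by fastforce
  qed
  \<comment> \<open>At the right end \<open>t\<close> vanishes, so the Young defect tends to \<open>|u\<^sub>1'(e)|\<^sup>p > 0\<close>.\<close>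
  let ?F = "at e within {c<..<e}"
  have lim: "(f \<longlongrightarrow> f e) ?F" if "continuous_on {0..1} f" for f :: "real \<Rightarrow> real"
  proof -
    have "(f \<longlongrightarrow> f e) (at e within {0..1})" using that ce unfolding continuous_on_def by auto
    then show ?thesis by (rule tendsto_within_subset) (use ce in auto)
  qed
  note l = lim[OF half_linear_continuous(1)[OF hl1]] lim[OF half_linear_continuous(2)[OF hl1]]
    lim[OF half_linear_continuous(1)[OF hl2]] lim[OF half_linear_continuous(2)[OF hl2]]
  have "u2 e \<noteq> 0" using u2[of e] ce by auto
  then have "(Y \<longlongrightarrow> Y e) ?F"
    unfolding Y_def t_def using p conj_exp_gt_1[OF p]
    by (intro tendsto_intros tendsto_powr' l) auto
  moreover have "Y e = \<bar>phi (conj_exp p) (v1 e)\<bar> powr p"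
    using u1 by (simp add: Y_def t_def)
  moreover have "\<forall>\<^sub>F x in ?F. Y x \<le> 0"
    using Y0 by (auto simp: eventually_at_filter)
  moreover have "?F \<noteq> bot"
    using ce by (simp add: at_within_eq_bot_iff trivial_limit_within islimpt_greaterThanLessThan2)
  ultimately have "\<bar>phi (conj_exp p) (v1 e)\<bar> powr p \<le> 0"
    by (metis tendsto_upperbound)
  then show False using u1 by simp
qed

lemma nonzero_constant_sign:
  fixes u :: "real \<Rightarrow> real"
  assumes "continuous_on S u" "connected S" "\<And>x. x \<in> S \<Longrightarrow> u x \<noteq> 0"
  shows "(\<forall>x\<in>S. 0 < u x) \<or> (\<forall>x\<in>S. u x < 0)"
proof (rule ccontr)
  assume "\<not> ?thesis"
  then obtain x y where "x \<in> S" "y \<in> S" "u x < 0" "0 < u y" using assms(3)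
    by (meson linorder_neqE_linordered_idom)
  moreover have "connected (u ` S)" using assms by (simp add: connected_continuous_image)
  ultimately have "0 \<in> u ` S"
    by (meson connectedD_interval imageI less_imp_le)
  then show False using assms(3) by auto
qed

theorem sturm_strict:
  assumes p: "1 < p" and hl1: "half_linear p q1 u1 v1" and hl2: "half_linear p q2 u2 v2"
    and ce: "0 \<le> c" "c < e" "e \<le> 1"
    and u1: "u1 c = 0" "u1 e = 0" "\<And>x. c < x \<Longrightarrow> x < e \<Longrightarrow> u1 x \<noteq> 0"
    and nd2: "\<And>x. x \<in> {0..1} \<Longrightarrow> u2 x \<noteq> 0 \<or> v2 x \<noteq> 0"
    and q: "\<And>x. c < x \<Longrightarrow> x < e \<Longrightarrow> q1 x < q2 x"
  shows "\<exists>x. c < x \<and> x < e \<and> u2 x = 0"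
proof (rule ccontr)
  assume "\<not> ?thesis"
  then have "(\<forall>x\<in>{c<..<e}. 0 < u2 x) \<or> (\<forall>x\<in>{c<..<e}. u2 x < 0)"
    by (intro nonzero_constant_sign continuous_on_subset[OF half_linear_continuous(1)[OF hl2]])
       (use ce in auto)
  then show False
  proof
    assume "\<forall>x\<in>{c<..<e}. 0 < u2 x"
    then show False using sturm_strict_pos[OF p hl1 hl2 ce u1 _ nd2 q] by auto
  next
    assume "\<forall>x\<in>{c<..<e}. u2 x < 0"
    then show False using sturm_strict_pos[OF p hl1 half_linear_uminus[OF hl2] ce u1 _ _ q] nd2 by auto
  qed
qed

theorem sturm_weak:
  assumes p: "1 < p" and hl1: "half_linear p q1 u1 v1" and hl2: "half_linear p q2 u2 v2"
    and ce: "0 \<le> c" "c < e" "e \<le> 1"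
    and u1: "u1 c = 0" "u1 e = 0" "v1 e \<noteq> 0"
    and nd2: "\<And>x. x \<in> {0..1} \<Longrightarrow> u2 x \<noteq> 0 \<or> v2 x \<noteq> 0"
    and q: "\<And>x. c < x \<Longrightarrow> x < e \<Longrightarrow> q1 x \<le> q2 x"
  shows "\<exists>x. c < x \<and> x \<le> e \<and> u2 x = 0"
proof (rule ccontr)
  assume "\<not> ?thesis"
  then have "(\<forall>x\<in>{c<..e}. 0 < u2 x) \<or> (\<forall>x\<in>{c<..e}. u2 x < 0)"
    by (intro nonzero_constant_sign continuous_on_subset[OF half_linear_continuous(1)[OF hl2]])
       (use ce in auto)
  then show False
  proof
    assume "\<forall>x\<in>{c<..e}. 0 < u2 x"
    then show False using sturm_weak_pos[OF p hl1 hl2 ce u1 _ nd2 q] by auto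
  next
    assume "\<forall>x\<in>{c<..e}. u2 x < 0"
    then show False using sturm_weak_pos[OF p hl1 half_linear_uminus[OF hl2] ce u1 _ _ q] nd2 by auto
  qed
qed

text \<open>
  If \<open>u\<close> had no zero, the Picone inequality for \<open>w(x) = (x - c)(e - x)\<close> would give
  \<open>\<integral> |w'|\<^sup>p \<ge> Q \<integral> w\<^sup>p\<close>, which fails for large \<open>Q\<close>. This is what makes the eigenvalues exist.
\<close>

lemma large_coefficient_zero:
  assumes p: "1 < p" and ce: "0 \<le> c" "c < e" "e \<le> 1"
  obtains Q where "\<And>q u v. half_linear p q u v \<Longrightarrow>
     (\<And>x. x \<in> {0..1} \<Longrightarrow> u x \<noteq> 0 \<or> v x \<noteq> 0) \<Longrightarrow> (\<And>x. c < x \<Longrightarrow> x < e \<Longrightarrow> Q \<le> q x) \<Longrightarrow>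
     \<exists>x. c < x \<and> x < e \<and> u x = 0"
proof -
  define w where "w x = (x - c) * (e - x)" for x :: real
  define w' where "w' x = (e - x) - (x - c)" for x :: real
  have dw: "(w has_real_derivative w' x) (at x within S)" for x S
    unfolding w_def [abs_def] w'_def by (auto intro!: derivative_eq_intros)
  have cw: "continuous_on {c..e} (\<lambda>x. \<bar>w x\<bar> powr p)" "continuous_on {c..e} (\<lambda>x. \<bar>w' x\<bar> powr p)"
    unfolding w_def w'_def using p by (intro continuous_on_powr' continuous_intros; auto)+
  define A where "A x = integral {c..x} (\<lambda>x. \<bar>w' x\<bar> powr p)" for x
  define B where "B x = integral {c..x} (\<lambda>x. \<bar>w x\<bar> powr p)" for x
  have dA: "(A has_real_derivative \<bar>w' x\<bar> powr p) (at x within {c..e})" if "x \<in> {c..e}" for x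
    unfolding A_def [abs_def] by (rule integral_has_real_derivative[OF cw(2) that])
  have dB: "(B has_real_derivative \<bar>w x\<bar> powr p) (at x within {c..e})" if "x \<in> {c..e}" for x
    unfolding B_def [abs_def] by (rule integral_has_real_derivative[OF cw(1) that])
  have cA: "continuous_on {c..e} A" and cB: "continuous_on {c..e} B"
    using dA dB DERIV_continuous continuous_on_eq_continuous_within by blast+
  have AB0: "A c = 0" "B c = 0" by (simp_all add: A_def B_def)
  have "B c < B e"
  proof (rule DERIV_pos_imp_increasing_open[OF ce(2) _ cB])
    fix x assume "c < x" "x < e"
    then show "\<exists>y. (B has_real_derivative y) (at x) \<and> 0 < y"
      using dB[of x] at_within_Icc_at[of c x e] by (auto simp: w_def intro!: exI[of _ "\<bar>w x\<bar> powr p"])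
  qed
  then have Bpos: "0 < B e" using AB0 by simp
  define Q where "Q = (A e + 1) / B e"
  have pos: False if hl: "half_linear p q u v" and nd: "\<And>x. x \<in> {0..1} \<Longrightarrow> u x \<noteq> 0 \<or> v x \<noteq> 0"
    and q: "\<And>x. c < x \<Longrightarrow> x < e \<Longrightarrow> Q \<le> q x" and u: "\<And>x. c < x \<Longrightarrow> x < e \<Longrightarrow> 0 < u x" for q u v
  proof -
    let ?N = "\<lambda>x. A x - Q * B x - picone p w u v x"
    have "?N c \<le> ?N e"
    proof (rule DERIV_nonneg_imp_increasing_open[of c e ?N])
      fix x assume x: "c < x" "x < e"
      define t where "t = w x * phi (conj_exp p) (v x) / u x"
      have "(picone p w u v has_real_derivative
           (p * phi p t * w' x - (p - 1) * \<bar>t\<bar> powr p - q x * \<bar>w x\<bar> powr p)) (at x)"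
        unfolding t_def using x ce by (intro picone_derivative[OF p hl] u dw) auto
      moreover have "(A has_real_derivative \<bar>w' x\<bar> powr p) (at x)"
        "(B has_real_derivative \<bar>w x\<bar> powr p) (at x)"
        using dA[of x] dB[of x] at_within_Icc_at[of c x e] x by auto
      ultimately have "(?N has_real_derivative (\<bar>w' x\<bar> powr p - Q * \<bar>w x\<bar> powr p
          - (p * phi p t * w' x - (p - 1) * \<bar>t\<bar> powr p - q x * \<bar>w x\<bar> powr p))) (at x)"
        by (auto intro!: derivative_eq_intros)
      moreover have "Q * \<bar>w x\<bar> powr p \<le> q x * \<bar>w x\<bar> powr p"
        using q[OF x] by (intro mult_right_mono) auto
      then have "0 \<le> \<bar>w' x\<bar> powr p - Q * \<bar>w x\<bar> powr p
          - (p * phi p t * w' x - (p - 1) * \<bar>t\<bar> powr p - q x * \<bar>w x\<bar> powr p)"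
        using young_phi[OF p, of t "w' x"] by linarith
      ultimately show "\<exists>y. (?N has_real_derivative y) (at x) \<and> 0 \<le> y" by blast
    next
      show "continuous_on {c..e} ?N"
        by (intro continuous_intros cA cB picone_continuous[OF p hl ce u nd dw]) (auto simp: w_def)
    qed (use ce in auto)
    moreover have "picone p w u v c = 0" "picone p w u v e = 0" by (auto simp: picone_def w_def)
    moreover have "Q * B e = A e + 1" using Bpos by (simp add: Q_def)
    ultimately show False using AB0 by simp
  qed
  have "\<exists>x. c < x \<and> x < e \<and> u x = 0"
    if hl: "half_linear p q u v" and nd: "\<And>x. x \<in> {0..1} \<Longrightarrow> u x \<noteq> 0 \<or> v x \<noteq> 0"
      and q: "\<And>x. c < x \<Longrightarrow> x < e \<Longrightarrow> Q \<le> q x" for q u v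
  proof (rule ccontr)
    assume "\<not> ?thesis"
    then have "(\<forall>x\<in>{c<..<e}. 0 < u x) \<or> (\<forall>x\<in>{c<..<e}. u x < 0)"
      by (intro nonzero_constant_sign continuous_on_subset[OF half_linear_continuous(1)[OF hl]])
       (use ce in auto)
    then show False
      using pos[OF hl nd q] pos[OF half_linear_uminus[OF hl] _ q] nd by auto
  qed
  then show thesis by (rule that)
qed

section \<open>The phase angle and the number of zeros\<close>

text \<open>
  Ordinary polar coordinates in the phase plane serve for every \<open>p\<close>, because only the passages of
  the angle through multiples of \<open>\<pi>\<close> matter. At these \<open>u\<close> vanishes, whatever the power.
\<close>

definition polar :: "(real \<Rightarrow> real) \<Rightarrow> (real \<Rightarrow> real) \<Rightarrow> (real \<Rightarrow> real) \<Rightarrow> bool" where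
  "polar u v \<theta> \<longleftrightarrow> continuous_on {0..1} \<theta> \<and> \<theta> 0 = 0 \<and>
     (\<forall>x\<in>{0..1}. \<exists>r>0. u x = r * sin (\<theta> x) \<and> v x = r * cos (\<theta> x))"

lemma polarE:
  assumes "polar u v \<theta>" "x \<in> {0..1}"
  obtains r where "0 < r" "u x = r * sin (\<theta> x)" "v x = r * cos (\<theta> x)"
  using assms unfolding polar_def by blast

lemma polar_continuous: "polar u v \<theta> \<Longrightarrow> continuous_on {0..1} \<theta>"
  and polar_at_0: "polar u v \<theta> \<Longrightarrow> \<theta> 0 = 0"
  by (auto simp: polar_def)

lemma polar_nonvanishing:
  assumes "polar u v \<theta>" "x \<in> {0..1}"
  shows "u x \<noteq> 0 \<or> v x \<noteq> 0"
  using polarE[OF assms] by (metis cos_zero_iff_int mult_eq_0_iff order_less_irrefl sin_zero_abs_cos_one abs_zero zero_neq_one)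

text \<open>
  As the parameter set is contractible, \<open>v + i u\<close> has a logarithm that is jointly continuous in the
  parameter and \<open>x\<close>. The angle is its imaginary part, normalized at \<open>x = 0\<close>.
\<close>

lemma polar_lift:
  fixes u v :: "'a::real_normed_vector \<Rightarrow> real \<Rightarrow> real"
  assumes P: "convex P"
    and cu: "continuous_on (P \<times> {0..1}) (\<lambda>(s, x). u s x)"
    and cv: "continuous_on (P \<times> {0..1}) (\<lambda>(s, x). v s x)"
    and nz: "\<And>s x. s \<in> P \<Longrightarrow> x \<in> {0..1} \<Longrightarrow> u s x \<noteq> 0 \<or> v s x \<noteq> 0"
    and init: "\<And>s. s \<in> P \<Longrightarrow> u s 0 = 0" "\<And>s. s \<in> P \<Longrightarrow> 0 < v s 0"
  obtains \<theta> where "continuous_on (P \<times> {0..1}) (\<lambda>(s, x). \<theta> s x)"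
    "\<And>s. s \<in> P \<Longrightarrow> polar (u s) (v s) (\<theta> s)"
proof -
  let ?f = "\<lambda>z. Complex (v (fst z) (snd z)) (u (fst z) (snd z))"
  have "continuous_on (P \<times> {0..1}) ?f"
    using cu cv unfolding Complex_eq case_prod_unfold by (intro continuous_intros)
  moreover have "contractible (P \<times> {0..1::real})"
    using P by (intro convex_imp_contractible convex_Times) auto
  moreover have "?f z \<noteq> 0" if "z \<in> P \<times> {0..1}" for z
    using nz[of "fst z" "snd z"] that by (auto simp: complex_eq_iff)
  ultimately obtain g where cg: "continuous_on (P \<times> {0..1}) g"
    and g: "\<And>z. z \<in> P \<times> {0..1} \<Longrightarrow> ?f z = exp (g z)"
    using continuous_logarithm_on_contractible[of "P \<times> {0..1}" ?f] by auto
  have uv: "u s x = exp (Re (g (s, x))) * sin (Im (g (s, x)))"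
           "v s x = exp (Re (g (s, x))) * cos (Im (g (s, x)))" if "s \<in> P" "x \<in> {0..1}" for s x
    using g[of "(s, x)"] that by (auto simp: complex_eq_iff Re_exp Im_exp)
  define \<theta> where "\<theta> s x = Im (g (s, x)) - Im (g (s, 0))" for s x
  have g0: "sin (Im (g (s, 0))) = 0" "cos (Im (g (s, 0))) = 1" if "s \<in> P" for s
  proof -
    show *: "sin (Im (g (s, 0))) = 0" using uv(1)[OF that, of 0] init(1)[OF that] by simp
    have "0 < cos (Im (g (s, 0)))" using uv(2)[OF that, of 0] init(2)[OF that] by (simp add: zero_less_mult_iff)
    then show "cos (Im (g (s, 0))) = 1" using sin_zero_abs_cos_one[OF *] by simp
  qed
  have c\<theta>: "continuous_on (P \<times> {0..1}) (\<lambda>(s, x). \<theta> s x)"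
    unfolding \<theta>_def case_prod_unfold
    by (intro continuous_intros continuous_on_compose2[OF cg]) auto
  show thesis
  proof (rule that[OF c\<theta>])
    fix s assume s: "s \<in> P"
    have "continuous_on {0..1} (\<lambda>x. case (s, x) of (s, x) \<Rightarrow> \<theta> s x)"
      by (rule continuous_on_compose2[OF c\<theta>]) (use s in \<open>auto intro!: continuous_intros\<close>)
    moreover have "\<theta> s 0 = 0" by (simp add: \<theta>_def)
    moreover have "\<exists>r>0. u s x = r * sin (\<theta> s x) \<and> v s x = r * cos (\<theta> s x)" if "x \<in> {0..1}" for x
      using uv[OF s that] g0[OF s]
      by (intro exI[of _ "exp (Re (g (s, x)))"]) (simp add: \<theta>_def sin_diff cos_diff)
    ultimately show "polar (u s) (v s) (\<theta> s)" by (simp add: polar_def)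
  qed
qed

lemma polar_exists:
  assumes "continuous_on {0..1} u" "continuous_on {0..1} v"
    "\<And>x. x \<in> {0..1} \<Longrightarrow> u x \<noteq> 0 \<or> v x \<noteq> 0" "u 0 = 0" "0 < v 0"
  obtains \<theta> where "polar u v \<theta>"
proof -
  have c: "continuous_on ({0::real} \<times> {0..1}) (\<lambda>(s, x). h x)" if "continuous_on {0..1} h"
    for h :: "real \<Rightarrow> real"
    unfolding case_prod_unfold by (rule continuous_on_compose2[OF that]) (auto intro: continuous_intros)
  show thesis
    by (rule polar_lift[of "{0::real}" "\<lambda>_. u" "\<lambda>_. v"]) (use assms c that in auto)
qed

text \<open>
  If two trajectories are close, their angles never differ by \<open>\<pi>/2\<close>, so the difference of the
  angles at \<open>1\<close> is the principal value \<open>arctan\<close> of its tangent, and this is small.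
\<close>

lemma polar_limit:
  assumes cu: "continuous_on {0..1} u" and cv: "continuous_on {0..1} v" and pol: "polar u v \<theta>"
    and pol_n: "\<And>n. polar (U n) (V n) (\<Theta> n)"
    and U: "uniform_limit {0..1} U u sequentially" and V: "uniform_limit {0..1} V v sequentially"
  shows "(\<lambda>n. \<Theta> n 1) \<longlonglongrightarrow> \<theta> 1"
proof -
  have "compact (u ` {0..1} \<union> v ` {0..1})"
    using cu cv by (intro compact_Un compact_continuous_image) auto
  then obtain B where B: "\<And>x. x \<in> {0..1} \<Longrightarrow> \<bar>u x\<bar> \<le> B \<and> \<bar>v x\<bar> \<le> B"
    using compact_imp_bounded[THEN bounded_iff[THEN iffD1]] by (metis UnI1 UnI2 imageI real_norm_def)
  obtain x0 where x0: "x0 \<in> {0..1}"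
    "\<And>x. x \<in> {0..1} \<Longrightarrow> (u x0)\<^sup>2 + (v x0)\<^sup>2 \<le> (u x)\<^sup>2 + (v x)\<^sup>2"
    using continuous_attains_inf[of "{0..1::real}" "\<lambda>x. (u x)\<^sup>2 + (v x)\<^sup>2"] cu cv
    by (force intro!: continuous_intros)
  define m where "m = (u x0)\<^sup>2 + (v x0)\<^sup>2"
  have m: "0 < m" using polar_nonvanishing[OF pol x0(1)] by (auto simp: m_def sum_power2_gt_zero_iff)
  have B0: "0 \<le> B" using B[of 0] by auto
  define e where "e = m / (2 * B + 1)"
  have e: "0 < e" "2 * B * e < m" using m B0 by (auto simp: e_def field_simps)
  have "\<forall>\<^sub>F n in sequentially. \<forall>x\<in>{0..1}. dist (U n x) (u x) < e"
    "\<forall>\<^sub>F n in sequentially. \<forall>x\<in>{0..1}. dist (V n x) (v x) < e"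
    using U V e(1) unfolding uniform_limit_iff by blast+
  then have small: "\<forall>\<^sub>F n in sequentially. \<Theta> n 1 - \<theta> 1 =
      arctan ((U n 1 * v 1 - V n 1 * u 1) / (U n 1 * u 1 + V n 1 * v 1))"
  proof eventually_elim
    case (elim n)
    define \<delta> where "\<delta> x = \<Theta> n x - \<theta> x" for x
    have c\<delta>: "continuous_on {0..1} \<delta>"
      unfolding \<delta>_def by (intro continuous_intros polar_continuous[OF pol] polar_continuous[OF pol_n])
    have cosd: "0 < cos (\<delta> x)" if x: "x \<in> {0..1}" for x
    proof -
      obtain r where r: "0 < r" "u x = r * sin (\<theta> x)" "v x = r * cos (\<theta> x)" by (rule polarE[OF pol x])
      obtain R where R: "0 < R" "U n x = R * sin (\<Theta> n x)" "V n x = R * cos (\<Theta> n x)"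
        by (rule polarE[OF pol_n x])
      have "\<bar>U n x - u x\<bar> \<le> e" "\<bar>V n x - v x\<bar> \<le> e"
        using elim x by (auto simp: dist_real_def less_imp_le)
      then have "\<bar>(U n x - u x) * u x\<bar> \<le> e * B" "\<bar>(V n x - v x) * v x\<bar> \<le> e * B"
        using B[OF x] unfolding abs_mult by (auto intro!: mult_mono e(1)[THEN less_imp_le])
      moreover have "U n x * u x + V n x * v x
          = (u x)\<^sup>2 + (v x)\<^sup>2 + (U n x - u x) * u x + (V n x - v x) * v x"
        by (simp add: algebra_simps power2_eq_square)
      moreover have "m \<le> (u x)\<^sup>2 + (v x)\<^sup>2" using x0(2)[OF x] by (simp add: m_def)
      moreover have "2 * B * e = e * B + e * B" by simp
      ultimately have "0 < U n x * u x + V n x * v x" using e(2) by linarith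
      also have "U n x * u x + V n x * v x = (r * R) * cos (\<delta> x)"
        by (simp add: r R \<delta>_def cos_diff algebra_simps)
      finally show ?thesis by (rule zero_less_mult_pos) (use r R in simp)
    qed
    have \<delta>0: "\<delta> 0 = 0" using polar_at_0[OF pol] polar_at_0[OF pol_n] by (simp add: \<delta>_def)
    have "\<delta> 1 < pi / 2"
    proof (rule ccontr)
      assume "\<not> ?thesis"
      then obtain y where "0 \<le> y" "y \<le> 1" "\<delta> y = pi / 2"
        using IVT'[of \<delta> 0 "pi / 2" 1] c\<delta> \<delta>0 by auto
      then show False using cosd[of y] cos_pi_half cos_minus[of "pi / 2"] by (metis atLeastAtMost_iff order_less_irrefl)
    qed
    moreover have "- (pi / 2) < \<delta> 1"
    proof (rule ccontr)
      assume "\<not> ?thesis"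
      then obtain y where "0 \<le> y" "y \<le> 1" "\<delta> y = - (pi / 2)"
        using IVT2'[of \<delta> 1 "- (pi / 2)" 0] c\<delta> \<delta>0 by auto
      then show False using cosd[of y] cos_pi_half cos_minus[of "pi / 2"] by (metis atLeastAtMost_iff order_less_irrefl)
    qed
    ultimately have "\<delta> 1 = arctan (tan (\<delta> 1))" by (simp add: arctan_tan)
    also have "tan (\<delta> 1) = (U n 1 * v 1 - V n 1 * u 1) / (U n 1 * u 1 + V n 1 * v 1)"
    proof -
      obtain r where r: "0 < r" "u 1 = r * sin (\<theta> 1)" "v 1 = r * cos (\<theta> 1)"
        by (rule polarE[OF pol, of 1]) auto
      obtain R where R: "0 < R" "U n 1 = R * sin (\<Theta> n 1)" "V n 1 = R * cos (\<Theta> n 1)"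
        by (rule polarE[OF pol_n, of 1]) auto
      have "U n 1 * v 1 - V n 1 * u 1 = (r * R) * sin (\<delta> 1)"
        "U n 1 * u 1 + V n 1 * v 1 = (r * R) * cos (\<delta> 1)"
        by (simp_all add: r R \<delta>_def sin_diff cos_diff algebra_simps)
      then show ?thesis using r R by (simp add: tan_def)
    qed
    finally show ?case by (simp add: \<delta>_def)
  qed
  have U1: "(\<lambda>n. U n 1) \<longlonglongrightarrow> u 1" and V1: "(\<lambda>n. V n 1) \<longlonglongrightarrow> v 1"
    using tendsto_uniform_limitI[OF U] tendsto_uniform_limitI[OF V] by auto
  have "u 1 * u 1 + v 1 * v 1 \<noteq> 0"
    using polar_nonvanishing[OF pol, of 1] by (simp add: sum_squares_eq_zero_iff)
  then have "(\<lambda>n. arctan ((U n 1 * v 1 - V n 1 * u 1) / (U n 1 * u 1 + V n 1 * v 1)))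
      \<longlonglongrightarrow> arctan ((u 1 * v 1 - v 1 * u 1) / (u 1 * u 1 + v 1 * v 1))"
    by (intro tendsto_intros U1 V1)
  then have "(\<lambda>n. arctan ((U n 1 * v 1 - V n 1 * u 1) / (U n 1 * u 1 + V n 1 * v 1))) \<longlonglongrightarrow> 0"
    by simp
  then have "(\<lambda>n. \<Theta> n 1 - \<theta> 1) \<longlonglongrightarrow> 0"
    by (rule Lim_transform_eventually) (use small in \<open>auto elim: eventually_mono\<close>)
  then show ?thesis by (simp add: LIM_zero_iff)
qed

lemma polar_zero_iff:
  assumes "polar u v \<theta>" "x \<in> {0..1}"
  shows "u x = 0 \<longleftrightarrow> (\<exists>j::int. \<theta> x = of_int j * pi)"
  using polarE[OF assms] by (metis mult_eq_0_iff order_less_irrefl sin_zero_iff_int2)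

lemma sin_sign_near_0:
  fixes t :: real
  assumes "\<bar>t\<bar> < pi"
  shows "0 < sin t \<Longrightarrow> 0 < t" and "sin t < 0 \<Longrightarrow> t < 0"
proof -
  show "0 < t" if "0 < sin t"
  proof (rule ccontr)
    assume "\<not> 0 < t"
    then have "0 \<le> sin (- t)" using assms by (intro sin_ge_zero) auto
    then show False using that by simp
  qed
  show "t < 0" if "sin t < 0"
  proof (rule ccontr)
    assume "\<not> t < 0"
    then have "0 \<le> sin t" using assms by (intro sin_ge_zero) auto
    then show False using that by simp
  qed
qed

text \<open>
  At a zero of \<open>u\<close> the derivative \<open>u'\<close> has the sign of \<open>v\<close>. Thus the angle crosses every multiple
  of \<open>\<pi>\<close> at most once, and upwards.
\<close>

lemma polar_crossing:
  assumes hl: "half_linear p q u v" and pol: "polar u v \<theta>" and x: "x \<in> {0..1}"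
    and j: "\<theta> x = of_int j * pi"
  shows "\<exists>d>0. \<forall>y\<in>{0..1}. (x < y \<and> y < x + d \<longrightarrow> of_int j * pi < \<theta> y) \<and>
    (x - d < y \<and> y < x \<longrightarrow> \<theta> y < of_int j * pi)"
proof -
  define s where "s = cos (of_int j * pi :: real)"
  have sj: "sin (of_int j * pi :: real) = 0" by (simp add: sin_zero_iff_int2)
  then have s: "s = 1 \<or> s = -1" using sin_zero_abs_cos_one[OF sj] unfolding s_def by linarith
  obtain r where r: "0 < r" "v x = r * s"
    using polarE[OF pol x] j unfolding s_def by metis
  have d: "((\<lambda>y. s * u y) has_real_derivative s * phi (conj_exp p) (v x)) (at x within {0..1})"
    by (rule DERIV_cmult[OF half_linear_derivs(1)[OF hl x]])
  have pos: "0 < s * phi (conj_exp p) (v x)"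
    using s r by auto
  have "u x = 0" using polar_zero_iff[OF pol x] j by blast
  obtain d1 where d1: "0 < d1" "\<And>h. 0 < h \<Longrightarrow> x + h \<in> {0..1} \<Longrightarrow> h < d1 \<Longrightarrow> 0 < s * u (x + h)"
    using has_real_derivative_pos_inc_right[OF d pos] \<open>u x = 0\<close> by auto
  obtain d2 where d2: "0 < d2" "\<And>h. 0 < h \<Longrightarrow> x - h \<in> {0..1} \<Longrightarrow> h < d2 \<Longrightarrow> s * u (x - h) < 0"
    using has_real_derivative_pos_inc_left[OF d pos] \<open>u x = 0\<close> by auto
  obtain d3 where d3: "0 < d3" "\<And>y. y \<in> {0..1} \<Longrightarrow> \<bar>y - x\<bar> < d3 \<Longrightarrow> \<bar>\<theta> y - of_int j * pi\<bar> < pi"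
  proof -
    have "\<exists>d>0. \<forall>y\<in>{0..1}. dist y x < d \<longrightarrow> dist (\<theta> y) (\<theta> x) < pi"
      using polar_continuous[OF pol] x pi_gt_zero unfolding continuous_on_iff by blast
    then show ?thesis using that j unfolding dist_real_def by auto
  qed
  have su: "\<exists>R>0. s * u y = R * sin (\<theta> y - of_int j * pi)" if y: "y \<in> {0..1}" for y
  proof -
    obtain R where "0 < R" "u y = R * sin (\<theta> y)" using polarE[OF pol y] by metis
    then show ?thesis using sj by (intro exI[of _ R]) (simp add: sin_diff s_def)
  qed
  define m where "m = min d1 (min d2 d3)"
  have right: "of_int j * pi < \<theta> y" if y: "y \<in> {0..1}" "x < y" "y < x + m" for y
  proof -
    obtain R where "R > 0" "s * u y = R * sin (\<theta> y - of_int j * pi)" using su[OF y(1)] by blast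
    moreover have "0 < s * u y" using d1(2)[of "y - x"] y by (auto simp: m_def)
    ultimately have "0 < sin (\<theta> y - of_int j * pi)" by (simp add: zero_less_mult_iff)
    moreover have "\<bar>\<theta> y - of_int j * pi\<bar> < pi" using d3(2)[of y] y by (auto simp: m_def)
    ultimately show ?thesis
      using sin_sign_near_0(1)[of "\<theta> y - of_int j * pi"] by linarith
  qed
  have left: "\<theta> y < of_int j * pi" if y: "y \<in> {0..1}" "x - m < y" "y < x" for y
  proof -
    obtain R where "R > 0" "s * u y = R * sin (\<theta> y - of_int j * pi)" using su[OF y(1)] by blast
    moreover have "s * u y < 0" using d2(2)[of "x - y"] y by (auto simp: m_def)
    ultimately have "sin (\<theta> y - of_int j * pi) < 0" by (simp add: mult_less_0_iff)
    moreover have "\<bar>\<theta> y - of_int j * pi\<bar> < pi" using d3(2)[of y] y by (auto simp: m_def)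
    ultimately show ?thesis
      using sin_sign_near_0(2)[of "\<theta> y - of_int j * pi"] by linarith
  qed
  have "0 < m" using d1(1) d2(1) d3(1) by (simp add: m_def)
  then show ?thesis using left right by blast
qed

lemma polar_stays_above:
  assumes hl: "half_linear p q u v" and pol: "polar u v \<theta>"
    and xy: "0 \<le> x" "x < y" "y \<le> 1" and j: "of_int j * pi \<le> \<theta> x"
  shows "of_int j * pi < \<theta> y"
proof -
  have above: "of_int j * pi \<le> \<theta> y" if xy: "x < y" "y \<le> 1" for y
  proof (rule ccontr)
    assume neg: "\<not> ?thesis"
    define S where "S = {x..y} \<inter> \<theta> -` {of_int j * pi..}"
    have c: "continuous_on {x..y} \<theta>"
      using xy \<open>0 \<le> x\<close> by (intro continuous_on_subset[OF polar_continuous[OF pol]]) auto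
    have "closed S" unfolding S_def by (intro continuous_closed_preimage[OF c]) auto
    have "compact S" using \<open>closed S\<close> unfolding compact_eq_bounded_closed S_def
      by (auto intro: bounded_subset[OF bounded_closed_interval[of x y]])
    moreover have "x \<in> S" using xy j by (auto simp: S_def)
    ultimately obtain s where s: "s \<in> S" "\<And>t. t \<in> S \<Longrightarrow> t \<le> s"
      using compact_attains_sup[of S] by auto
    have sy: "s < y" using s(1) neg by (auto simp: S_def order_less_le)
    have s01: "s \<in> {0..1}" using s(1) xy \<open>0 \<le> x\<close> by (auto simp: S_def)
    obtain t where t: "s \<le> t" "t \<le> y" "\<theta> t = of_int j * pi"
      using IVT2'[of \<theta> y "of_int j * pi" s] s(1) neg sy continuous_on_subset[OF c, of "{s..y}"]
      by (auto simp: S_def)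
    then have "t = s" using s(1) s(2)[of t] by (auto simp: S_def)
    then have "\<theta> s = of_int j * pi" using t by simp
    then obtain d where d: "0 < d" "\<And>y. y \<in> {0..1} \<Longrightarrow> s < y \<Longrightarrow> y < s + d \<Longrightarrow> of_int j * pi < \<theta> y"
      using polar_crossing[OF hl pol s01] by blast
    define z where "z = min y (s + d / 2)"
    have "s < z" "z < s + d" "z \<le> y" using d(1) sy by (auto simp: z_def)
    moreover from this have "z \<in> S" using d(2)[of z] s01 xy s(1) by (auto simp: S_def)
    ultimately show False using s(2)[of z] by simp
  qed
  have "\<theta> y \<noteq> of_int j * pi"
  proof
    assume "\<theta> y = of_int j * pi"
    then obtain d where d: "0 < d" "\<And>z. z \<in> {0..1} \<Longrightarrow> y - d < z \<Longrightarrow> z < y \<Longrightarrow> \<theta> z < of_int j * pi"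
      using polar_crossing[OF hl pol, of y j] xy by auto
    define z where "z = max ((x + y) / 2) (y - d / 2)"
    have "x < z" "z < y" "y - d < z" using d(1) xy by (auto simp: z_def max_def field_simps)
    then show False using above[of z] d(2)[of z] xy by auto
  qed
  then show ?thesis using above[of y] xy by auto
qed

lemma polar_pos:
  assumes "half_linear p q u v" "polar u v \<theta>" "0 < x" "x \<le> 1"
  shows "0 < \<theta> x"
  using polar_stays_above[OF assms(1,2), of 0 x 0] assms polar_at_0[OF assms(2)] by simp

text \<open>
  The points where the angle reaches \<open>0, \<pi>, \<dots>, k\<pi>\<close> cut off \<open>k\<close> consecutive nodal intervals.
\<close>

lemma polar_nodal_points:
  fixes k :: nat
  assumes hl: "half_linear p q u v" and pol: "polar u v \<theta>" and k: "of_nat k * pi \<le> \<theta> 1"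
  obtains X :: "nat \<Rightarrow> real"
  where "X 0 = 0" "\<And>j. j \<le> k \<Longrightarrow> X j \<in> {0..1}" "\<And>j. j \<le> k \<Longrightarrow> \<theta> (X j) = of_nat j * pi"
    "\<And>j. j \<le> k \<Longrightarrow> u (X j) = 0" "\<And>j. j < k \<Longrightarrow> X j < X (Suc j)"
    "\<And>j x. j < k \<Longrightarrow> X j < x \<Longrightarrow> x < X (Suc j) \<Longrightarrow> u x \<noteq> 0"
proof -
  have above: "of_nat j * pi < \<theta> y" if "0 \<le> x" "x < y" "y \<le> 1" "of_nat j * pi \<le> \<theta> x" for x y j
    using polar_stays_above[OF hl pol that(1-3), of "int j"] that(4) by simp
  have "\<exists>x\<in>{0..1}. \<theta> x = of_nat j * pi" if "j \<le> k" for j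
  proof -
    have "of_nat j * pi \<le> of_nat k * pi" using that by simp
    then have "of_nat j * pi \<le> \<theta> 1" using k by linarith
    then show ?thesis
      using IVT'[of \<theta> 0 "of_nat j * pi" 1] polar_at_0[OF pol] polar_continuous[OF pol] by auto
  qed
  then have "\<forall>j. \<exists>x. j \<le> k \<longrightarrow> x \<in> {0..1} \<and> \<theta> x = of_nat j * pi" by blast
  then obtain X where X: "\<And>j. j \<le> k \<Longrightarrow> X j \<in> {0..1}" "\<And>j. j \<le> k \<Longrightarrow> \<theta> (X j) = of_nat j * pi"
    by metis
  have less: "X j < X (Suc j)" if j: "j < k" for j
  proof (rule ccontr)
    assume "\<not> ?thesis"
    moreover have "X j \<noteq> X (Suc j)" using X(2)[of j] X(2)[of "Suc j"] j by auto
    ultimately have "X (Suc j) < X j" by simp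
    then have "of_nat (Suc j) * pi < \<theta> (X j)"
      using above[of "X (Suc j)" "X j" "Suc j"] X[of j] X[of "Suc j"] j by auto
    then show False using X(2)[of j] j by (simp add: algebra_simps)
  qed
  show thesis
  proof (rule that[OF _ X _ less])
    show "X 0 = 0" using polar_pos[OF hl pol, of "X 0"] X[of 0] by fastforce
    show "u (X j) = 0" if "j \<le> k" for j
      using polar_zero_iff[OF pol X(1)[OF that]] X(2)[OF that] by (metis of_int_of_nat_eq)
    show "u x \<noteq> 0" if j: "j < k" and x: "X j < x" "x < X (Suc j)" for j x
    proof
      assume "u x = 0"
      have x01: "x \<in> {0..1}" using x X(1)[of j] X(1)[of "Suc j"] j by auto
      then obtain i :: int where i: "\<theta> x = of_int i * pi"
        using polar_zero_iff[OF pol x01] \<open>u x = 0\<close> by blast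
      have "of_int (int j) * pi < of_int i * pi"
        using above[of "X j" x j] X[of j] x x01 j i by auto
      moreover have "of_int i * pi < of_int (int (Suc j)) * pi"
        using polar_stays_above[OF hl pol, of x "X (Suc j)" i] X[of "Suc j"] x x01 j i by auto
      ultimately have "int j < i" "i < int (Suc j)"
        by (simp_all only: mult_less_cancel_right_pos[OF pi_gt_zero] of_int_less_iff)
      then show False by simp
    qed
  qed
qed

text \<open>As the angle passes each multiple of \<open>\<pi>\<close> once, it enumerates the zeros.\<close>

lemma polar_zero_index:
  assumes hl: "half_linear p q u v" and pol: "polar u v \<theta>"
  obtains J :: "real \<Rightarrow> nat"
  where "inj_on J {x\<in>{0<..1}. u x = 0}"
    "\<And>x. x \<in> {0<..1} \<Longrightarrow> u x = 0 \<Longrightarrow> \<theta> x = of_nat (J x) * pi \<and> 1 \<le> J x"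
    "\<And>x. x \<in> {0<..<1} \<Longrightarrow> u x = 0 \<Longrightarrow> of_nat (J x) * pi < \<theta> 1"
proof -
  have "\<exists>j::nat. \<theta> x = of_nat j * pi \<and> 1 \<le> j" if x: "x \<in> {0<..1}" "u x = 0" for x
  proof -
    obtain i :: int where i: "\<theta> x = of_int i * pi" using polar_zero_iff[OF pol, of x] x by auto
    have "0 < of_int i * pi" using polar_pos[OF hl pol, of x] x i by auto
    then have "0 < i" by (simp add: zero_less_mult_iff)
    then show ?thesis using i by (intro exI[of _ "nat i"]) auto
  qed
  then obtain J where J: "\<And>x. x \<in> {0<..1} \<Longrightarrow> u x = 0 \<Longrightarrow> \<theta> x = of_nat (J x) * pi \<and> 1 \<le> J x"
    by metis
  have step: "of_nat (J x) * pi < \<theta> y" if "x \<in> {0<..1}" "u x = 0" "x < y" "y \<le> 1" for x y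
    using polar_stays_above[OF hl pol, of x y "int (J x)"] J[OF that(1,2)] that by auto
  show thesis
  proof (rule that[OF _ J])
    show "inj_on J {x\<in>{0<..1}. u x = 0}"
    proof (rule inj_onI, rule ccontr)
      fix x y assume xy: "x \<in> {x\<in>{0<..1}. u x = 0}" "y \<in> {x\<in>{0<..1}. u x = 0}" "J x = J y" "x \<noteq> y"
      then show False using step[of x y] step[of y x] J[of x] J[of y] by fastforce
    qed
    show "of_nat (J x) * pi < \<theta> 1" if "x \<in> {0<..<1}" "u x = 0" for x
      using step[of x 1] that by auto
  qed
qed

lemma polar_angle_ge_zeros:
  assumes hl: "half_linear p q u v" and pol: "polar u v \<theta>"
    and T: "finite T" "T \<subseteq> {0<..1}" "\<And>x. x \<in> T \<Longrightarrow> u x = 0"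
  shows "of_nat (card T) * pi \<le> \<theta> 1"
    and "T \<subseteq> {0<..<1} \<Longrightarrow> of_nat (card T) * pi < \<theta> 1"
proof -
  obtain J where J: "inj_on J {x\<in>{0<..1}. u x = 0}"
    "\<And>x. x \<in> {0<..1} \<Longrightarrow> u x = 0 \<Longrightarrow> \<theta> x = of_nat (J x) * pi \<and> 1 \<le> J x"
    "\<And>x. x \<in> {0<..<1} \<Longrightarrow> u x = 0 \<Longrightarrow> of_nat (J x) * pi < \<theta> 1"
    by (rule polar_zero_index[OF hl pol]) (rule that)
  have inj: "inj_on J T" using T by (intro inj_on_subset[OF J(1)]) auto
  have pos: "0 < \<theta> 1" using polar_pos[OF hl pol, of 1] by simp
  obtain x where x: "x \<in> T" "card T \<le> J x" if "T \<noteq> {}"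
  proof (rule ccontr)
    assume c: "\<not> thesis"
    then have "T \<noteq> {}" using that by blast
    have "J ` T \<subseteq> {1..<card T}" using c that J(2) T by (force simp: not_le)
    then have "card T \<le> card {1..<card T}" using inj card_inj_on_le by blast
    then show False using \<open>T \<noteq> {}\<close> T(1) by (cases "card T") auto
  qed
  have le: "of_nat (card T) * pi \<le> of_nat (J x) * pi" if "T \<noteq> {}" using x(2)[OF that] by simp
  show "of_nat (card T) * pi \<le> \<theta> 1"
  proof (cases "T = {}")
    case False
    have "of_nat (J x) * pi \<le> \<theta> 1"
      using J(2)[of x] J(3)[of x] x(1)[OF False] T by (cases "x = 1") (auto simp: subset_iff less_imp_le)
    then show ?thesis using le[OF False] by linarith
  qed (use pos in auto)
  show "of_nat (card T) * pi < \<theta> 1" if "T \<subseteq> {0<..<1}"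
  proof (cases "T = {}")
    case False
    have "of_nat (J x) * pi < \<theta> 1" using J(3)[of x] x(1)[OF False] T that by auto
    then show ?thesis using le[OF False] by linarith
  qed (use pos in auto)
qed

lemma polar_zero_count:
  fixes k :: nat
  assumes hl: "half_linear p q u v" and pol: "polar u v \<theta>" and k: "\<theta> 1 = of_nat k * pi"
  shows "finite {x\<in>{0<..<1}. u x = 0}" "card {x\<in>{0<..<1}. u x = 0} = k - 1"
proof -
  obtain J where J: "inj_on J {x\<in>{0<..1}. u x = 0}"
    "\<And>x. x \<in> {0<..1} \<Longrightarrow> u x = 0 \<Longrightarrow> \<theta> x = of_nat (J x) * pi \<and> 1 \<le> J x"
    "\<And>x. x \<in> {0<..<1} \<Longrightarrow> u x = 0 \<Longrightarrow> of_nat (J x) * pi < \<theta> 1"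
    by (rule polar_zero_index[OF hl pol]) (rule that)
  obtain X :: "nat \<Rightarrow> real"
  where X: "X 0 = 0" "\<And>j. j \<le> k \<Longrightarrow> X j \<in> {0..1}" "\<And>j. j \<le> k \<Longrightarrow> \<theta> (X j) = of_nat j * pi"
    "\<And>j. j \<le> k \<Longrightarrow> u (X j) = 0"
    by (rule polar_nodal_points[OF hl pol, of k]) (use k in auto)
  let ?Z = "{x\<in>{0<..<1}. u x = 0}"
  have inj: "inj_on J ?Z" by (rule inj_on_subset[OF J(1)]) auto
  have "J ` ?Z = {1..<k}"
  proof (intro equalityI subsetI)
    fix j assume "j \<in> J ` ?Z"
    then obtain x where "x \<in> {0<..<1}" "u x = 0" "j = J x" by auto
    then have "of_nat j * pi < of_nat k * pi" "1 \<le> j" using J(2,3)[of x] k by auto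
    then show "j \<in> {1..<k}" by simp
  next
    fix j assume j: "j \<in> {1..<k}"
    have "X j \<noteq> 0" "X j \<noteq> 1" using X(3)[of j] j k polar_at_0[OF pol] by auto
    then have Xj: "X j \<in> {0<..<1}" "u (X j) = 0" using X(2,4)[of j] j by (auto simp: order_less_le)
    then have "of_nat (J (X j)) * pi = of_nat j * pi" using J(2)[of "X j"] X(3)[of j] j by auto
    then have "J (X j) = j" by simp
    then show "j \<in> J ` ?Z" using Xj by force
  qed
  then show "finite ?Z" "card ?Z = k - 1"
    using inj finite_imageD[of J ?Z] card_image[OF inj] by auto
qed

lemma polar_angle_interlacing:
  fixes k :: nat and X :: "nat \<Rightarrow> real"
  assumes hl: "half_linear p q u v" and pol: "polar u v \<theta>"
    and X: "\<And>j. j \<le> k \<Longrightarrow> X j \<in> {0..1}"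
    and zero: "\<And>j. j < k \<Longrightarrow> \<exists>x. X j < x \<and> x \<le> X (Suc j) \<and> u x = 0"
  shows "of_nat k * pi \<le> \<theta> 1"
    and "(\<And>j. j < k \<Longrightarrow> \<exists>x. X j < x \<and> x < X (Suc j) \<and> u x = 0) \<Longrightarrow> of_nat k * pi < \<theta> 1"
proof -
  have main: "of_nat k * pi \<le> \<theta> 1 \<and> ((\<forall>j<k. z j < X (Suc j)) \<longrightarrow> of_nat k * pi < \<theta> 1)"
    if z: "\<And>j. j < k \<Longrightarrow> X j < z j \<and> z j \<le> X (Suc j) \<and> u (z j) = 0" for z
  proof -
    have less: "z i < z j" if "i < j" "j < k" for i j
      using that
    proof (induction j rule: less_Suc_induct)
      case (1 i)
      then show ?case using z[of i] z[of "Suc i"] by auto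
    next
      case (2 i j l)
      then show ?case by (meson less_trans)
    qed
    have inj: "inj_on z {..<k}"
      by (rule inj_onI) (metis less lessThan_iff linorder_neqE_nat order_less_irrefl)
    have zX: "0 < z j" "z j \<le> X (Suc j)" "X (Suc j) \<le> 1" if "j < k" for j
      using z[OF that] X[of j] X[of "Suc j"] that by auto
    then have "z ` {..<k} \<subseteq> {0<..1}" by fastforce
    then have "of_nat (card (z ` {..<k})) * pi \<le> \<theta> 1"
      "z ` {..<k} \<subseteq> {0<..<1} \<Longrightarrow> of_nat (card (z ` {..<k})) * pi < \<theta> 1"
      using z by (intro polar_angle_ge_zeros[OF hl pol]; auto)+
    moreover have "z ` {..<k} \<subseteq> {0<..<1}" if "\<forall>j<k. z j < X (Suc j)" using zX that by fastforce
    ultimately show ?thesis using card_image[OF inj] by simp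
  qed
  obtain z where "\<And>j. j < k \<Longrightarrow> X j < z j \<and> z j \<le> X (Suc j) \<and> u (z j) = 0" using zero by metis
  then show "of_nat k * pi \<le> \<theta> 1" using main by blast
  assume "\<And>j. j < k \<Longrightarrow> \<exists>x. X j < x \<and> x < X (Suc j) \<and> u x = 0"
  then obtain z where "\<And>j. j < k \<Longrightarrow> X j < z j \<and> z j < X (Suc j) \<and> u (z j) = 0" by metis
  then show "of_nat k * pi < \<theta> 1" using main[of z] by (simp add: less_imp_le)
qed

text \<open>
  Sturm's theorem puts a zero of \<open>u\<^sub>2\<close> inside each of the first \<open>k\<close> nodal intervals of \<open>u\<^sub>1\<close>. The
  last of these zeros lies before \<open>1\<close>, so the angle of \<open>u\<^sub>2\<close> has passed \<open>k\<pi>\<close> by then.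
\<close>

theorem sturm_angle_strict:
  fixes k :: nat
  assumes p: "1 < p" and hl1: "half_linear p q1 u1 v1" and pol1: "polar u1 v1 \<theta>1"
    and hl2: "half_linear p q2 u2 v2" and pol2: "polar u2 v2 \<theta>2"
    and q: "\<And>x. x \<in> {0<..<1} \<Longrightarrow> q1 x < q2 x" and k: "of_nat k * pi \<le> \<theta>1 1"
  shows "of_nat k * pi < \<theta>2 1"
proof -
  obtain X :: "nat \<Rightarrow> real"
  where X: "X 0 = 0" "\<And>j. j \<le> k \<Longrightarrow> X j \<in> {0..1}" "\<And>j. j \<le> k \<Longrightarrow> \<theta>1 (X j) = of_nat j * pi"
    "\<And>j. j \<le> k \<Longrightarrow> u1 (X j) = 0" "\<And>j. j < k \<Longrightarrow> X j < X (Suc j)"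
    "\<And>j x. j < k \<Longrightarrow> X j < x \<Longrightarrow> x < X (Suc j) \<Longrightarrow> u1 x \<noteq> 0"
    by (rule polar_nodal_points[OF hl1 pol1 k]) blast
  have zero: "\<exists>x. X j < x \<and> x < X (Suc j) \<and> u2 x = 0" if j: "j < k" for j
    using X(2)[of j] X(2)[of "Suc j"] X(4)[of j] X(4)[of "Suc j"] X(5,6)[OF j] j
    by (intro sturm_strict[OF p hl1 hl2 _ _ _ _ _ _ polar_nonvanishing[OF pol2]]) (auto intro!: q)
  show ?thesis
    by (rule polar_angle_interlacing(2)[where X = X, OF hl2 pol2 X(2)]) (use zero less_imp_le in blast)+
qed

theorem sturm_angle_weak:
  fixes k :: nat
  assumes p: "1 < p" and hl1: "half_linear p q1 u1 v1" and pol1: "polar u1 v1 \<theta>1"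
    and hl2: "half_linear p q2 u2 v2" and pol2: "polar u2 v2 \<theta>2"
    and q: "\<And>x. x \<in> {0<..<1} \<Longrightarrow> q1 x \<le> q2 x" and k: "of_nat k * pi \<le> \<theta>1 1"
  shows "of_nat k * pi \<le> \<theta>2 1"
proof -
  obtain X :: "nat \<Rightarrow> real"
  where X: "X 0 = 0" "\<And>j. j \<le> k \<Longrightarrow> X j \<in> {0..1}" "\<And>j. j \<le> k \<Longrightarrow> \<theta>1 (X j) = of_nat j * pi"
    "\<And>j. j \<le> k \<Longrightarrow> u1 (X j) = 0" "\<And>j. j < k \<Longrightarrow> X j < X (Suc j)"
    "\<And>j x. j < k \<Longrightarrow> X j < x \<Longrightarrow> x < X (Suc j) \<Longrightarrow> u1 x \<noteq> 0"
    by (rule polar_nodal_points[OF hl1 pol1 k]) blast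
  have zero: "\<exists>x. X j < x \<and> x \<le> X (Suc j) \<and> u2 x = 0" if j: "j < k" for j
    using X(2)[of j] X(2)[of "Suc j"] X(4)[of j] X(4)[of "Suc j"] X(5)[OF j] j
      polar_nonvanishing[OF pol1, of "X (Suc j)"]
    by (intro sturm_weak[OF p hl1 hl2 _ _ _ _ _ _ polar_nonvanishing[OF pol2]]) (auto intro!: q)
  show ?thesis
    by (rule polar_angle_interlacing(1)[where X = X, OF hl2 pol2 X(2) zero])
qed

section \<open>Limits of approximate trajectories\<close>

lemma uniform_limit_phi:
  assumes p: "1 < p" and lim: "uniform_limit S f g F"
    and f: "\<And>n x. x \<in> S \<Longrightarrow> \<bar>f n x\<bar> \<le> M" and g: "\<And>x. x \<in> S \<Longrightarrow> \<bar>g x\<bar> \<le> M"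
  shows "uniform_limit S (\<lambda>n x. phi p (f n x)) (\<lambda>x. phi p (g x)) F"
  unfolding uniform_limit_iff
proof (intro allI impI)
  fix e :: real assume "0 < e"
  have "uniformly_continuous_on {-M..M} (phi p)"
    by (intro compact_uniformly_continuous continuous_on_phi[OF p]) auto
  then obtain d where d: "0 < d"
    "\<And>s t. s \<in> {-M..M} \<Longrightarrow> t \<in> {-M..M} \<Longrightarrow> dist t s < d \<Longrightarrow> dist (phi p t) (phi p s) < e"
    using \<open>0 < e\<close> unfolding uniformly_continuous_on_def by metis
  have M: "f n x \<in> {-M..M}" "g x \<in> {-M..M}" if "x \<in> S" for n x
    using f[OF that, of n] g[OF that] by auto
  have "\<forall>\<^sub>F n in F. \<forall>x\<in>S. dist (f n x) (g x) < d"
    using lim d(1) unfolding uniform_limit_iff by blast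
  then show "\<forall>\<^sub>F n in F. \<forall>x\<in>S. dist (phi p (f n x)) (phi p (g x)) < e"
    by eventually_elim (use d(2) M in blast)
qed

lemma uniform_limit_diagonal:
  fixes f :: "nat \<Rightarrow> 'a::metric_space \<Rightarrow> 'b::metric_space"
  assumes lim: "uniform_limit S f g sequentially" and g: "continuous_on S g"
    and x: "x \<in> S" "\<xi> \<longlonglongrightarrow> x" "\<forall>\<^sub>F i in sequentially. \<xi> i \<in> S"
  shows "(\<lambda>i. f i (\<xi> i)) \<longlonglongrightarrow> g x"
  unfolding tendsto_iff
proof (intro allI impI)
  fix e :: real assume "0 < e"
  have "(\<lambda>i. g (\<xi> i)) \<longlonglongrightarrow> g x"
    using continuous_on_tendsto_compose[OF g x(2,1,3)] .
  then have "\<forall>\<^sub>F i in sequentially. dist (g (\<xi> i)) (g x) < e / 2"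
    by (rule tendstoD) (use \<open>0 < e\<close> in simp)
  moreover have "\<forall>\<^sub>F i in sequentially. \<forall>x\<in>S. dist (f i x) (g x) < e / 2"
    using lim \<open>0 < e\<close> unfolding uniform_limit_iff by (meson half_gt_zero)
  ultimately show "\<forall>\<^sub>F i in sequentially. dist (f i (\<xi> i)) (g x) < e"
    using x(3)
  proof eventually_elim
    case (elim i)
    then have "dist (f i (\<xi> i)) (g (\<xi> i)) < e / 2" by blast
    then show ?case using elim(1) dist_triangle[of "f i (\<xi> i)" "g x" "g (\<xi> i)"] by linarith
  qed
qed

lemma increment_eq:
  fixes f :: "real \<Rightarrow> real"
  assumes "continuous_on {0..1} f" "\<And>x. x \<in> {0<..<1} \<Longrightarrow> (f has_real_derivative f' x) (at x)"
    and xy: "0 \<le> x" "x < y" "y \<le> 1"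
  obtains \<xi> where "x < \<xi>" "\<xi> < y" "f y - f x = (y - x) * f' \<xi>"
proof -
  have "continuous_on {x..y} f" by (rule continuous_on_subset[OF assms(1)]) (use xy in auto)
  moreover have "f differentiable (at z)" if "x < z" "z < y" for z
    using assms(2)[of z] that xy real_differentiable_def by auto
  ultimately obtain l z where z: "x < z" "z < y" "DERIV f z :> l" "f y - f x = (y - x) * l"
    using MVT[OF xy(2)] by blast
  then have "l = f' z" using assms(2)[of z] xy DERIV_unique by auto
  then show thesis using that z by blast
qed

lemma lipschitz_of_bounded_derivative:
  fixes f :: "real \<Rightarrow> real"
  assumes "continuous_on {0..1} f" "\<And>x. x \<in> {0<..<1} \<Longrightarrow> (f has_real_derivative f' x) (at x)"
    and "\<And>x. x \<in> {0<..<1} \<Longrightarrow> \<bar>f' x\<bar> \<le> B" and "x \<in> {0..1}" "y \<in> {0..1}"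
  shows "\<bar>f x - f y\<bar> \<le> B * \<bar>x - y\<bar>"
proof -
  have *: "\<bar>f y - f x\<bar> \<le> B * \<bar>y - x\<bar>" if xy: "0 \<le> x" "x < y" "y \<le> 1" for x y
  proof -
    obtain \<xi> where \<xi>: "x < \<xi>" "\<xi> < y" "f y - f x = (y - x) * f' \<xi>"
      by (rule increment_eq[OF assms(1,2) xy])
    have "\<bar>f' \<xi>\<bar> \<le> B" using assms(3)[of \<xi>] \<xi> xy by auto
    then show ?thesis unfolding \<xi>(3) abs_mult by (simp add: mult.commute mult_right_mono)
  qed
  show ?thesis
    using *[of x y] *[of y x] assms(4,5) by (cases x y rule: linorder_cases) (auto simp: abs_minus_commute)
qed

text \<open>
  The Arzela--Ascoli theorem applies to the momenta \<open>V\<close>. The functions \<open>U\<close> converge with them, being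
  the primitives of \<open>\<psi>(V)\<close>, where \<open>\<psi>\<close> is the inverse of \<open>\<phi>\<^sub>p\<close>.
\<close>

lemma phase_curves_compact:
  fixes U V k :: "nat \<Rightarrow> real \<Rightarrow> real"
  assumes p: "1 < p"
    and dU: "\<And>n x. x \<in> {0..1} \<Longrightarrow> (U n has_real_derivative phi (conj_exp p) (V n x)) (at x within {0..1})"
    and U0: "\<And>n. U n 0 = 0"
    and cV: "\<And>n. continuous_on {0..1} (V n)"
    and dV: "\<And>n x. x \<in> {0<..<1} \<Longrightarrow> (V n has_real_derivative - k n x) (at x)"
    and k: "\<And>n x. x \<in> {0<..<1} \<Longrightarrow> \<bar>k n x\<bar> \<le> B"
    and V0: "\<And>n. \<bar>V n 0\<bar> \<le> B0"
  obtains r u v where "strict_mono (r :: nat \<Rightarrow> nat)"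
    "uniform_limit {0..1} (\<lambda>i. U (r i)) u sequentially"
    "uniform_limit {0..1} (\<lambda>i. V (r i)) v sequentially"
    "uniform_limit {0..1} (\<lambda>i x. phi (conj_exp p) (V (r i) x)) (\<lambda>x. phi (conj_exp p) (v x)) sequentially"
    "continuous_on {0..1} v" "u 0 = 0"
    "\<And>x. x \<in> {0..1} \<Longrightarrow> (u has_real_derivative phi (conj_exp p) (v x)) (at x within {0..1})"
proof -
  let ?\<psi> = "phi (conj_exp p)"
  have B: "0 \<le> B" using k[of "1/2" 0] by auto
  have lip: "\<bar>V n x - V n y\<bar> \<le> B * \<bar>x - y\<bar>" if "x \<in> {0..1}" "y \<in> {0..1}" for n x y
    using that k by (intro lipschitz_of_bounded_derivative[OF cV dV]) auto
  have VM: "\<bar>V n x\<bar> \<le> B0 + B" if x: "x \<in> {0..1}" for n x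
  proof -
    have "B * \<bar>x - 0\<bar> \<le> B" using x B by (simp add: mult_left_le)
    then show ?thesis using lip[OF x, of 0 n] V0[of n] by auto
  qed
  have equi: "\<exists>d>0. \<forall>n y. y \<in> {0..1} \<and> norm (x - y) < d \<longrightarrow> norm (V n x - V n y) < e"
    if x: "x \<in> {0..1}" and e: "0 < e" for x e
  proof (intro exI[of _ "e / (B + 1)"] conjI allI impI)
    show "0 < e / (B + 1)" using e B by simp
    fix n y assume y: "y \<in> {0..1} \<and> norm (x - y) < e / (B + 1)"
    have "\<bar>V n x - V n y\<bar> \<le> B * \<bar>x - y\<bar>" using lip x y by auto
    also have "\<dots> \<le> B * (e / (B + 1))" using y B by (intro mult_left_mono) auto
    also have "\<dots> < e" using e B by (simp add: field_simps)
    finally show "norm (V n x - V n y) < e" by simp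
  qed
  obtain v and r :: "nat \<Rightarrow> nat" where cv: "continuous_on {0..1} v" and r: "strict_mono r"
    and conv: "\<And>e. 0 < e \<Longrightarrow> \<exists>N. \<forall>n x. n \<ge> N \<and> x \<in> {0..1} \<longrightarrow> norm (V (r n) x - v x) < e"
    using Arzela_Ascoli[of "{0..1::real}" V "B0 + B"] VM equi by auto
  have Vv: "uniform_limit {0..1} (\<lambda>i. V (r i)) v sequentially"
    unfolding uniform_limit_iff eventually_sequentially dist_norm using conv by meson
  have vM: "\<bar>v x\<bar> \<le> B0 + B" if x: "x \<in> {0..1}" for x
    using tendsto_upperbound[OF tendsto_rabs[OF tendsto_uniform_limitI[OF Vv x]]] VM[OF x] by auto
  have \<psi>: "uniform_limit {0..1} (\<lambda>i x. ?\<psi> (V (r i) x)) (\<lambda>x. ?\<psi> (v x)) sequentially"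
    using VM vM by (intro uniform_limit_phi[OF conj_exp_gt_1[OF p] Vv]) auto
  define u where "u x = integral {0..x} (\<lambda>t. ?\<psi> (v t))" for x
  have c\<psi>: "continuous_on {0..1} (\<lambda>t. ?\<psi> (v t))"
    by (intro continuous_intros conj_exp_gt_1 p cv)
  have du: "(u has_real_derivative ?\<psi> (v x)) (at x within {0..1})" if "x \<in> {0..1}" for x
    unfolding u_def [abs_def] by (rule integral_has_real_derivative[OF c\<psi> that])
  have u0: "u 0 = 0" by (simp add: u_def)
  have "uniform_limit {0..1} (\<lambda>i. U (r i)) u sequentially"
    unfolding uniform_limit_iff
  proof (intro allI impI)
    fix e :: real assume "0 < e"
    then have "\<forall>\<^sub>F i in sequentially. \<forall>x\<in>{0..1}. dist (?\<psi> (V (r i) x)) (?\<psi> (v x)) < e"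
      using \<psi> unfolding uniform_limit_iff by blast
    then show "\<forall>\<^sub>F i in sequentially. \<forall>x\<in>{0..1}. dist (U (r i) x) (u x) < e"
    proof eventually_elim
      case (elim i)
      show ?case
      proof
        fix x :: real assume x: "x \<in> {0..1}"
        show "dist (U (r i) x) (u x) < e"
        proof (cases "x = 0")
          case True
          then show ?thesis using \<open>0 < e\<close> u0 U0 by simp
        next
          case False
          have D: "((\<lambda>x. U (r i) x - u x) has_real_derivative ?\<psi> (V (r i) x) - ?\<psi> (v x)) (at x within {0..1})"
            if "x \<in> {0..1}" for x
            by (intro DERIV_diff dU du that)
          obtain \<xi> where \<xi>: "0 < \<xi>" "\<xi> < x"
            "(U (r i) x - u x) - (U (r i) 0 - u 0) = (x - 0) * (?\<psi> (V (r i) \<xi>) - ?\<psi> (v \<xi>))"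
          proof -
            have c: "continuous_on {0..1} (\<lambda>x. U (r i) x - u x)"
              using D DERIV_continuous continuous_on_eq_continuous_within by blast
            have d: "((\<lambda>x. U (r i) x - u x) has_real_derivative ?\<psi> (V (r i) x) - ?\<psi> (v x)) (at x)"
              if "x \<in> {0<..<1}" for x
              using D[of x] at_within_Icc_at[of 0 x 1] that by simp
            have "0 < x" "x \<le> 1" using x False by auto
            from increment_eq[OF c d order_refl this] show thesis using that by blast
          qed
          have "\<bar>U (r i) x - u x\<bar> = x * \<bar>?\<psi> (V (r i) \<xi>) - ?\<psi> (v \<xi>)\<bar>"
            using \<xi>(3) x u0 U0 by (simp add: abs_mult)
          also have "\<dots> \<le> 1 * \<bar>?\<psi> (V (r i) \<xi>) - ?\<psi> (v \<xi>)\<bar>"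
            using x by (intro mult_right_mono) auto
          also have "\<dots> < e" using elim[unfolded dist_real_def] \<xi> x by auto
          finally show ?thesis by (simp add: dist_real_def)
        qed
      qed
    qed
  qed
  then show thesis using that r Vv \<psi> cv u0 du by blast
qed

text \<open>
  By the mean value theorem each increment of \<open>V n\<close> is given by the slope at an intermediate point.
  These points accumulate, and the slopes converge along convergent sequences of points, so each
  increment of the limit is given by a value of the limit slope.
\<close>

lemma limit_equation:
  fixes V k :: "nat \<Rightarrow> real \<Rightarrow> real"
  assumes cV: "\<And>n. continuous_on {0..1} (V n)"
    and dV: "\<And>n x. x \<in> {0<..<1} \<Longrightarrow> (V n has_real_derivative - k n x) (at x)"
    and lim: "\<And>x. x \<in> {0..1} \<Longrightarrow> (\<lambda>n. V n x) \<longlonglongrightarrow> v x"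
    and kl: "\<And>r \<xi> x. strict_mono (r :: nat \<Rightarrow> nat) \<Longrightarrow> x \<in> {0<..<1} \<Longrightarrow> \<xi> \<longlonglongrightarrow> x \<Longrightarrow>
        (\<lambda>i. k (r i) (\<xi> i)) \<longlonglongrightarrow> kl x"
    and ckl: "continuous_on {0<..<1} kl"
    and x: "x \<in> {0<..<1}"
  shows "(v has_real_derivative - kl x) (at x)"
proof -
  have mvt: "\<exists>\<zeta>\<in>{a..b}. v b - v a = (b - a) * - kl \<zeta>" if ab: "0 < a" "a < b" "b < 1" for a b
  proof -
    have "\<exists>\<xi>. a < \<xi> \<and> \<xi> < b \<and> V n b - V n a = (b - a) * - k n \<xi>" for n
      by (rule increment_eq[OF cV dV, of a b n]) (use ab in auto)
    then obtain \<xi> where \<xi>: "\<And>n. a < \<xi> n \<and> \<xi> n < b \<and> V n b - V n a = (b - a) * - k n (\<xi> n)" by metis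
    then have "\<forall>n. \<xi> n \<in> {a..b}" by (auto simp: less_imp_le)
    then obtain \<zeta> r where \<zeta>: "\<zeta> \<in> {a..b}" "strict_mono r" "(\<xi> \<circ> r) \<longlonglongrightarrow> \<zeta>"
      using compact_Icc[of a b] unfolding compact_def by blast
    have "(\<lambda>i. (b - a) * - k (r i) (\<xi> (r i))) \<longlonglongrightarrow> (b - a) * - kl \<zeta>"
      using \<zeta> ab by (intro tendsto_intros kl[OF \<zeta>(2), of \<zeta> "\<xi> \<circ> r", unfolded comp_def]) (auto simp: comp_def)
    moreover have "(\<lambda>i. V (r i) b - V (r i) a) \<longlonglongrightarrow> v b - v a"
      using LIMSEQ_subseq_LIMSEQ[OF lim[of b] \<zeta>(2)] LIMSEQ_subseq_LIMSEQ[OF lim[of a] \<zeta>(2)] ab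
      by (intro tendsto_diff) (auto simp: comp_def)
    ultimately have "v b - v a = (b - a) * - kl \<zeta>"
      using \<xi> by (simp add: LIMSEQ_unique)
    then show ?thesis using \<zeta>(1) by blast
  qed
  show ?thesis
    unfolding has_field_derivative_iff tendsto_iff
  proof (intro allI impI)
    fix e :: real assume "0 < e"
    have "continuous_on {0<..<1} (\<lambda>x. - kl x)" by (intro continuous_intros ckl)
    then obtain d where d: "0 < d" "\<And>y. y \<in> {0<..<1} \<Longrightarrow> \<bar>y - x\<bar> < d \<Longrightarrow> \<bar>- kl y + kl x\<bar> < e"
      using x \<open>0 < e\<close> unfolding continuous_on_iff dist_real_def by (metis diff_minus_eq_add)
    have "dist ((v y - v x) / (y - x)) (- kl x) < e" if y: "y \<in> {0<..<1}" "y \<noteq> x" "\<bar>y - x\<bar> < d" for y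
    proof -
      have "\<exists>\<zeta>. min x y \<le> \<zeta> \<and> \<zeta> \<le> max x y \<and> (v y - v x) / (y - x) = - kl \<zeta>"
      proof (cases "x < y")
        case True
        then show ?thesis using mvt[of x y] x y by (auto simp: field_simps)
      next
        case False
        then have "y < x" using y by simp
        then obtain \<zeta> where "\<zeta> \<in> {y..x}" "v x - v y = (x - y) * - kl \<zeta>" using mvt[of y x] x y by auto
        moreover from this have "(v y - v x) / (y - x) = - kl \<zeta>" using \<open>y < x\<close> by (simp add: field_simps)
        ultimately show ?thesis using \<open>y < x\<close> by auto
      qed
      then obtain \<zeta> where \<zeta>: "min x y \<le> \<zeta>" "\<zeta> \<le> max x y" "(v y - v x) / (y - x) = - kl \<zeta>" by blast
      then have "\<zeta> \<in> {0<..<1}" "\<bar>\<zeta> - x\<bar> < d" using x y by (auto simp: min_def max_def split: if_splits)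
      then show ?thesis using d(2)[of \<zeta>] \<zeta>(3) by (simp add: dist_real_def)
    qed
    moreover have "\<forall>\<^sub>F y in at x. y \<in> {0<..<1}"
      using x by (intro eventually_at_in_open') auto
    moreover have "\<forall>\<^sub>F y in at x. y \<noteq> x \<and> \<bar>y - x\<bar> < d"
      using d(1) unfolding eventually_at dist_real_def by blast
    ultimately show "\<forall>\<^sub>F y in at x. dist ((v y - v x) / (y - x)) (- kl x) < e"
      by (auto elim: eventually_elim2)
  qed
qed

section \<open>Shooting\<close>

text \<open>
  Trajectories are the objects of shooting: solutions of \<open>(\<phi>\<^sub>p(u'))' + h(x,u,l) = 0\<close> with their
  momentum \<open>v = \<phi>\<^sub>p(u')\<close>, free at the end point \<open>1\<close>.
\<close>

definition trajectory ::
  "real \<Rightarrow> (real \<Rightarrow> real \<Rightarrow> real \<Rightarrow> real) \<Rightarrow> real \<Rightarrow> (real \<Rightarrow> real) \<Rightarrow> (real \<Rightarrow> real) \<Rightarrow> bool" where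
  "trajectory p h l u v \<longleftrightarrow> u 0 = 0 \<and>
     (\<forall>x\<in>{0..1}. (u has_real_derivative phi (conj_exp p) (v x)) (at x within {0..1})) \<and>
     continuous_on {0..1} v \<and> (\<forall>x\<in>{0<..<1}. (v has_real_derivative - h x (u x) l) (at x))"

lemma trajectory_cong:
  assumes "trajectory p h l u v" "\<And>x. x \<in> {0<..<1} \<Longrightarrow> h x (u x) l = h' x (u x) l"
  shows "trajectory p h' l u v"
  using assms unfolding trajectory_def by auto

text \<open>
  The substitution \<open>t \<mapsto> x t\<close> reduces the variable upper limit to an integral over \<open>[0,1]\<close> that
  depends on a parameter.
\<close>

lemma continuous_on_integral_upper:
  fixes g :: "'a::metric_space \<Rightarrow> real \<Rightarrow> real"
  assumes g: "continuous_on UNIV (\<lambda>(s, x). g s x)"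
  shows "continuous_on UNIV (\<lambda>(s, x). integral {0..x} (g s))"
proof -
  have eq: "integral {0..x} (g s) = max 0 x * integral (cbox 0 1) (\<lambda>t. g s (max 0 x * t))" for s x
  proof (cases "0 < x")
    case True
    have "(\<lambda>y. y / x) ` {0..x} = {0..1}" using True by simp
    then have "integral {0..1} (\<lambda>t. g s (x * t)) = (1 / \<bar>x\<bar>) *\<^sub>R integral {0..x} (g s)"
      using integral_stretch_real[of x 0 x "g s"] True by simp
    then show ?thesis using True by (simp add: field_simps)
  next
    case False
    then show ?thesis by (cases "x = 0") auto
  qed
  have "continuous_on UNIV (\<lambda>z. integral (cbox 0 1) (\<lambda>t. g (fst z) (max 0 (snd z) * t)))"
  proof (rule integral_continuous_on_param)
    show "continuous_on (UNIV \<times> cbox 0 1) (\<lambda>(z, t). g (fst z) (max 0 (snd z) * t))"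
      unfolding case_prod_unfold
      by (rule continuous_on_compose2[OF g[unfolded case_prod_unfold],
            of _ "\<lambda>y. (fst (fst y), max 0 (snd (fst y)) * snd y)", simplified])
         (intro continuous_intros)
  qed
  then show ?thesis unfolding eq case_prod_unfold by (intro continuous_intros)
qed

text \<open>
  The two bounds have different purposes. The homogeneous one makes every trajectory half-linear
  with a coefficient bounded by \<open>C\<close>, so that it cannot reach the origin of the phase plane; the
  uniform one makes all momenta Lipschitz with the same constant \<open>B\<close>.
\<close>

locale bounded_field =
  fixes p :: real and h :: "real \<Rightarrow> real \<Rightarrow> real \<Rightarrow> real" and C B \<Lambda> :: real
  assumes p: "1 < p"
    and h_cont: "continuous_on ({0<..<1} \<times> UNIV \<times> UNIV) (\<lambda>(x, s, l). h x s l)"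
    and h_le: "\<And>x s l. x \<in> {0<..<1} \<Longrightarrow> \<bar>l\<bar> \<le> \<Lambda> \<Longrightarrow> \<bar>h x s l\<bar> \<le> C * \<bar>phi p s\<bar>"
    and h_bdd: "\<And>x s l. x \<in> {0<..<1} \<Longrightarrow> \<bar>l\<bar> \<le> \<Lambda> \<Longrightarrow> \<bar>h x s l\<bar> \<le> B"
    and C_nonneg: "0 \<le> C"
begin

definition coef :: "real \<Rightarrow> (real \<Rightarrow> real) \<Rightarrow> real \<Rightarrow> real" where
  "coef l u x = h x (u x) l / phi p (u x)"

lemma coef_bound:
  assumes "\<bar>l\<bar> \<le> \<Lambda>" "x \<in> {0<..<1}"
  shows "\<bar>coef l u x\<bar> \<le> C"
  using h_le[OF assms(2,1), of "u x"] C_nonneg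
  by (cases "u x = 0") (auto simp: coef_def abs_divide divide_le_eq)

lemma trajectory_half_linear:
  assumes "trajectory p h l u v" "\<bar>l\<bar> \<le> \<Lambda>"
  shows "half_linear p (coef l u) u v"
proof -
  have "h x (u x) l = coef l u x * phi p (u x)" if "x \<in> {0<..<1}" for x
    using h_le[OF that assms(2), of "u x"] by (cases "u x = 0") (auto simp: coef_def)
  then show ?thesis using assms(1) unfolding trajectory_def half_linear_def by auto
qed

lemma trajectory_continuous:
  assumes "trajectory p h l u v" "\<bar>l\<bar> \<le> \<Lambda>"
  shows "continuous_on {0..1} u" "continuous_on {0..1} v"
  using half_linear_continuous[OF trajectory_half_linear[OF assms]] .

lemma trajectory_nonvanishing:
  assumes "trajectory p h l u v" "\<bar>l\<bar> \<le> \<Lambda>" "y \<in> {0..1}" "u y \<noteq> 0 \<or> v y \<noteq> 0" "x \<in> {0..1}"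
  shows "u x \<noteq> 0 \<or> v x \<noteq> 0"
  by (rule half_linear_nonvanishing[OF p trajectory_half_linear[OF assms(1,2)] coef_bound[OF assms(2)]])
     (use assms in auto)

lemma trajectory_polar:
  assumes tr: "trajectory p h l u v" and l: "\<bar>l\<bar> \<le> \<Lambda>" and v0: "0 < v 0"
  obtains \<theta> where "polar u v \<theta>"
proof (rule polar_exists[of u v])
  show "u x \<noteq> 0 \<or> v x \<noteq> 0" if "x \<in> {0..1}" for x
    by (rule trajectory_nonvanishing[OF tr l _ _ that, of 0]) (use v0 in auto)
  show "u 0 = 0" using tr by (simp add: trajectory_def)
qed (use that trajectory_continuous[OF tr l] v0 in auto)

text \<open>
  Tonelli's approximations: the nonlinearity is evaluated at the delayed argument \<open>t - 1/N\<close>, so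
  that \<open>N\<close> iterations starting from \<open>0\<close> produce the solution on \<open>[0,1]\<close>. Unlike solutions of the
  limit problem, which may fail to be unique, they are continuous in the parameter \<open>l\<close> and the
  initial slope. The first argument of \<open>h\<close> is kept away from the end points of \<open>[0,1]\<close>, where
  \<open>h\<close> need not have limits. The offset \<open>3\<close> in \<open>N = n + 3\<close> leaves room between \<open>1/N\<close> and
  \<open>1 - 1/N\<close>.
\<close>

definition delay :: "nat \<Rightarrow> real" where
  "delay n = 1 / of_nat (n + 3)"

definition trim :: "nat \<Rightarrow> real \<Rightarrow> real" where
  "trim n x = max (delay n) (min (1 - delay n) x)"

definition tonelli_slope :: "nat \<Rightarrow> (real \<times> real \<Rightarrow> real \<Rightarrow> real) \<Rightarrow> real \<times> real \<Rightarrow> real \<Rightarrow> real" where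
  "tonelli_slope n U s x =
     phi p (snd s) - integral {0..x} (\<lambda>t. h (trim n t) (U s (t - delay n)) (fst s))"

definition tonelli_step :: "nat \<Rightarrow> (real \<times> real \<Rightarrow> real \<Rightarrow> real) \<Rightarrow> real \<times> real \<Rightarrow> real \<Rightarrow> real" where
  "tonelli_step n U s x = integral {0..x} (\<lambda>t. phi (conj_exp p) (tonelli_slope n U s t))"

definition tonelli :: "nat \<Rightarrow> real \<times> real \<Rightarrow> real \<Rightarrow> real" where
  "tonelli n = (tonelli_step n ^^ (n + 3)) (\<lambda>_ _. 0)"

lemma delay_bounds: "0 < delay n" "delay n \<le> 1 / 3"
  by (auto simp: delay_def field_simps)

lemma delay_tendsto: "delay \<longlonglongrightarrow> 0"
  unfolding delay_def by (rule LIMSEQ_ignore_initial_segment[OF lim_1_over_n])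

lemma trim_in: "trim n x \<in> {0<..<1}"
  using delay_bounds[of n] by (auto simp: trim_def max_def min_def)

lemma continuous_on_h:
  assumes "continuous_on S f" "continuous_on S g" "continuous_on S l" "\<And>z. z \<in> S \<Longrightarrow> f z \<in> {0<..<1}"
  shows "continuous_on S (\<lambda>z. h (f z) (g z) (l z))"
proof -
  have "continuous_on S (\<lambda>z. (f z, g z, l z))" by (intro continuous_intros assms)
  moreover have "(\<lambda>z. (f z, g z, l z)) ` S \<subseteq> {0<..<1} \<times> UNIV \<times> UNIV" using assms(4) by blast
  ultimately show ?thesis using continuous_on_compose2[OF h_cont] by fastforce
qed

lemma tendsto_h:
  assumes "x \<in> {0<..<1}" "(f \<longlongrightarrow> x) F" "(g \<longlongrightarrow> s) F" "(l \<longlongrightarrow> l0) F"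
  shows "((\<lambda>i. h (f i) (g i) (l i)) \<longlongrightarrow> h x s l0) F"
proof -
  have "open ({0<..<1::real} \<times> (UNIV :: (real \<times> real) set))" by (intro open_Times) auto
  then have "isCont (\<lambda>(x, s, l). h x s l) (x, s, l0)"
    using h_cont assms(1) by (simp add: continuous_on_eq_continuous_at)
  moreover have "((\<lambda>i. (f i, g i, l i)) \<longlongrightarrow> (x, s, l0)) F" by (intro tendsto_intros assms)
  ultimately show ?thesis
    using isCont_tendsto_compose[of "(x, s, l0)" "\<lambda>(x, s, l). h x s l" "\<lambda>i. (f i, g i, l i)" F] by simp
qed

lemma continuous_on_trim: "continuous_on S (trim n)"
  unfolding trim_def by (intro continuous_intros)

lemma tonelli_slope_continuous:
  assumes "continuous_on UNIV (\<lambda>(s, x). U s x)"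
  shows "continuous_on UNIV (\<lambda>(s, x). tonelli_slope n U s x)"
proof -
  have "continuous_on UNIV (\<lambda>(s, t). h (trim n t) (U s (t - delay n)) (fst s))"
    unfolding case_prod_unfold
  proof (rule continuous_on_h)
    show "continuous_on UNIV (\<lambda>z. U (fst z) (snd z - delay n))"
      by (rule continuous_on_compose2[OF assms[unfolded case_prod_unfold],
            of _ "\<lambda>z. (fst z, snd z - delay n)", simplified]) (intro continuous_intros)
    show "continuous_on UNIV (\<lambda>z. trim n (snd z))"
      by (rule continuous_on_compose2[OF continuous_on_trim[of UNIV]]) (auto intro!: continuous_intros)
  qed (auto intro!: continuous_intros simp: trim_in simp del: greaterThanLessThan_iff)
  from continuous_on_integral_upper[OF this] show ?thesis
    unfolding tonelli_slope_def case_prod_unfold by (intro continuous_intros p)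
qed

lemma tonelli_step_continuous:
  assumes "continuous_on UNIV (\<lambda>(s, x). U s x)"
  shows "continuous_on UNIV (\<lambda>(s, x). tonelli_step n U s x)"
  unfolding tonelli_step_def
  using tonelli_slope_continuous[OF assms, of n]
  by (intro continuous_on_integral_upper) (auto simp: case_prod_unfold intro!: continuous_intros conj_exp_gt_1 p)

lemma tonelli_continuous: "continuous_on UNIV (\<lambda>(s, x). tonelli n s x)"
proof -
  have "continuous_on UNIV (\<lambda>(s, x). (tonelli_step n ^^ j) (\<lambda>_ _. 0) s x)" for j
    by (induction j) (auto intro: tonelli_step_continuous)
  then show ?thesis by (simp add: tonelli_def)
qed

lemma tonelli_iterates_stable:
  assumes "x \<le> of_nat j * delay n"
  shows "(tonelli_step n ^^ Suc j) (\<lambda>_ _. 0) s x = (tonelli_step n ^^ j) (\<lambda>_ _. 0) s x"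
  using assms
proof (induction j arbitrary: x)
  case 0
  then show ?case by (cases "x = 0") (auto simp: tonelli_step_def)
next
  case (Suc j)
  have "tonelli_slope n ((tonelli_step n ^^ Suc j) (\<lambda>_ _. 0)) s t
      = tonelli_slope n ((tonelli_step n ^^ j) (\<lambda>_ _. 0)) s t" if "t \<le> x" for t
  proof -
    have "(tonelli_step n ^^ Suc j) (\<lambda>_ _. 0) s (\<tau> - delay n) = (tonelli_step n ^^ j) (\<lambda>_ _. 0) s (\<tau> - delay n)"
      if "\<tau> \<le> t" for \<tau>
      using that \<open>t \<le> x\<close> Suc.prems by (intro Suc.IH) (simp add: algebra_simps)
    then show ?thesis unfolding tonelli_slope_def by (intro arg_cong2[where f = minus] integral_cong refl) auto
  qed
  then have "tonelli_step n ((tonelli_step n ^^ Suc j) (\<lambda>_ _. 0)) s x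
      = tonelli_step n ((tonelli_step n ^^ j) (\<lambda>_ _. 0)) s x"
    unfolding tonelli_step_def[of n _ s x] by (intro integral_cong) auto
  then show ?case by simp
qed

lemma tonelli_fixed: "x \<le> 1 \<Longrightarrow> tonelli n s x = tonelli_step n (tonelli n) s x"
proof -
  assume "x \<le> 1"
  then have "x \<le> of_nat (n + 3) * delay n" by (simp add: delay_def)
  from tonelli_iterates_stable[OF this, of s] show ?thesis
    unfolding tonelli_def by (simp only: funpow.simps(2) comp_apply)
qed

lemma tonelli_at_0: "tonelli n s 0 = 0" "tonelli_slope n U s 0 = phi p (snd s)"
  using tonelli_fixed[of 0 n s] by (simp_all add: tonelli_step_def tonelli_slope_def)

lemma tonelli_has_derivative:
  assumes x: "x \<in> {0..1}"
  shows "(tonelli n s has_real_derivative phi (conj_exp p) (tonelli_slope n (tonelli n) s x)) (at x within {0..1})"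
proof -
  have "continuous_on {0..1} (\<lambda>t. tonelli_slope n (tonelli n) s t)"
  proof -
    have "continuous_on {0..1} (\<lambda>t::real. (s, t))" by (intro continuous_intros)
    from continuous_on_compose2[OF tonelli_slope_continuous[OF tonelli_continuous, of n n] this]
    show ?thesis by auto
  qed
  then have "((\<lambda>x. tonelli_step n (tonelli n) s x) has_real_derivative
      phi (conj_exp p) (tonelli_slope n (tonelli n) s x)) (at x within {0..1})"
    unfolding tonelli_step_def [abs_def]
    by (intro integral_has_real_derivative x continuous_intros conj_exp_gt_1 p)
  then show ?thesis
    by (rule has_field_derivative_transform_within[OF _ zero_less_one x]) (simp add: tonelli_fixed)
qed

lemma tonelli_slope_has_derivative:
  assumes x: "x \<in> {0..1}"
  shows "(tonelli_slope n (tonelli n) s has_real_derivative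
      - h (trim n x) (tonelli n s (x - delay n)) (fst s)) (at x within {0..1})"
proof -
  have "continuous_on {0..1} (\<lambda>t. tonelli n s (t - delay n))"
  proof -
    have "continuous_on {0..1} (\<lambda>t. (s, t - delay n))" by (intro continuous_intros)
    from continuous_on_compose2[OF tonelli_continuous[of n] this] show ?thesis by auto
  qed
  then have "continuous_on {0..1} (\<lambda>t. h (trim n t) (tonelli n s (t - delay n)) (fst s))"
    by (intro continuous_on_h continuous_on_trim continuous_intros trim_in)
  from DERIV_diff[OF DERIV_const integral_has_real_derivative[OF this x]]
  show ?thesis unfolding tonelli_slope_def [abs_def] by simp
qed

text \<open>
  The momenta are equi-Lipschitz by the uniform bound of the field, and the delay disappears in the
  limit. At interior points the trimming of the first argument of \<open>h\<close> disappears as well.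
\<close>

lemma tonelli_limit:
  assumes m: "strict_mono m" and s: "\<And>n. s n \<in> {-\<Lambda>..\<Lambda>} \<times> {\<epsilon>..A}"
  obtains r l \<alpha> u v where "strict_mono (r :: nat \<Rightarrow> nat)" "(l, \<alpha>) \<in> {-\<Lambda>..\<Lambda>} \<times> {\<epsilon>..A}"
    "(\<lambda>n. s (r n)) \<longlonglongrightarrow> (l, \<alpha>)" "trajectory p h l u v" "v 0 = phi p \<alpha>"
    "uniform_limit {0..1} (\<lambda>n. tonelli (m (r n)) (s (r n))) u sequentially"
    "uniform_limit {0..1} (\<lambda>n. tonelli_slope (m (r n)) (tonelli (m (r n))) (s (r n))) v sequentially"
    "uniform_limit {0..1} (\<lambda>n x. phi (conj_exp p) (tonelli_slope (m (r n)) (tonelli (m (r n))) (s (r n)) x))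
       (\<lambda>x. phi (conj_exp p) (v x)) sequentially"
proof -
  have "compact ({-\<Lambda>..\<Lambda>} \<times> {\<epsilon>..A})" by (intro compact_Times) auto
  then obtain la r0 where r0: "la \<in> {-\<Lambda>..\<Lambda>} \<times> {\<epsilon>..A}" "strict_mono r0" "(s \<circ> r0) \<longlonglongrightarrow> la"
    using s unfolding compact_def by metis
  define l where "l = fst la"
  define \<alpha> where "\<alpha> = snd la"
  define U where "U n = tonelli (m (r0 n)) (s (r0 n))" for n
  define V where "V n = tonelli_slope (m (r0 n)) (tonelli (m (r0 n))) (s (r0 n))" for n
  define k where "k n x = h (trim (m (r0 n)) x) (U n (x - delay (m (r0 n)))) (fst (s (r0 n)))" for n x
  have dV: "(V n has_real_derivative - k n x) (at x within {0..1})" if "x \<in> {0..1}" for n x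
    unfolding V_def k_def U_def by (rule tonelli_slope_has_derivative[OF that])
  then have dV': "(V n has_real_derivative - k n x) (at x)" if "x \<in> {0<..<1}" for n x
    using that at_within_Icc_at[of 0 x 1] by (metis atLeastAtMost_iff greaterThanLessThan_iff less_imp_le)
  have cV: "continuous_on {0..1} (V n)" for n
    using dV DERIV_continuous continuous_on_eq_continuous_within by blast
  have sb: "\<bar>fst (s n)\<bar> \<le> \<Lambda>" "\<bar>snd (s n)\<bar> \<le> max \<bar>\<epsilon>\<bar> \<bar>A\<bar>" for n
    using s[of n] by (auto simp: abs_le_iff)
  obtain r1 u v where r1: "strict_mono (r1 :: nat \<Rightarrow> nat)"
    "uniform_limit {0..1} (\<lambda>i. U (r1 i)) u sequentially"
    "uniform_limit {0..1} (\<lambda>i. V (r1 i)) v sequentially"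
    "uniform_limit {0..1} (\<lambda>i x. phi (conj_exp p) (V (r1 i) x)) (\<lambda>x. phi (conj_exp p) (v x)) sequentially"
    "continuous_on {0..1} v" "u 0 = 0"
    "\<And>x. x \<in> {0..1} \<Longrightarrow> (u has_real_derivative phi (conj_exp p) (v x)) (at x within {0..1})"
  proof (rule phase_curves_compact[where U = U and V = V and k = k, OF p _ _ cV dV'])
    show "(U n has_real_derivative phi (conj_exp p) (V n x)) (at x within {0..1})" if "x \<in> {0..1}" for n x
      unfolding U_def V_def by (rule tonelli_has_derivative[OF that])
    show "U n 0 = 0" for n by (simp add: U_def tonelli_at_0)
    show "\<bar>k n x\<bar> \<le> B" for n x unfolding k_def by (rule h_bdd[OF trim_in sb(1)])
    show "\<bar>V n 0\<bar> \<le> (max \<bar>\<epsilon>\<bar> \<bar>A\<bar>) powr (p - 1)" for n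
      unfolding V_def tonelli_at_0 abs_phi using p by (intro powr_mono2 sb) auto
  qed (assumption, rule that)
  have cu: "continuous_on {0..1} u"
    using r1(7) DERIV_continuous continuous_on_eq_continuous_within by blast
  have s_lim: "(\<lambda>n. s (r0 (r1 n))) \<longlonglongrightarrow> (l, \<alpha>)"
    using LIMSEQ_subseq_LIMSEQ[OF r0(3) r1(1)] by (simp add: comp_def l_def \<alpha>_def)
  have dv: "(v has_real_derivative - h x (u x) l) (at x)" if x: "x \<in> {0<..<1}" for x
  proof (rule limit_equation[where V = "\<lambda>n. V (r1 n)" and k = "\<lambda>n. k (r1 n)" and
        kl = "\<lambda>x. h x (u x) l", OF cV dV' _ _ _ x])
    show "(\<lambda>n. V (r1 n) x) \<longlonglongrightarrow> v x" if "x \<in> {0..1}" for x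
      using tendsto_uniform_limitI[OF r1(3) that] .
    show "continuous_on {0<..<1} (\<lambda>x. h x (u x) l)"
      by (intro continuous_on_h continuous_on_subset[OF cu] continuous_intros) auto
    fix r :: "nat \<Rightarrow> nat" and \<xi> :: "nat \<Rightarrow> real" and x
    assume r: "strict_mono r" and x: "x \<in> {0<..<1}" and \<xi>: "\<xi> \<longlonglongrightarrow> x"
    let ?r = "\<lambda>i. m (r0 (r1 (r i)))"
    have "strict_mono (m \<circ> (r0 \<circ> (r1 \<circ> r)))"
      by (intro strict_mono_o m r0(2) r1(1) r)
    then have "strict_mono ?r" by (simp add: comp_def)
    then have del: "(\<lambda>i. delay (?r i)) \<longlonglongrightarrow> 0"
      using LIMSEQ_subseq_LIMSEQ[OF delay_tendsto] by (simp add: comp_def)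
    have "(\<lambda>i. trim (?r i) (\<xi> i)) \<longlonglongrightarrow> max 0 (min (1 - 0) x)"
      unfolding trim_def by (intro tendsto_intros del \<xi>)
    then have inn: "(\<lambda>i. trim (?r i) (\<xi> i)) \<longlonglongrightarrow> x" using x by (simp add: max_def min_def)
    have shift: "(\<lambda>i. \<xi> i - delay (?r i)) \<longlonglongrightarrow> x"
      using tendsto_diff[OF \<xi> del] by simp
    have "\<forall>\<^sub>F i in sequentially. \<xi> i - delay (?r i) \<in> {0<..<1}"
      by (rule topological_tendstoD[OF shift]) (use x in auto)
    then have ev: "\<forall>\<^sub>F i in sequentially. \<xi> i - delay (?r i) \<in> {0..1}"
      by eventually_elim auto
    have "uniform_limit {0..1} (\<lambda>i. U (r1 (r i))) u sequentially"
      by (rule filterlim_compose[OF r1(2) filterlim_subseq[OF r]])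
    then have "(\<lambda>i. U (r1 (r i)) (\<xi> i - delay (?r i))) \<longlonglongrightarrow> u x"
      by (rule uniform_limit_diagonal[OF _ cu _ shift ev]) (use x in auto)
    moreover have "(\<lambda>i. fst (s (r0 (r1 (r i))))) \<longlonglongrightarrow> l"
      using tendsto_fst[OF LIMSEQ_subseq_LIMSEQ[OF s_lim r]] by (simp add: comp_def)
    ultimately show "(\<lambda>i. k (r1 (r i)) (\<xi> i)) \<longlonglongrightarrow> h x (u x) l"
      unfolding k_def by (intro tendsto_h x inn)
  qed
  show thesis
  proof (rule that[of "r0 \<circ> r1" l \<alpha> u v])
    show "strict_mono (r0 \<circ> r1)" using r0(2) r1(1) by (rule strict_mono_o)
    show "trajectory p h l u v" using r1 dv unfolding trajectory_def by auto
    have "(\<lambda>i. V (r1 i) 0) \<longlonglongrightarrow> v 0" using tendsto_uniform_limitI[OF r1(3), of 0] by simp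
    moreover have "(\<lambda>i. V (r1 i) 0) \<longlonglongrightarrow> phi p \<alpha>"
      unfolding V_def tonelli_at_0 using tendsto_snd[OF s_lim] by (intro tendsto_intros p) simp
    ultimately show "v 0 = phi p \<alpha>" by (rule LIMSEQ_unique)
  qed (use r0(1) s_lim r1 in \<open>auto simp: l_def \<alpha>_def U_def V_def\<close>)
qed

lemma tonelli_eventually_nonvanishing:
  assumes \<epsilon>: "0 < \<epsilon>"
  shows "\<exists>N. \<forall>n\<ge>N. \<forall>s\<in>{-\<Lambda>..\<Lambda>} \<times> {\<epsilon>..A}. \<forall>x\<in>{0..1}.
           tonelli n s x \<noteq> 0 \<or> tonelli_slope n (tonelli n) s x \<noteq> 0"
proof (rule ccontr)
  let ?Q = "\<lambda>n. \<exists>s\<in>{-\<Lambda>..\<Lambda>} \<times> {\<epsilon>..A}. \<exists>x\<in>{0..1}.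
           tonelli n s x = 0 \<and> tonelli_slope n (tonelli n) s x = 0"
  assume "\<not> ?thesis"
  then have "\<exists>n\<ge>N. ?Q n" for N by force
  then have "infinite {n. ?Q n}" unfolding infinite_nat_iff_unbounded_le by auto
  then obtain m :: "nat \<Rightarrow> nat" where m: "strict_mono m" "\<And>n. ?Q (m n)"
    using infinite_enumerate[of "{n. ?Q n}"] by auto
  then obtain s x where s: "\<And>n. s n \<in> {-\<Lambda>..\<Lambda>} \<times> {\<epsilon>..A}" and x: "\<And>n. x n \<in> {0..1}"
    and zero: "\<And>n. tonelli (m n) (s n) (x n) = 0" "\<And>n. tonelli_slope (m n) (tonelli (m n)) (s n) (x n) = 0"
    by metis
  obtain r l \<alpha> u v where r: "strict_mono (r :: nat \<Rightarrow> nat)" "(l, \<alpha>) \<in> {-\<Lambda>..\<Lambda>} \<times> {\<epsilon>..A}"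
    "trajectory p h l u v" "v 0 = phi p \<alpha>"
    "uniform_limit {0..1} (\<lambda>n. tonelli (m (r n)) (s (r n))) u sequentially"
    "uniform_limit {0..1} (\<lambda>n. tonelli_slope (m (r n)) (tonelli (m (r n))) (s (r n))) v sequentially"
    by (rule tonelli_limit[where s = s, OF m(1) s]) blast
  have l: "\<bar>l\<bar> \<le> \<Lambda>" using r(2) by auto
  obtain y r' where y: "y \<in> {0..1}" "strict_mono r'" "((x \<circ> r) \<circ> r') \<longlonglongrightarrow> y"
    using compact_Icc[of "0::real" 1] x unfolding compact_def by (metis comp_apply)
  have ev: "\<forall>\<^sub>F i in sequentially. ((x \<circ> r) \<circ> r') i \<in> {0..1}" using x by simp
  have "(\<lambda>i. tonelli (m (r (r' i))) (s (r (r' i))) (((x \<circ> r) \<circ> r') i)) \<longlonglongrightarrow> u y"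
    by (rule uniform_limit_diagonal[OF filterlim_compose[OF r(5) filterlim_subseq[OF y(2)]]
          trajectory_continuous(1)[OF r(3) l] y(1,3) ev])
  then have "u y = 0" using zero(1) by (simp add: LIMSEQ_const_iff)
  have "(\<lambda>i. tonelli_slope (m (r (r' i))) (tonelli (m (r (r' i)))) (s (r (r' i))) (((x \<circ> r) \<circ> r') i)) \<longlonglongrightarrow> v y"
    by (rule uniform_limit_diagonal[OF filterlim_compose[OF r(6) filterlim_subseq[OF y(2)]]
          trajectory_continuous(2)[OF r(3) l] y(1,3) ev])
  then have "v y = 0" using zero(2) by (simp add: LIMSEQ_const_iff)
  moreover have "v 0 \<noteq> 0" using r(2,4) \<epsilon> by auto
  ultimately show False
    using trajectory_nonvanishing[OF r(3) l, of 0 y] \<open>u y = 0\<close> y(1) by auto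
qed

text \<open>
  The interface of the shooting method: single-valued approximate solutions with an angle at \<open>1\<close>
  that depends continuously on \<open>l\<close> and on the initial slope, all of whose limits are trajectories.
\<close>

theorem shooting_family:
  fixes \<epsilon> A :: real
  assumes \<epsilon>: "0 < \<epsilon>"
  defines "P \<equiv> {-\<Lambda>..\<Lambda>} \<times> {\<epsilon>..A}"
  obtains U V \<Theta> :: "nat \<Rightarrow> real \<times> real \<Rightarrow> real \<Rightarrow> real"
  where "\<And>n. continuous_on (P \<times> {0..1}) (\<lambda>(s, x). U n s x)"
    "\<And>n. continuous_on (P \<times> {0..1}) (\<lambda>(s, x). V n s x)"
    "\<And>n. continuous_on P (\<lambda>s. \<Theta> n s 1)"
    "\<And>n s. s \<in> P \<Longrightarrow> U n s 0 = 0" "\<And>n s. s \<in> P \<Longrightarrow> V n s 0 = phi p (snd s)"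
    "\<And>n s x. s \<in> P \<Longrightarrow> x \<in> {0..1} \<Longrightarrow>
        (U n s has_real_derivative phi (conj_exp p) (V n s x)) (at x within {0..1})"
    "\<And>m s. strict_mono m \<Longrightarrow> (\<And>n. s n \<in> P) \<Longrightarrow>
       \<exists>r l \<alpha> u v \<theta>. strict_mono (r :: nat \<Rightarrow> nat) \<and> (l, \<alpha>) \<in> P \<and> (\<lambda>n. s (r n)) \<longlonglongrightarrow> (l, \<alpha>) \<and>
         trajectory p h l u v \<and> v 0 = phi p \<alpha> \<and> polar u v \<theta> \<and>
         uniform_limit {0..1} (\<lambda>n. U (m (r n)) (s (r n))) u sequentially \<and>
         uniform_limit {0..1} (\<lambda>n x. phi (conj_exp p) (V (m (r n)) (s (r n)) x))
           (\<lambda>x. phi (conj_exp p) (v x)) sequentially \<and>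
         (\<lambda>n. \<Theta> (m (r n)) (s (r n)) 1) \<longlonglongrightarrow> \<theta> 1"
proof -
  obtain N where N: "\<And>n s x. N \<le> n \<Longrightarrow> s \<in> P \<Longrightarrow> x \<in> {0..1} \<Longrightarrow>
      tonelli n s x \<noteq> 0 \<or> tonelli_slope n (tonelli n) s x \<noteq> 0"
    using tonelli_eventually_nonvanishing[OF \<epsilon>, of A] unfolding P_def by blast
  define U where "U n = tonelli (n + N)" for n
  define V where "V n = tonelli_slope (n + N) (tonelli (n + N))" for n
  have cU: "continuous_on (P \<times> {0..1}) (\<lambda>(s, x). U n s x)" for n
    unfolding U_def by (rule continuous_on_subset[OF tonelli_continuous]) simp
  have cV: "continuous_on (P \<times> {0..1}) (\<lambda>(s, x). V n s x)" for n
    unfolding V_def by (rule continuous_on_subset[OF tonelli_slope_continuous[OF tonelli_continuous]]) simp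
  have V0: "V n s 0 = phi p (snd s)" for n s by (simp add: V_def tonelli_at_0)
  have "\<exists>\<theta>. continuous_on (P \<times> {0..1}) (\<lambda>(s, x). \<theta> s x) \<and> (\<forall>s\<in>P. polar (U n s) (V n s) (\<theta> s))" for n
  proof -
    have "convex P" unfolding P_def by (intro convex_Times) auto
    moreover have "0 < V n s 0" if "s \<in> P" for s using that \<epsilon> V0[of n s] by (auto simp: P_def)
    moreover have "U n s 0 = 0" for s by (simp add: U_def tonelli_at_0)
    moreover have "U n s x \<noteq> 0 \<or> V n s x \<noteq> 0" if "s \<in> P" "x \<in> {0..1}" for s x
      unfolding U_def V_def by (rule N[OF _ that]) simp
    ultimately show ?thesis using polar_lift[of P "U n" "V n"] cU[of n] cV[of n] by metis
  qed
  then obtain \<Theta> where c\<Theta>: "\<And>n. continuous_on (P \<times> {0..1}) (\<lambda>(s, x). \<Theta> n s x)"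
    and \<Theta>: "\<And>n s. s \<in> P \<Longrightarrow> polar (U n s) (V n s) (\<Theta> n s)" by metis
  show thesis
  proof (rule that[OF cU cV])
    show "continuous_on P (\<lambda>s. \<Theta> n s 1)" for n
    proof -
      have "continuous_on P (\<lambda>s. (s, 1::real))" by (intro continuous_intros)
      moreover have "(\<lambda>s. (s, 1::real)) ` P \<subseteq> P \<times> {0..1}" by auto
      ultimately show ?thesis using continuous_on_compose2[OF c\<Theta>[of n]] by fastforce
    qed
    show "U n s 0 = 0" for n s by (simp add: U_def tonelli_at_0)
    show "V n s 0 = phi p (snd s)" for n s by (rule V0)
    show "(U n s has_real_derivative phi (conj_exp p) (V n s x)) (at x within {0..1})"
      if "x \<in> {0..1}" for n s x
      unfolding U_def V_def by (rule tonelli_has_derivative[OF that])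
    fix m :: "nat \<Rightarrow> nat" and s :: "nat \<Rightarrow> real \<times> real"
    assume m: "strict_mono m" and s: "\<And>n. s n \<in> P"
    have "strict_mono (\<lambda>n. m n + N)" using m by (simp add: strict_mono_def)
    then obtain r l \<alpha> u v where r: "strict_mono (r :: nat \<Rightarrow> nat)" "(l, \<alpha>) \<in> P"
      "(\<lambda>n. s (r n)) \<longlonglongrightarrow> (l, \<alpha>)" "trajectory p h l u v" "v 0 = phi p \<alpha>"
      "uniform_limit {0..1} (\<lambda>n. U (m (r n)) (s (r n))) u sequentially"
      "uniform_limit {0..1} (\<lambda>n. V (m (r n)) (s (r n))) v sequentially"
      "uniform_limit {0..1} (\<lambda>n x. phi (conj_exp p) (V (m (r n)) (s (r n)) x)) (\<lambda>x. phi (conj_exp p) (v x)) sequentially"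
      by (rule tonelli_limit[where s = s, OF _ s[unfolded P_def]]) (unfold U_def V_def P_def, blast)
    have l: "\<bar>l\<bar> \<le> \<Lambda>" and "0 < v 0" using r(2,5) \<epsilon> by (auto simp: P_def)
    then obtain \<theta> where \<theta>: "polar u v \<theta>" by (rule trajectory_polar[OF r(4)])
    have "(\<lambda>n. \<Theta> (m (r n)) (s (r n)) 1) \<longlonglongrightarrow> \<theta> 1"
      by (rule polar_limit[OF trajectory_continuous[OF r(4) l] \<theta> \<Theta>[OF s] r(6,7)])
    then show "\<exists>r l \<alpha> u v \<theta>. strict_mono (r :: nat \<Rightarrow> nat) \<and> (l, \<alpha>) \<in> P \<and> (\<lambda>n. s (r n)) \<longlonglongrightarrow> (l, \<alpha>) \<and>
         trajectory p h l u v \<and> v 0 = phi p \<alpha> \<and> polar u v \<theta> \<and>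
         uniform_limit {0..1} (\<lambda>n. U (m (r n)) (s (r n))) u sequentially \<and>
         uniform_limit {0..1} (\<lambda>n x. phi (conj_exp p) (V (m (r n)) (s (r n)) x))
           (\<lambda>x. phi (conj_exp p) (v x)) sequentially \<and>
         (\<lambda>n. \<Theta> (m (r n)) (s (r n)) 1) \<longlonglongrightarrow> \<theta> 1"
      using r \<theta> by blast
  qed
qed

end

section \<open>Solutions as trajectories\<close>

lemma trajectory_cong_values:
  assumes tr: "trajectory p h l u v"
    and eq: "\<And>x. x \<in> {0..1} \<Longrightarrow> u' x = u x" "\<And>x. x \<in> {0..1} \<Longrightarrow> v' x = v x"
  shows "trajectory p h l u' v'"
  unfolding trajectory_def
proof (intro conjI ballI)
  show "u' 0 = 0" using tr eq(1)[of 0] by (simp add: trajectory_def)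
  show "continuous_on {0..1} v'"
    using tr eq(2) continuous_on_cong[of "{0..1}" "{0..1}" v' v] by (simp add: trajectory_def)
  fix x :: real assume x: "x \<in> {0..1}"
  have "(u has_real_derivative phi (conj_exp p) (v x)) (at x within {0..1})"
    using tr x by (simp add: trajectory_def)
  then have "(u has_real_derivative phi (conj_exp p) (v' x)) (at x within {0..1})"
    using eq(2)[OF x] by simp
  then show "(u' has_real_derivative phi (conj_exp p) (v' x)) (at x within {0..1})"
    by (rule has_field_derivative_transform_within[OF _ zero_less_one x]) (use eq in auto)
next
  fix x :: real assume x: "x \<in> {0<..<1}"
  have "(v has_real_derivative - h x (u x) l) (at x)"
    using tr x by (simp add: trajectory_def)
  then have "(v has_real_derivative - h x (u' x) l) (at x)" using eq(1)[of x] x by simp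
  then show "(v' has_real_derivative - h x (u' x) l) (at x)"
    by (rule has_field_derivative_transform_within_open[of _ _ _ "{0<..<1}"]) (use eq x in auto)
qed

lemma plap_solution_iff_trajectory:
  assumes p: "1 < p"
  shows "plap_solution p a F l e \<longleftrightarrow>
    trajectory p (\<lambda>x s l. l * a x * phi p s + F x s l) l (fn e) (\<lambda>x. phi p (dfn e x))"
    (is "_ \<longleftrightarrow> trajectory p ?h l ?u ?v")
proof
  assume sol: "plap_solution p a F l e"
  show "trajectory p ?h l ?u ?v"
    unfolding trajectory_def
  proof (intro conjI ballI)
    show "(fn e has_real_derivative phi (conj_exp p) (?v x)) (at x within {0..1})" if "x \<in> {0..1}" for x
      using fn_has_derivative[OF that, of e] p by (simp add: phi_inverse)
    show "continuous_on {0..1} ?v" by (intro continuous_intros p continuous_on_dfn)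
    fix x :: real assume x: "x \<in> {0<..<1}"
    have d: "?v differentiable (at x)" "deriv ?v x + ?h x (?u x) l = 0"
      using sol x unfolding plap_solution_def by (auto simp: add.assoc)
    then have "(?v has_real_derivative deriv ?v x) (at x)"
      by (simp add: DERIV_deriv_iff_real_differentiable)
    moreover have "deriv ?v x = - ?h x (?u x) l" using d(2) by linarith
    ultimately show "(?v has_real_derivative - ?h x (?u x) l) (at x)" by simp
  qed simp
next
  assume tr: "trajectory p ?h l ?u ?v"
  show "plap_solution p a F l e"
    unfolding plap_solution_def
  proof
    fix x :: real assume x: "x \<in> {0<..<1}"
    have d: "(?v has_real_derivative - ?h x (?u x) l) (at x)" using tr x by (simp add: trajectory_def)
    then have "deriv ?v x = - ?h x (?u x) l" by (rule DERIV_imp_deriv)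
    then show "?v differentiable (at x) \<and> deriv ?v x + l * a x * phi p (fn e x) + F x (fn e x) l = 0"
      using d real_differentiable_def by auto
  qed
qed

text \<open>
  Subtracting \<open>x u(1)\<close> turns every \<open>C\<^sup>1\<close> function with \<open>u(0) = 0\<close> into an element of \<open>E\<close>, and
  changes nothing if \<open>u(1) = 0\<close>. Thus approximate solutions can be compared with solutions in
  \<open>E\<close> before the boundary condition at \<open>1\<close> holds.
\<close>

definition to_c1 :: "(real \<Rightarrow> real) \<Rightarrow> c1_zero" where
  "to_c1 u = Abs_c1_zero (\<lambda>x. if x \<in> {0..1} then u x - x * u 1 else 0)"

lemma to_c1:
  assumes u0: "u 0 = 0" and w: "continuous_on {0..1} w"
    and du: "\<And>x. x \<in> {0..1} \<Longrightarrow> (u has_real_derivative w x) (at x within {0..1})"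
    and x: "x \<in> {0..1}"
  shows "fn (to_c1 u) x = u x - x * u 1" "dfn (to_c1 u) x = w x - u 1"
proof -
  let ?f = "\<lambda>x. if x \<in> {0..1} then u x - x * u 1 else 0"
  have d: "(?f has_real_derivative w x - u 1) (at x within {0..1})" if x: "x \<in> {0..1}" for x
  proof -
    have "((\<lambda>x. u x - x * u 1) has_real_derivative w x - u 1) (at x within {0..1})"
      by (auto intro!: derivative_eq_intros du[OF x])
    then show ?thesis
      by (rule has_field_derivative_transform_within[OF _ zero_less_one x]) auto
  qed
  have "?f \<in> {u. (\<exists>u'. continuous_on {0..1} u' \<and>
          (\<forall>x\<in>{0..1}. (u has_real_derivative u' x) (at x within {0..1}))) \<and>
    u 0 = 0 \<and> u 1 = 0 \<and> (\<forall>x. x \<notin> {0..1} \<longrightarrow> u x = 0)}"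
    using d u0 by (auto intro!: exI[of _ "\<lambda>x. w x - u 1"] continuous_intros w)
  then have fn: "fn (to_c1 u) = ?f" unfolding to_c1_def by (rule Abs_c1_zero_inverse)
  show "fn (to_c1 u) x = u x - x * u 1" using x by (simp add: fn)
  show "dfn (to_c1 u) x = w x - u 1" by (rule dfn_unique[OF x]) (use d[OF x] in \<open>simp add: fn\<close>)
qed

lemma fn_eqI:
  assumes "\<And>x. x \<in> {0..1} \<Longrightarrow> fn e x = fn e' x" shows "e = e'"
proof -
  have "fn e x = fn e' x" for x using assms[of x] fn_outside[of x] by (cases "x \<in> {0..1}") auto
  then show ?thesis by (metis fn_inject ext)
qed

lemma fn_uminus: "fn (- e) x = - fn e x"
  by (simp add: uminus_c1_zero.rep_eq)

lemma fn_diff: "fn (e - e') x = fn e x - fn e' x"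
  by (simp add: minus_c1_zero.rep_eq)

lemma dfn_uminus: "x \<in> {0..1} \<Longrightarrow> dfn (- e) x = - dfn e x"
  using dfn_scaleR[of x "-1" e] by simp

lemma dfn_diff: "x \<in> {0..1} \<Longrightarrow> dfn (e - e') x = dfn e x - dfn e' x"
  using dfn_add[of x "e - e'" e'] by simp

lemma norm_c1_upper:
  assumes "x \<in> {0..1}" "y \<in> {0..1}"
  shows "\<bar>fn e x\<bar> + \<bar>dfn e y\<bar> \<le> norm e"
  using SUP_abs_upper[OF continuous_on_fn[of e] assms(1)] SUP_abs_upper[OF continuous_on_dfn[of e] assms(2)]
  unfolding norm_c1_zero_def by linarith

lemma norm_c1_le:
  assumes "\<And>x. x \<in> {0..1} \<Longrightarrow> \<bar>fn e x\<bar> \<le> c" "\<And>x. x \<in> {0..1} \<Longrightarrow> \<bar>dfn e x\<bar> \<le> d"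
  shows "norm e \<le> c + d"
  unfolding norm_c1_zero_def using assms by (intro add_mono cSUP_least) auto

text \<open>
  This bound makes up for the possible blow-up of \<open>F(x,s,l)\<close> as \<open>x\<close> tends to \<open>0\<close> or \<open>1\<close>.
\<close>

lemma fn_tent_bound:
  assumes x: "x \<in> {0..1}"
  shows "\<bar>fn e x\<bar> \<le> norm e * min x (1 - x)"
proof -
  have d: "(fn e has_real_derivative dfn e x) (at x)" if "x \<in> {0<..<1}" for x
    using fn_has_derivative[of x e] at_within_Icc_at[of 0 x 1] that by simp
  have b: "\<bar>dfn e x\<bar> \<le> norm e" if "x \<in> {0<..<1}" for x
    using norm_c1_upper[of x x e] that abs_ge_zero[of "fn e x"] by auto
  have "\<bar>fn e x - fn e 0\<bar> \<le> norm e * \<bar>x - 0\<bar>" "\<bar>fn e x - fn e 1\<bar> \<le> norm e * \<bar>x - 1\<bar>"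
    by (rule lipschitz_of_bounded_derivative[OF continuous_on_fn d b]; use x in auto)+
  then show ?thesis using x by (auto simp: min_def)
qed

lemma trajectory_to_c1:
  assumes p: "1 < p" and tr: "trajectory p h l u v" and u1: "u 1 = 0" and x: "x \<in> {0..1}"
  shows "fn (to_c1 u) x = u x" "dfn (to_c1 u) x = phi (conj_exp p) (v x)"
    "phi p (dfn (to_c1 u) x) = v x"
proof -
  have w: "continuous_on {0..1} (\<lambda>x. phi (conj_exp p) (v x))"
    using tr p by (intro continuous_intros conj_exp_gt_1) (auto simp: trajectory_def)
  show f: "fn (to_c1 u) x = u x" "dfn (to_c1 u) x = phi (conj_exp p) (v x)"
    using to_c1[OF _ w _ x, of u] tr u1 by (auto simp: trajectory_def)
  show "phi p (dfn (to_c1 u) x) = v x" using f p by (simp add: phi_inverse)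
qed

lemma polar_cong_values:
  assumes "polar u v \<theta>" "\<And>x. x \<in> {0..1} \<Longrightarrow> u' x = u x" "\<And>x. x \<in> {0..1} \<Longrightarrow> v' x = v x"
  shows "polar u' v' \<theta>"
  using assms unfolding polar_def by simp

text \<open>
  This lemma and the next translate between nodal classes and angles, the angle being the
  quantity that is continuous in parameters and monotone in the coefficient.
\<close>

lemma S_plus_of_angle:
  assumes hl: "half_linear p q (fn e) (\<lambda>x. phi p (dfn e x))"
    and pol: "polar (fn e) (\<lambda>x. phi p (dfn e x)) \<theta>" and k: "\<theta> 1 = of_nat k * pi"
  shows "e \<in> S_plus k"
proof -
  obtain r where "0 < r" "phi p (dfn e 0) = r * cos (\<theta> 0)" by (rule polarE[OF pol, of 0]) auto
  then have "0 < dfn e 0" using polar_at_0[OF pol] phi_pos_iff[of p "dfn e 0"] by simp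
  then obtain d where d: "0 < d" "\<And>h. 0 < h \<Longrightarrow> 0 + h \<in> {0..1} \<Longrightarrow> h < d \<Longrightarrow> fn e 0 < fn e (0 + h)"
    using has_real_derivative_pos_inc_right[OF fn_has_derivative[of 0 e]] by auto
  have "\<forall>\<^sub>F x in at_right 0. fn e x > 0"
    using d unfolding eventually_at_right_field by (intro exI[of _ "min d 1"]) auto
  moreover have "dfn e x \<noteq> 0" if "x \<in> {0..1}" "fn e x = 0" for x
    using polar_nonvanishing[OF pol that(1)] that(2) by simp
  ultimately show ?thesis
    using polar_zero_count[OF hl pol k] by (auto simp: S_plus_def)
qed

lemma angle_of_S_plus:
  assumes p: "1 < p" and hl: "half_linear p q (fn e) (\<lambda>x. phi p (dfn e x))"
    and q: "\<And>x. x \<in> {0<..<1} \<Longrightarrow> \<bar>q x\<bar> \<le> C" and e: "e \<in> S_plus k" and k: "1 \<le> k"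
  obtains \<theta> where "polar (fn e) (\<lambda>x. phi p (dfn e x)) \<theta>" "\<theta> 1 = of_nat k * pi"
proof -
  have nd0: "dfn e 0 \<noteq> 0" using e unfolding S_plus_def by auto
  have pos: "0 < dfn e 0"
  proof (rule ccontr)
    assume "\<not> ?thesis"
    then have "dfn (- e) 0 > 0" using nd0 by (simp add: dfn_uminus)
    then obtain d where d: "0 < d" "\<And>h. 0 < h \<Longrightarrow> 0 + h \<in> {0..1} \<Longrightarrow> h < d \<Longrightarrow> fn (- e) 0 < fn (- e) (0 + h)"
      using has_real_derivative_pos_inc_right[OF fn_has_derivative[of 0 "- e"]] by auto
    have "\<forall>\<^sub>F x in at_right 0. fn e x < 0"
      using d unfolding eventually_at_right_field by (intro exI[of _ "min d 1"]) (auto simp: fn_uminus)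
    moreover have "\<forall>\<^sub>F x in at_right 0. fn e x > 0" using e by (simp add: S_plus_def)
    ultimately have "\<forall>\<^sub>F x in at_right (0::real). False" by eventually_elim simp
    then show False by simp
  qed
  have nz: "fn e x \<noteq> 0 \<or> phi p (dfn e x) \<noteq> 0" if "x \<in> {0..1}" for x
    using that e by (auto simp: S_plus_def)
  obtain \<theta> where pol: "polar (fn e) (\<lambda>x. phi p (dfn e x)) \<theta>"
    using polar_exists[OF half_linear_continuous[OF hl] nz] pos by auto
  obtain i :: int where i: "\<theta> 1 = of_int i * pi" using polar_zero_iff[OF pol, of 1] by auto
  have "0 < of_int i * pi" using polar_pos[OF hl pol, of 1] i by simp
  then have i0: "0 < i" by (simp add: zero_less_mult_iff)
  then have i': "\<theta> 1 = of_nat (nat i) * pi" using i by simp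
  have "nat i - 1 = k - 1" using polar_zero_count(2)[OF hl pol i'] e by (simp add: S_plus_def)
  then have "nat i = k" using k i0 by linarith
  then show thesis using that[OF pol] i' by simp
qed

section \<open>The eigenvalues\<close>

lemma eventually_by_subsequences:
  assumes "\<And>m. strict_mono (m :: nat \<Rightarrow> nat) \<Longrightarrow> \<exists>n. P (m n)"
  shows "\<forall>\<^sub>F n in sequentially. P n"
proof (rule ccontr)
  assume "\<not> ?thesis"
  then have "\<exists>n\<ge>N. \<not> P n" for N unfolding eventually_sequentially by blast
  then have "infinite {n. \<not> P n}" unfolding infinite_nat_iff_unbounded_le by auto
  then show False using assms infinite_enumerate[of "{n. \<not> P n}"] by blast
qed

locale plap_weight =
  fixes p :: real and a :: "real \<Rightarrow> real"
  assumes p: "1 < p"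
    and a_cont: "continuous_on {0..1} a"
    and a_pos: "\<And>x. x \<in> {0..1} \<Longrightarrow> 0 < a x"
begin

lemma a_bounds:
  "\<exists>lo hi. 0 < lo \<and> (\<forall>x\<in>{0..1}. lo \<le> a x \<and> a x \<le> hi) \<and> lo = (INF x\<in>{0..1}. a x)"
proof -
  obtain y where y: "y \<in> {0..1}" "\<And>x. x \<in> {0..1} \<Longrightarrow> a y \<le> a x"
    using continuous_attains_inf[of "{0..1::real}" a] a_cont by force
  obtain z where z: "z \<in> {0..1}" "\<And>x. x \<in> {0..1} \<Longrightarrow> a x \<le> a z"
    using continuous_attains_sup[of "{0..1::real}" a] a_cont by force
  have "a y = (INF x\<in>{0..1}. a x)"
    using y by (intro cInf_eq_minimum[symmetric]) auto
  then have "0 < a y \<and> (\<forall>x\<in>{0..1}. a y \<le> a x \<and> a x \<le> a z) \<and> a y = (INF x\<in>{0..1}. a x)"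
    using y(2) z(2) a_pos[OF y(1)] by blast
  then show ?thesis by blast
qed

text \<open>
  \<open>eigen_class l j\<close>: the angle of the solution of the eigenvalue equation with positive slope at
  \<open>0\<close> is \<open>j\<pi>\<close> at \<open>1\<close>, that is, \<open>l\<close> has an eigenfunction in \<open>S\<^sub>j\<^sup>+\<close>.
\<close>

definition eigen_class :: "real \<Rightarrow> nat \<Rightarrow> bool" where
  "eigen_class l j \<longleftrightarrow> (\<exists>u v \<theta>. half_linear p (\<lambda>x. l * a x) u v \<and> u 0 = 0 \<and> polar u v \<theta> \<and>
     \<theta> 1 = of_nat j * pi)"

lemma eigen_class_pos: "eigen_class l j \<Longrightarrow> 1 \<le> j"
  unfolding eigen_class_def by (metis One_nat_def Suc_leI gr0I less_irrefl mult_zero_left of_nat_0 order_refl polar_pos zero_less_one)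

lemma eigen_class_strict:
  assumes "eigen_class l j" "eigen_class l' j'" "l < l'"
  shows "j < j'"
proof -
  obtain u v \<theta> u' v' \<theta>' where u: "half_linear p (\<lambda>x. l * a x) u v" "polar u v \<theta>" "\<theta> 1 = of_nat j * pi"
    and u': "half_linear p (\<lambda>x. l' * a x) u' v'" "polar u' v' \<theta>'" "\<theta>' 1 = of_nat j' * pi"
    using assms(1,2) unfolding eigen_class_def by blast
  have "of_nat j * pi < \<theta>' 1"
    by (rule sturm_angle_strict[OF p u(1,2) u'(1,2)]) (use u(3) assms(3) a_pos in auto)
  then show ?thesis using u'(3) by simp
qed

lemma eigen_class_unique:
  assumes "eigen_class l j" "eigen_class l j'"
  shows "j = j'"
proof -
  have "j \<le> j'" if j: "eigen_class l j" and j': "eigen_class l j'" for j j'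
  proof -
    obtain u v \<theta> where u: "half_linear p (\<lambda>x. l * a x) u v" "polar u v \<theta>" "\<theta> 1 = of_nat j * pi"
      using j unfolding eigen_class_def by blast
    obtain u' v' \<theta>' where u': "half_linear p (\<lambda>x. l * a x) u' v'" "polar u' v' \<theta>'" "\<theta>' 1 = of_nat j' * pi"
      using j' unfolding eigen_class_def by blast
    have "of_nat j * pi \<le> \<theta>' 1"
      by (rule sturm_angle_weak[OF p u(1,2) u'(1,2)]) (use u(3) in auto)
    then show ?thesis using u'(3) by simp
  qed
  then show ?thesis using assms by (meson le_antisym)
qed

lemma eigen_class_of_solution:
  assumes hl: "half_linear p (\<lambda>x. l * a x) u v" and u: "u 0 = 0" "u 1 = 0"
    and v: "v 0 \<noteq> 0"
  shows "\<exists>j. eigen_class l j"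
proof -
  have *: "\<exists>j. eigen_class l j" if hl: "half_linear p (\<lambda>x. l * a x) u v" and u: "u 0 = 0" "u 1 = 0"
    and v: "0 < v 0" for u v
  proof -
    obtain hi where "\<And>x. x \<in> {0..1} \<Longrightarrow> a x \<le> hi" using a_bounds by blast
    then have q: "\<bar>l * a x\<bar> \<le> \<bar>l\<bar> * hi" if "x \<in> {0<..<1}" for x
      using a_pos[of x] that by (auto simp: abs_mult intro!: mult_left_mono)
    have nz: "u x \<noteq> 0 \<or> v x \<noteq> 0" if "x \<in> {0..1}" for x
      by (rule half_linear_nonvanishing[OF p hl q _ _ that, of 0]) (use v in auto)
    obtain \<theta> where pol: "polar u v \<theta>"
      by (rule polar_exists[OF half_linear_continuous[OF hl] nz u(1) v]) auto
    obtain i :: int where i: "\<theta> 1 = of_int i * pi" using polar_zero_iff[OF pol, of 1] u by auto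
    have "0 < of_int i * pi" using polar_pos[OF hl pol, of 1] i by simp
    then have "0 < i" by (simp add: zero_less_mult_iff)
    then have "\<theta> 1 = of_nat (nat i) * pi" using i by simp
    then show ?thesis using hl u(1) pol unfolding eigen_class_def by blast
  qed
  show ?thesis
  proof (cases "0 < v 0")
    case True
    then show ?thesis using *[OF hl u] by blast
  next
    case False
    then show ?thesis using *[OF half_linear_uminus[OF hl]] u v by auto
  qed
qed

lemma half_linear_trajectory:
  "trajectory p (\<lambda>x s l. l * a x * phi p s + 0) l u v \<longleftrightarrow>
     half_linear p (\<lambda>x. l * a x) u v \<and> u 0 = 0"
  unfolding trajectory_def half_linear_def by auto

lemma plap_eigenvalue_iff: "plap_eigenvalue p a l \<longleftrightarrow> (\<exists>j. eigen_class l j)"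
proof
  assume "plap_eigenvalue p a l"
  then obtain e where e: "e \<noteq> 0" and "plap_solution p a (\<lambda>_ _ _. 0) l e"
    by (auto simp: plap_eigenvalue_def)
  then have hl: "half_linear p (\<lambda>x. l * a x) (fn e) (\<lambda>x. phi p (dfn e x))"
    using plap_solution_iff_trajectory[OF p, of a "\<lambda>_ _ _. 0"] half_linear_trajectory by simp
  obtain hi where "\<And>x. x \<in> {0..1} \<Longrightarrow> a x \<le> hi" using a_bounds by blast
  then have q: "\<bar>l * a x\<bar> \<le> \<bar>l\<bar> * hi" if "x \<in> {0<..<1}" for x
    using a_pos[of x] that by (auto simp: abs_mult intro!: mult_left_mono)
  obtain y where y: "y \<in> {0..1}" "fn e y \<noteq> 0"
    using e fn_eqI[of e 0] by (auto simp: zero_c1_zero.rep_eq)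
  have "fn e 0 \<noteq> 0 \<or> phi p (dfn e 0) \<noteq> 0"
    by (rule half_linear_nonvanishing[OF p hl q y(1)]) (use y in auto)
  then show "\<exists>j. eigen_class l j" by (intro eigen_class_of_solution[OF hl]) auto
next
  assume "\<exists>j. eigen_class l j"
  then obtain j u v \<theta> where hl: "half_linear p (\<lambda>x. l * a x) u v" and u0: "u 0 = 0"
    and pol: "polar u v \<theta>" and j: "\<theta> 1 = of_nat j * pi"
    unfolding eigen_class_def by blast
  have tr: "trajectory p (\<lambda>x s l. l * a x * phi p s + 0) l u v"
    using half_linear_trajectory hl u0 by blast
  have u1: "u 1 = 0" using polar_zero_iff[OF pol, of 1] j by (metis atLeastAtMost_iff of_int_of_nat_eq order_refl zero_le_one)
  note c = trajectory_to_c1[OF p tr u1]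
  have "plap_solution p a (\<lambda>_ _ _. 0) l (to_c1 u)"
    unfolding plap_solution_iff_trajectory[OF p] by (rule trajectory_cong_values[OF tr]) (use c in auto)
  moreover have "to_c1 u \<noteq> 0"
  proof
    assume "to_c1 u = 0"
    then have "v 0 = 0" using c(3)[of 0] by (simp add: dfn_0)
    then show False using polar_nonvanishing[OF pol, of 0] u0 by auto
  qed
  ultimately show "plap_eigenvalue p a l" unfolding plap_eigenvalue_def by blast
qed

lemma angle_for_zero_eigenvalue:
  assumes hl: "half_linear p (\<lambda>x. 0 * a x) u v" and u0: "u 0 = 0" and v0: "0 < v 0"
    and pol: "polar u v \<theta>"
  shows "\<theta> 1 < pi"
proof (rule ccontr)
  assume "\<not> ?thesis"
  then have "of_nat 1 * pi \<le> \<theta> 1" by simp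
  then obtain X :: "nat \<Rightarrow> real" where X: "X 0 = 0" "\<And>j. j \<le> 1 \<Longrightarrow> X j \<in> {0..1}"
    "\<And>j. j \<le> 1 \<Longrightarrow> u (X j) = 0" "\<And>j. j < 1 \<Longrightarrow> X j < X (Suc j)"
    by (rule polar_nodal_points[OF hl pol]) blast
  have X1: "0 < X 1" "X 1 \<le> 1" "u (X 1) = 0" using X(1) X(2)[of 1] X(3)[of 1] X(4)[of 0] by auto
  obtain \<xi> where \<xi>: "0 < \<xi>" "\<xi> < X 1" "u (X 1) - u 0 = (X 1 - 0) * phi (conj_exp p) (v \<xi>)"
    by (rule increment_eq[OF half_linear_continuous(1)[OF hl] half_linear_derivs(2)[OF hl] order_refl X1(1,2)])
  obtain \<eta> where "v \<xi> - v 0 = (\<xi> - 0) * - (0 * a \<eta> * phi p (u \<eta>))"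
    using increment_eq[OF half_linear_continuous(2)[OF hl] half_linear_derivs(3)[OF hl] order_refl \<xi>(1)]
      \<xi>(2) X1(2) by (metis less_eq_real_def order_trans)
  then have "0 < phi (conj_exp p) (v \<xi>)" using v0 by simp
  then show False using \<xi>(3) X1 u0 by simp
qed

text \<open>
  Along shooting with a fixed small slope, the angle at \<open>1\<close> is less than
  \<open>\<pi>\<close> for \<open>l = 0\<close> and exceeds \<open>j\<pi>\<close> for large \<open>l\<close>. The cut-off at \<open>1\<close> only makes the field
  bounded; the slope is so small that solutions never reach it.
\<close>

lemma eigen_class_exists:
  assumes j: "1 \<le> j"
  shows "\<exists>l. eigen_class l j"
proof -
  obtain lo hi where lohi: "0 < lo" "\<And>x. x \<in> {0..1} \<Longrightarrow> lo \<le> a x" "\<And>x. x \<in> {0..1} \<Longrightarrow> a x \<le> hi"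
    using a_bounds by blast
  have hi: "0 \<le> hi" using lohi(1) lohi(2)[of 0] lohi(3)[of 0] by simp
  have "\<exists>Q. \<forall>q u v. half_linear p q u v \<longrightarrow> (\<forall>x\<in>{0..1}. u x \<noteq> 0 \<or> v x \<noteq> 0) \<longrightarrow>
      (\<forall>x. of_nat i / of_nat j < x \<and> x < of_nat (Suc i) / of_nat j \<longrightarrow> Q \<le> q x) \<longrightarrow>
     (\<exists>x. of_nat i / of_nat j < x \<and> x < of_nat (Suc i) / of_nat j \<and> u x = 0)" if i: "i < j" for i
  proof -
    have "0 \<le> of_nat i / (of_nat j :: real)" "of_nat i / of_nat j < of_nat (Suc i) / (of_nat j :: real)"
      "of_nat (Suc i) / of_nat j \<le> (1::real)" using i by (auto simp: divide_simps)
    from large_coefficient_zero[OF p this] show ?thesis by metis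
  qed
  then obtain Q where Q: "\<And>i q u v. i < j \<Longrightarrow> half_linear p q u v \<Longrightarrow> (\<forall>x\<in>{0..1}. u x \<noteq> 0 \<or> v x \<noteq> 0) \<Longrightarrow>
      (\<forall>x. of_nat i / of_nat j < x \<and> x < of_nat (Suc i) / of_nat j \<longrightarrow> Q i \<le> q x) \<Longrightarrow>
     (\<exists>x. of_nat i / of_nat j < x \<and> x < of_nat (Suc i) / of_nat j \<and> u x = 0)" by metis
  \<comment> \<open>A common multiple of the weight that exceeds all thresholds \<open>Q i\<close>.\<close>
  define \<Lambda> where "\<Lambda> = (\<Sum>i<j. \<bar>Q i\<bar>) / lo"
  have \<Lambda>0: "0 \<le> \<Lambda>" using lohi(1) by (simp add: \<Lambda>_def sum_nonneg)
  have \<Lambda>Q: "Q i \<le> \<Lambda> * lo" if "i < j" for i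
  proof -
    have "\<bar>Q i\<bar> \<le> (\<Sum>i<j. \<bar>Q i\<bar>)" using that by (intro member_le_sum) auto
    then show ?thesis using lohi(1) by (simp add: \<Lambda>_def)
  qed
  define cut where "cut s = max (-1) (min 1 s)" for s :: real
  define h where "h x s l = l * a x * phi p (cut s)" for x s l
  define C where "C = \<Lambda> * hi"
  have C0: "0 \<le> C" using \<Lambda>0 hi by (simp add: C_def)
  have cut: "\<bar>cut s\<bar> \<le> \<bar>s\<bar>" "\<bar>cut s\<bar> \<le> 1" for s by (auto simp: cut_def)
  have la: "\<bar>l * a x\<bar> \<le> C" if "x \<in> {0<..<1}" "\<bar>l\<bar> \<le> \<Lambda>" for x l
    unfolding C_def abs_mult using that lohi(3)[of x] a_pos[of x] \<Lambda>0 by (intro mult_mono) auto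
  interpret bounded_field p h C C \<Lambda>
  proof
    show "continuous_on ({0<..<1} \<times> UNIV \<times> UNIV) (\<lambda>(x, s, l). h x s l)"
      unfolding h_def cut_def case_prod_unfold
      by (intro continuous_intros p continuous_on_compose2[OF a_cont]) auto
    fix x s l :: real assume x: "x \<in> {0<..<1}" and l: "\<bar>l\<bar> \<le> \<Lambda>"
    have "\<bar>h x s l\<bar> = \<bar>l * a x\<bar> * \<bar>phi p (cut s)\<bar>" by (simp add: h_def abs_mult)
    also have "\<dots> \<le> C * \<bar>phi p (cut s)\<bar>" using la[OF x l] by (intro mult_right_mono) auto
    finally have *: "\<bar>h x s l\<bar> \<le> C * \<bar>phi p (cut s)\<bar>" .
    have "\<bar>phi p (cut s)\<bar> \<le> \<bar>phi p s\<bar>" "\<bar>phi p (cut s)\<bar> \<le> 1 powr (p - 1)"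
      unfolding abs_phi using cut[of s] p by (intro powr_mono2; simp)+
    then show "\<bar>h x s l\<bar> \<le> C * \<bar>phi p s\<bar>" "\<bar>h x s l\<bar> \<le> C"
      using * C0 by (auto elim!: order_trans intro!: mult_left_mono mult_left_le)
  qed (use p C0 in auto)
  define \<epsilon> where "\<epsilon> = exp (- ((p + conj_exp p * C) / p))"
  have \<epsilon>: "0 < \<epsilon>" by (simp add: \<epsilon>_def)
  have hl: "half_linear p (\<lambda>x. l * a x) u v"
    if tr: "trajectory p h l u v" and l: "\<bar>l\<bar> \<le> \<Lambda>" and v0: "v 0 = phi p \<epsilon>" for l u v
  proof -
    have u0: "u 0 = 0" using tr by (simp add: trajectory_def)
    have "\<bar>u x\<bar> \<le> 1" if "x \<in> {0..1}" for x
      using half_linear_small(1)[OF p trajectory_half_linear[OF tr l] coef_bound[OF l] u0 v0 \<epsilon> that C0]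
      by (simp add: \<epsilon>_def exp_add [symmetric])
    then have "h x (u x) l = l * a x * phi p (u x)" if "x \<in> {0<..<1}" for x
      using that abs_le_iff[of "u x" 1] by (auto simp: h_def cut_def)
    then show ?thesis using tr unfolding trajectory_def half_linear_def by auto
  qed
  obtain U V \<Theta> :: "nat \<Rightarrow> real \<times> real \<Rightarrow> real \<Rightarrow> real"
    where c\<Theta>: "\<And>n. continuous_on ({-\<Lambda>..\<Lambda>} \<times> {\<epsilon>..\<epsilon>}) (\<lambda>s. \<Theta> n s 1)"
    and lim: "\<And>m s. strict_mono m \<Longrightarrow> (\<And>n. s n \<in> {-\<Lambda>..\<Lambda>} \<times> {\<epsilon>..\<epsilon>}) \<Longrightarrow>
       \<exists>r l \<alpha> u v \<theta>. strict_mono (r :: nat \<Rightarrow> nat) \<and> (l, \<alpha>) \<in> {-\<Lambda>..\<Lambda>} \<times> {\<epsilon>..\<epsilon>} \<and>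
         (\<lambda>n. s (r n)) \<longlonglongrightarrow> (l, \<alpha>) \<and>
         trajectory p h l u v \<and> v 0 = phi p \<alpha> \<and> polar u v \<theta> \<and>
         uniform_limit {0..1} (\<lambda>n. U (m (r n)) (s (r n))) u sequentially \<and>
         uniform_limit {0..1} (\<lambda>n x. phi (conj_exp p) (V (m (r n)) (s (r n)) x))
           (\<lambda>x. phi (conj_exp p) (v x)) sequentially \<and>
         (\<lambda>n. \<Theta> (m (r n)) (s (r n)) 1) \<longlonglongrightarrow> \<theta> 1"
    by (rule shooting_family[OF \<epsilon>, of \<epsilon>]) blast
  have limit: "\<exists>r l \<theta>. strict_mono (r :: nat \<Rightarrow> nat) \<and> (\<lambda>n. L (r n)) \<longlonglongrightarrow> l \<and>
      (\<lambda>n. \<Theta> (m (r n)) (L (r n), \<epsilon>) 1) \<longlonglongrightarrow> \<theta> 1 \<and>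
      (\<exists>u v. half_linear p (\<lambda>x. l * a x) u v \<and> u 0 = 0 \<and> 0 < v 0 \<and> polar u v \<theta>)"
    if m: "strict_mono m" and L: "\<And>n. L n \<in> {-\<Lambda>..\<Lambda>}" for m L
  proof -
    obtain r l \<alpha> u v \<theta> where r: "strict_mono (r :: nat \<Rightarrow> nat)" "(l, \<alpha>) \<in> {-\<Lambda>..\<Lambda>} \<times> {\<epsilon>..\<epsilon>}"
      "(\<lambda>n. (L (r n), \<epsilon>)) \<longlonglongrightarrow> (l, \<alpha>)" "trajectory p h l u v" "v 0 = phi p \<alpha>" "polar u v \<theta>"
      "(\<lambda>n. \<Theta> (m (r n)) (L (r n), \<epsilon>) 1) \<longlonglongrightarrow> \<theta> 1"
      using lim[OF m, of "\<lambda>n. (L n, \<epsilon>)"] L by auto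
    have l: "\<bar>l\<bar> \<le> \<Lambda>" "\<alpha> = \<epsilon>" using r(2) by auto
    then have "half_linear p (\<lambda>x. l * a x) u v" using hl[OF r(4)] r(5) by simp
    moreover have "u 0 = 0" using r(4) by (simp add: trajectory_def)
    moreover have "0 < v 0" using r(5) l \<epsilon> by simp
    moreover have "(\<lambda>n. L (r n)) \<longlonglongrightarrow> l" using tendsto_fst[OF r(3)] by simp
    ultimately show ?thesis using r by blast
  qed
  have low: "\<forall>\<^sub>F n in sequentially. \<Theta> n (0, \<epsilon>) 1 < of_nat j * pi"
  proof (rule eventually_by_subsequences)
    fix m :: "nat \<Rightarrow> nat" assume "strict_mono m"
    from limit[OF this, of "\<lambda>_. 0"] obtain r l \<theta> u v where r: "(\<lambda>n. 0::real) \<longlonglongrightarrow> l"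
      "(\<lambda>n. \<Theta> (m (r n)) (0, \<epsilon>) 1) \<longlonglongrightarrow> \<theta> 1" "half_linear p (\<lambda>x. l * a x) u v" "u 0 = 0" "0 < v 0" "polar u v \<theta>"
      using \<Lambda>0 by auto
    have "l = 0" using r(1) LIMSEQ_const_iff[of 0 l] by auto
    then have "\<theta> 1 < pi" using angle_for_zero_eigenvalue[OF _ r(4,5,6)] r(3) by simp
    also have "pi \<le> of_nat j * pi" using j by simp
    finally have "\<forall>\<^sub>F n in sequentially. \<Theta> (m (r n)) (0, \<epsilon>) 1 < of_nat j * pi"
      using order_tendstoD(2)[OF r(2)] by blast
    then show "\<exists>n. \<Theta> (m n) (0, \<epsilon>) 1 < of_nat j * pi"
      using eventually_happens'[OF sequentially_bot] by blast
  qed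
  have high: "\<forall>\<^sub>F n in sequentially. of_nat j * pi < \<Theta> n (\<Lambda>, \<epsilon>) 1"
  proof (rule eventually_by_subsequences)
    fix m :: "nat \<Rightarrow> nat" assume "strict_mono m"
    from limit[OF this, of "\<lambda>_. \<Lambda>"] obtain r l \<theta> u v where r: "(\<lambda>n. \<Lambda>) \<longlonglongrightarrow> l"
      "(\<lambda>n. \<Theta> (m (r n)) (\<Lambda>, \<epsilon>) 1) \<longlonglongrightarrow> \<theta> 1" "half_linear p (\<lambda>x. l * a x) u v" "polar u v \<theta>"
      using \<Lambda>0 by auto
    have "l = \<Lambda>" using r(1) LIMSEQ_const_iff[of \<Lambda> l] by auto
    have nd: "\<forall>x\<in>{0..1}. u x \<noteq> 0 \<or> v x \<noteq> 0" using polar_nonvanishing[OF r(4)] by blast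
    have zero: "\<exists>x. of_nat i / of_nat j < x \<and> x < of_nat (Suc i) / of_nat j \<and> u x = 0" if i: "i < j" for i
    proof (rule Q[OF i r(3) nd], intro allI impI)
      fix x :: real assume x: "of_nat i / of_nat j < x \<and> x < of_nat (Suc i) / of_nat j"
      have "of_nat (Suc i) / of_nat j \<le> (1::real)" "0 \<le> of_nat i / (of_nat j :: real)"
        using i by (auto simp: divide_simps)
      then have "x \<in> {0..1}" using x unfolding atLeastAtMost_iff by linarith
      then have "\<Lambda> * lo \<le> \<Lambda> * a x" using lohi(2)[of x] \<Lambda>0 by (intro mult_left_mono) auto
      then show "Q i \<le> l * a x" using order_trans[OF \<Lambda>Q[OF i]] \<open>l = \<Lambda>\<close> by simp
    qed
    have "of_nat i / of_nat j \<in> {0..1::real}" if "i \<le> j" for i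
      using that j by (auto simp: divide_simps)
    then have "of_nat j * pi < \<theta> 1"
      by (rule polar_angle_interlacing(2)[OF r(3,4), of j "\<lambda>i. of_nat i / of_nat j"])
         (use zero less_imp_le in blast)+
    then have "\<forall>\<^sub>F n in sequentially. of_nat j * pi < \<Theta> (m (r n)) (\<Lambda>, \<epsilon>) 1"
      using order_tendstoD(1)[OF r(2)] by blast
    then show "\<exists>n. of_nat j * pi < \<Theta> (m n) (\<Lambda>, \<epsilon>) 1"
      using eventually_happens'[OF sequentially_bot] by blast
  qed
  obtain N where N: "\<And>n. N \<le> n \<Longrightarrow> \<Theta> n (0, \<epsilon>) 1 < of_nat j * pi \<and> of_nat j * pi < \<Theta> n (\<Lambda>, \<epsilon>) 1"
    using eventually_conj[OF low high] unfolding eventually_sequentially by blast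
  have "\<exists>l\<in>{0..\<Lambda>}. \<Theta> (n + N) (l, \<epsilon>) 1 = of_nat j * pi" for n
  proof -
    have c: "continuous_on {0..\<Lambda>} (\<lambda>l. \<Theta> (n + N) (l, \<epsilon>) 1)"
      by (rule continuous_on_compose2[OF c\<Theta>[of "n + N"]]) (use \<Lambda>0 in \<open>auto intro!: continuous_intros\<close>)
    show ?thesis
      using IVT'[of "\<lambda>l. \<Theta> (n + N) (l, \<epsilon>) 1" 0 "of_nat j * pi" \<Lambda>] N[of "n + N"] \<Lambda>0 c by auto
  qed
  then obtain L where L: "\<And>n. L n \<in> {0..\<Lambda>}" "\<And>n. \<Theta> (n + N) (L n, \<epsilon>) 1 = of_nat j * pi" by metis
  have "strict_mono (\<lambda>n. n + N)" by (simp add: strict_mono_def)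
  moreover have "L n \<in> {-\<Lambda>..\<Lambda>}" for n using L(1)[of n] \<Lambda>0 by auto
  ultimately obtain r l \<theta> u v where r: "(\<lambda>n. \<Theta> (r n + N) (L (r n), \<epsilon>) 1) \<longlonglongrightarrow> \<theta> 1"
    "half_linear p (\<lambda>x. l * a x) u v" "u 0 = 0" "polar u v \<theta>"
    using limit[of "\<lambda>n. n + N" L] by auto
  have "\<theta> 1 = of_nat j * pi" using r(1) L(2) by (simp add: LIMSEQ_const_iff)
  then show ?thesis using r unfolding eigen_class_def by blast
qed

text \<open>
  By strict comparison a larger eigenvalue has a larger class, and by weak comparison an eigenvalue
  has only one class. As all classes occur, the eigenvalue with \<open>k - 1\<close> eigenvalues below it is
  the one of class \<open>k\<close>.
\<close>

theorem eigen_class_plap_eig: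
  assumes k: "1 \<le> k"
  shows "eigen_class (plap_eig p a k) k"
proof -
  obtain \<mu> where \<mu>: "\<And>j. 1 \<le> j \<Longrightarrow> eigen_class (\<mu> j) j" using eigen_class_exists by metis
  have unique: "l = \<mu> j" if "eigen_class l j" for l j
  proof -
    have "eigen_class (\<mu> j) j" using \<mu> eigen_class_pos[OF that] by blast
    then show ?thesis using eigen_class_strict that by (metis linorder_neqE_linordered_idom less_irrefl_nat)
  qed
  have mono: "\<mu> i < \<mu> j \<longleftrightarrow> i < j" if "1 \<le> i" "1 \<le> j" for i j
  proof -
    note ij = \<mu>[OF that(1)] \<mu>[OF that(2)]
    have "i = j" if "\<mu> i = \<mu> j" using eigen_class_unique ij that by simp
    then show ?thesis
      using eigen_class_strict[OF ij] eigen_class_strict[OF ij(2,1)]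
      by (cases "\<mu> i" "\<mu> j" rule: linorder_cases) auto
  qed
  have ev: "plap_eigenvalue p a l \<longleftrightarrow> (\<exists>j\<ge>1. l = \<mu> j)" for l
    unfolding plap_eigenvalue_iff using unique eigen_class_pos \<mu> by blast
  have below: "{m. plap_eigenvalue p a m \<and> m < \<mu> j} = \<mu> ` {1..<j}" if "1 \<le> j" for j
    unfolding ev using mono[OF _ that] by auto
  have inj: "inj_on \<mu> {1..<j}" for j
    by (rule inj_onI) (metis atLeastLessThan_iff linorder_neqE_nat mono order_less_irrefl)
  have card: "card {m. plap_eigenvalue p a m \<and> m < \<mu> j} = j - 1" if "1 \<le> j" for j
    unfolding below[OF that] using card_image[OF inj] by simp
  have "plap_eig p a k = \<mu> k"
    unfolding plap_eig_def
  proof (rule the_equality)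
    show "plap_eigenvalue p a (\<mu> k) \<and> finite {m. plap_eigenvalue p a m \<and> m < \<mu> k} \<and>
        card {m. plap_eigenvalue p a m \<and> m < \<mu> k} = k - 1"
      using ev k card[OF k] below[OF k] by auto
    fix l assume l: "plap_eigenvalue p a l \<and> finite {m. plap_eigenvalue p a m \<and> m < l} \<and>
        card {m. plap_eigenvalue p a m \<and> m < l} = k - 1"
    then obtain j where j: "1 \<le> j" "l = \<mu> j" using ev by blast
    then have "j - 1 = k - 1" using l card[OF j(1)] by simp
    then show "l = \<mu> k" using j k by (metis le_add_diff_inverse)
  qed
  then show ?thesis using \<mu>[OF k] by simp
qed

end

section \<open>Two facts from topology\<close>

text \<open>The Poincare--Miranda theorem: clamp \<open>z - G(z)\<close> to the rectangle and apply Brouwer.\<close>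

lemma poincare_miranda:
  fixes G1 G2 :: "real \<times> real \<Rightarrow> real"
  assumes ab: "a \<le> b" and cd: "c \<le> d"
    and G1: "continuous_on ({a..b} \<times> {c..d}) G1" and G2: "continuous_on ({a..b} \<times> {c..d}) G2"
    and left: "\<And>y. y \<in> {c..d} \<Longrightarrow> G1 (a, y) \<le> 0" and right: "\<And>y. y \<in> {c..d} \<Longrightarrow> 0 \<le> G1 (b, y)"
    and bottom: "\<And>x. x \<in> {a..b} \<Longrightarrow> G2 (x, c) \<le> 0" and top: "\<And>x. x \<in> {a..b} \<Longrightarrow> 0 \<le> G2 (x, d)"
  shows "\<exists>z\<in>{a..b} \<times> {c..d}. G1 z = 0 \<and> G2 z = 0"
proof -
  define T where "T z = (max a (min b (fst z - G1 z)), max c (min d (snd z - G2 z)))" for z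
  obtain z where z: "z \<in> {a..b} \<times> {c..d}" "T z = z"
  proof (rule brouwer)
    show "compact ({a..b} \<times> {c..d})" "convex ({a..b} \<times> {c..d})"
      by (auto intro!: compact_Times convex_Times)
    show "{a..b} \<times> {c..d} \<noteq> {}" using ab cd by simp
    show "continuous_on ({a..b} \<times> {c..d}) T"
      unfolding T_def by (intro continuous_intros G1 G2)
    show "T \<in> {a..b} \<times> {c..d} \<rightarrow> {a..b} \<times> {c..d}" using ab cd by (auto simp: T_def)
  qed (rule that)
  obtain x y where xy: "z = (x, y)" by (cases z)
  have x: "x \<in> {a..b}" "x = max a (min b (x - G1 z))" and y: "y \<in> {c..d}" "y = max c (min d (y - G2 z))"
    using z unfolding T_def xy by auto
  have "G1 z = 0"
    using x left[OF y(1)] right[OF y(1)] unfolding xy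
    by (cases "G1 (x, y)" "0::real" rule: linorder_cases) (auto simp: max_def min_def split: if_splits)
  moreover have "G2 z = 0"
    using y bottom[OF x(1)] top[OF x(1)] unfolding xy
    by (cases "G2 (x, y)" "0::real" rule: linorder_cases) (auto simp: max_def min_def split: if_splits)
  ultimately show ?thesis using z(1) by blast
qed

text \<open>
  Components and quasi-components of compact spaces agree. Therefore a bounded component can be
  enclosed in a compact relatively open subset \<open>K\<close>, which has a positive distance from the rest of
  the set.
\<close>

lemma bounded_component_separated:
  fixes X :: "'a::real_normed_vector set"
  assumes X: "closed X" and comp: "\<And>R. compact (X \<inter> cball 0 R)" and x: "x \<in> X"
    and bdd: "bounded (connected_component_set X x)"
  obtains K \<delta> where "compact K" "connected_component_set X x \<subseteq> K" "0 < \<delta>" "\<delta> \<le> 1"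
    "\<And>z. z \<in> X \<Longrightarrow> infdist z K \<noteq> \<delta>"
proof -
  define D where "D = connected_component_set X x"
  obtain b where b: "\<And>z. z \<in> D \<Longrightarrow> norm z \<le> b" using bdd unfolding bounded_iff D_def by blast
  define R where "R = b + 1"
  have DR: "D \<subseteq> ball 0 R" using b by (force simp: R_def)
  define S where "S = X \<inter> cball 0 R"
  have S: "compact S" by (simp add: S_def comp)
  have DX: "D \<subseteq> X" unfolding D_def by (rule connected_component_subset)
  have DS: "D \<subseteq> S" using DX DR by (auto simp: S_def)
  have xD: "x \<in> D" using x by (simp add: D_def)
  have conn: "connected D" by (simp add: D_def)
  let ?T = "top_of_set S"
  have "compact_space ?T" using S by (simp add: compact_space_subtopology)
  moreover have "Hausdorff_space ?T" by (simp add: Hausdorff_space_subtopology Hausdorff_space_euclidean)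
  ultimately have "quasi_components_of ?T = connected_components_of ?T"
    by (intro quasi_eq_connected_components_of) auto
  then have quasi: "quasi_component_of ?T z = connected_component_of ?T z" for z
    unfolding quasi_eq_connected_components_of_pointwise_alt by blast
  have sep: "\<exists>T. x \<in> T \<and> closedin ?T T \<and> openin ?T T \<and> y \<notin> T" if y: "y \<in> S" "y \<notin> D" for y
  proof -
    have "\<not> connected_component_of ?T x y"
    proof
      assume "connected_component_of ?T x y"
      then obtain C where C: "connectedin ?T C" "x \<in> C" "y \<in> C"
        unfolding connected_component_of_def by blast
      then have "connected C" "C \<subseteq> S" by (auto simp: connectedin_subtopology)
      then have "C \<subseteq> D" unfolding D_def
        using C(2) by (intro connected_component_maximal) (auto simp: S_def)
      then show False using C(3) y(2) by blast
    qed
    then have "\<not> quasi_component_of ?T x y" by (simp add: quasi)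
    then show ?thesis using y(1) xD DS unfolding quasi_component_of by auto
  qed
  define B where "B = S - ball 0 R"
  have B: "compact B" unfolding B_def using S by (intro compact_diff) auto
  have "\<forall>y\<in>B. \<exists>T. x \<in> T \<and> closedin ?T T \<and> openin ?T T \<and> y \<notin> T"
    using sep DR by (auto simp: B_def)
  then obtain T where T: "\<And>y. y \<in> B \<Longrightarrow> x \<in> T y \<and> closedin ?T (T y) \<and> openin ?T (T y) \<and> y \<notin> T y"
    by metis
  have "\<exists>W. open W \<and> S - T y = S \<inter> W" if "y \<in> B" for y
  proof -
    have "openin ?T (S - T y)" using T[OF that] openin_diff[of ?T S "T y"] by simp
    then show ?thesis by (simp add: openin_open)
  qed
  then obtain W where W: "\<And>y. y \<in> B \<Longrightarrow> open (W y) \<and> S - T y = S \<inter> W y" by metis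
  have "B \<subseteq> (\<Union>y\<in>B. W y)"
  proof
    fix y assume y: "y \<in> B"
    then have "y \<in> S - T y" using T[OF y] by (simp add: B_def)
    then show "y \<in> (\<Union>y\<in>B. W y)" using W[OF y] y by blast
  qed
  then obtain B' where B': "B' \<subseteq> B" "finite B'" "B \<subseteq> (\<Union>y\<in>B'. W y)"
    using compactE_image[OF B, of B W] W by auto
  define K where "K = S \<inter> (\<Inter>y\<in>B'. T y)"
  have DT: "D \<subseteq> T y" if y: "y \<in> B" for y
  proof
    fix z assume z: "z \<in> D"
    have "connectedin ?T D" using conn DS by (simp add: connectedin_subtopology)
    then have "connected_component_of ?T x z"
      using xD z unfolding connected_component_of_def by blast
    then have "quasi_component_of ?T x z" by (simp add: quasi)
    then show "z \<in> T y" using T[OF y] unfolding quasi_component_of by auto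
  qed
  have DK: "D \<subseteq> K" using DT DS B'(1) by (auto simp: K_def)
  have cK: "closedin ?T K"
  proof (cases "B' = {}")
    case False
    then show ?thesis using T B'(1) unfolding K_def
      by (intro closedin_Int closedin_INT) auto
  qed (simp add: K_def)
  have oK: "openin ?T K"
  proof (cases "B' = {}")
    case False
    then show ?thesis using T B'(1,2) unfolding K_def
      by (intro openin_Int openin_INT2) auto
  qed (simp add: K_def)
  have compK: "compact K" using closedin_compact[OF S cK] .
  have KR: "K \<subseteq> ball 0 R"
  proof
    fix z assume z: "z \<in> K"
    show "z \<in> ball 0 R"
    proof (rule ccontr)
      assume "z \<notin> ball 0 R"
      then have "z \<in> B" using z by (auto simp: B_def K_def)
      then obtain y where y: "y \<in> B'" "z \<in> W y" using B'(3) by blast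
      moreover have "z \<in> S" using z by (simp add: K_def)
      ultimately have "z \<notin> T y" using W[of y] B'(1) by blast
      then show False using z y by (auto simp: K_def)
    qed
  qed
  have "closed (S - K)"
    using oK S closedin_closed_trans[of S "S - K"] compact_imp_closed closedin_diff[of ?T S K] by auto
  moreover have "closed (X - ball 0 R)" using X by (intro closed_Diff) auto
  moreover have "X - K = (S - K) \<union> (X - ball 0 R)" using KR by (auto simp: S_def)
  ultimately have cl: "closed (X - K)" by auto
  show thesis
  proof (cases "X - K = {}")
    case True
    have "infdist z K \<noteq> 1" if "z \<in> X" for z using that True by auto
    then show ?thesis using that[OF compK, of 1] DK unfolding D_def by auto
  next
    case False
    have "K \<noteq> {}" using DK xD by auto
    then obtain k0 where k0: "k0 \<in> K" "\<And>k. k \<in> K \<Longrightarrow> infdist k0 (X - K) \<le> infdist k (X - K)"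
    proof -
      have "continuous_on K (\<lambda>k. infdist k (X - K))" by (intro continuous_intros)
      then show ?thesis using continuous_attains_inf[OF compK \<open>K \<noteq> {}\<close>] that by blast
    qed
    define e where "e = infdist k0 (X - K)"
    have e: "0 < e" unfolding e_def by (rule infdist_pos_not_in_closed[OF cl False]) (use k0 in auto)
    have "infdist z K \<noteq> min 1 (e / 2)" if z: "z \<in> X" for z
    proof (cases "z \<in> K")
      case True
      then show ?thesis using e by simp
    next
      case False
      have "e \<le> dist z k" if "k \<in> K" for k
        using k0(2)[OF that] infdist_le[of z "X - K" k] z False by (simp add: e_def dist_commute)
      then have "e \<le> infdist z K" using \<open>K \<noteq> {}\<close> unfolding infdist_notempty[OF \<open>K \<noteq> {}\<close>]
        by (intro cINF_greatest)
      then show ?thesis using e by (auto simp: min_def)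
    qed
    then show ?thesis using that[OF compK, of "min 1 (e / 2)"] DK e unfolding D_def by auto
  qed
qed

section \<open>Continuity of the passage to \<open>E\<close>\<close>

lemma norm_to_c1_diff_le:
  assumes "u 0 = 0" "continuous_on {0..1} w"
    "\<And>x. x \<in> {0..1} \<Longrightarrow> (u has_real_derivative w x) (at x within {0..1})"
    and "u' 0 = 0" "continuous_on {0..1} w'"
    "\<And>x. x \<in> {0..1} \<Longrightarrow> (u' has_real_derivative w' x) (at x within {0..1})"
    and le: "\<And>x. x \<in> {0..1} \<Longrightarrow> \<bar>u x - u' x\<bar> \<le> e" "\<And>x. x \<in> {0..1} \<Longrightarrow> \<bar>w x - w' x\<bar> \<le> e"
  shows "norm (to_c1 u - to_c1 u') \<le> 4 * e"
proof -
  have "norm (to_c1 u - to_c1 u') \<le> 2 * e + 2 * e"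
  proof (rule norm_c1_le)
    fix x :: real assume x: "x \<in> {0..1}"
    have 1: "\<bar>u 1 - u' 1\<bar> \<le> e" using le(1)[of 1] by simp
    have "\<bar>x * (u 1 - u' 1)\<bar> \<le> 1 * e"
      unfolding abs_mult by (rule mult_mono) (use x 1 in auto)
    moreover have "fn (to_c1 u - to_c1 u') x = (u x - u' x) - x * (u 1 - u' 1)"
      using to_c1(1)[OF assms(1-3) x] to_c1(1)[OF assms(4-6) x] by (simp add: fn_diff algebra_simps)
    ultimately show "\<bar>fn (to_c1 u - to_c1 u') x\<bar> \<le> 2 * e" using le(1)[OF x] by linarith
    have "dfn (to_c1 u - to_c1 u') x = (w x - w' x) - (u 1 - u' 1)"
      using to_c1(2)[OF assms(1-3) x] to_c1(2)[OF assms(4-6) x] x by (simp add: dfn_diff)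
    then show "\<bar>dfn (to_c1 u - to_c1 u') x\<bar> \<le> 2 * e" using le(2)[OF x] 1 by linarith
  qed
  then show ?thesis by simp
qed

lemma to_c1_continuous:
  fixes U W :: "'a::metric_space \<Rightarrow> real \<Rightarrow> real"
  assumes U: "continuous_on (P \<times> {0..1}) (\<lambda>(s, x). U s x)"
    and W: "continuous_on (P \<times> {0..1}) (\<lambda>(s, x). W s x)"
    and U0: "\<And>s. s \<in> P \<Longrightarrow> U s 0 = 0"
    and dU: "\<And>s x. s \<in> P \<Longrightarrow> x \<in> {0..1} \<Longrightarrow> (U s has_real_derivative W s x) (at x within {0..1})"
  shows "continuous_on P (\<lambda>s. to_c1 (U s))"
  unfolding continuous_on_def tendsto_iff
proof (intro ballI allI impI)
  fix s0 and e :: real assume s0: "s0 \<in> P" and e: "0 < e"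
  have e5: "0 < e / 5" using e by simp
  have cW: "continuous_on {0..1} (W s)" if "s \<in> P" for s
  proof -
    have "continuous_on {0..1} (\<lambda>x::real. (s, x))" by (intro continuous_intros)
    moreover have "(\<lambda>x. (s, x)) ` {0..1} \<subseteq> P \<times> {0..1}" using that by auto
    ultimately show ?thesis using continuous_on_compose2[OF W] by fastforce
  qed
  obtain A where A: "s0 \<in> A" "open A" "\<forall>s\<in>A \<inter> P. \<forall>t\<in>{0..1}. dist (U s t) (U s0 t) \<le> e / 5"
    using continuous_on_prod_compactE[OF U compact_Icc s0 e5] unfolding prod.case by metis
  obtain B where B: "s0 \<in> B" "open B" "\<forall>s\<in>B \<inter> P. \<forall>t\<in>{0..1}. dist (W s t) (W s0 t) \<le> e / 5"
    using continuous_on_prod_compactE[OF W compact_Icc s0 e5] unfolding prod.case by metis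
  have "\<forall>\<^sub>F s in at s0 within P. s \<in> A \<inter> B \<and> s \<in> P"
    unfolding eventually_at_topological using A(1,2) B(1,2) by (intro exI[of _ "A \<inter> B"]) auto
  then show "\<forall>\<^sub>F s in at s0 within P. dist (to_c1 (U s)) (to_c1 (U s0)) < e"
  proof eventually_elim
    case (elim s)
    then have "norm (to_c1 (U s) - to_c1 (U s0)) \<le> 4 * (e / 5)"
      using A(3) B(3) s0
      by (intro norm_to_c1_diff_le[where w = "W s" and w' = "W s0"] U0 cW dU) (auto simp: dist_real_def)
    then show ?case using e by (simp add: dist_norm)
  qed
qed

lemma to_c1_tendsto:
  fixes U W :: "nat \<Rightarrow> real \<Rightarrow> real"
  assumes U: "uniform_limit {0..1} U u sequentially" and W: "uniform_limit {0..1} W w sequentially"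
    and n: "\<And>n. U n 0 = 0" "\<And>n. continuous_on {0..1} (W n)"
      "\<And>n x. x \<in> {0..1} \<Longrightarrow> (U n has_real_derivative W n x) (at x within {0..1})"
    and l: "u 0 = 0" "continuous_on {0..1} w"
      "\<And>x. x \<in> {0..1} \<Longrightarrow> (u has_real_derivative w x) (at x within {0..1})"
  shows "(\<lambda>n. to_c1 (U n)) \<longlonglongrightarrow> to_c1 u"
  unfolding tendsto_iff
proof (intro allI impI)
  fix e :: real assume e: "0 < e"
  then have "0 < e / 5" by simp
  then have "\<forall>\<^sub>F n in sequentially. \<forall>x\<in>{0..1}. dist (U n x) (u x) < e / 5"
    "\<forall>\<^sub>F n in sequentially. \<forall>x\<in>{0..1}. dist (W n x) (w x) < e / 5"
    using U W unfolding uniform_limit_iff by blast+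
  then show "\<forall>\<^sub>F n in sequentially. dist (to_c1 (U n)) (to_c1 u) < e"
  proof eventually_elim
    case (elim k)
    then have "norm (to_c1 (U k) - to_c1 u) \<le> 4 * (e / 5)"
      by (intro norm_to_c1_diff_le[OF n(1,2,3) l]) (auto simp: dist_real_def less_imp_le)
    then show ?case using e by (simp add: dist_norm)
  qed
qed

section \<open>Solutions of the nonlinear problem\<close>

locale plap_problem = plap_weight p a for p a +
  fixes F f g :: "real \<Rightarrow> real \<Rightarrow> real \<Rightarrow> real" and M a0 :: real
  assumes a0: "a0 = (INF x\<in>{0..1}. a x)"
    and F_cont: "continuous_on ({0<..<1} \<times> UNIV \<times> UNIV) (\<lambda>(x, s, l). F x s l)"
    and F_eq: "\<And>x s l. x \<in> {0<..<1} \<Longrightarrow> F x s l = f x s l + g x s l"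
    and M: "0 < M"
    and f: "\<And>x s l. x \<in> {0<..<1} \<Longrightarrow> 0 < \<bar>s\<bar> \<Longrightarrow> \<bar>s\<bar> \<le> 1 \<Longrightarrow> \<bar>f x s l\<bar> \<le> M * \<bar>phi p s\<bar>"
    and g: "\<And>L \<epsilon>. bounded L \<Longrightarrow> 0 < \<epsilon> \<Longrightarrow>
       \<exists>\<delta>>0. \<forall>x\<in>{0<..<1}. \<forall>l\<in>L. \<forall>s. 0 < \<bar>s\<bar> \<and> \<bar>s\<bar> < \<delta> \<longrightarrow> \<bar>g x s l\<bar> \<le> \<epsilon> * \<bar>s\<bar> powr (p - 1)"
begin

lemma a0_pos: "0 < a0" and a_ge: "x \<in> {0..1} \<Longrightarrow> a0 \<le> a x"
  using a_bounds a0 by auto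

lemma F_small:
  assumes \<eta>: "0 < \<eta>"
  obtains \<sigma> where "0 < \<sigma>"
    "\<And>x l s. x \<in> {0<..<1} \<Longrightarrow> \<bar>l\<bar> \<le> \<Lambda> \<Longrightarrow> \<bar>s\<bar> \<le> \<sigma> \<Longrightarrow> \<bar>F x s l\<bar> \<le> (M + \<eta>) * \<bar>phi p s\<bar>"
proof -
  obtain \<delta> where \<delta>: "0 < \<delta>"
    "\<And>x l s. x \<in> {0<..<1} \<Longrightarrow> l \<in> {-\<Lambda>..\<Lambda>} \<Longrightarrow> 0 < \<bar>s\<bar> \<Longrightarrow> \<bar>s\<bar> < \<delta> \<Longrightarrow> \<bar>g x s l\<bar> \<le> \<eta> * \<bar>s\<bar> powr (p - 1)"
    using g[of "{-\<Lambda>..\<Lambda>}", OF bounded_closed_interval \<eta>] by blast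
  define \<sigma> where "\<sigma> = min 1 (\<delta> / 2)"
  have nonzero: "\<bar>F x s l\<bar> \<le> (M + \<eta>) * \<bar>phi p s\<bar>"
    if x: "x \<in> {0<..<1}" and l: "\<bar>l\<bar> \<le> \<Lambda>" and s: "\<bar>s\<bar> \<le> \<sigma>" "s \<noteq> 0" for x l s
  proof -
    have "\<bar>f x s l\<bar> \<le> M * \<bar>phi p s\<bar>" using s by (intro f x) (auto simp: \<sigma>_def)
    moreover have "\<bar>g x s l\<bar> \<le> \<eta> * \<bar>phi p s\<bar>"
      unfolding abs_phi using s l \<delta>(1) by (intro \<delta>(2) x) (auto simp: \<sigma>_def)
    ultimately show ?thesis unfolding F_eq[OF x] by (simp add: distrib_right)
  qed
  have zero: "F x 0 l = 0" if x: "x \<in> {0<..<1}" and l: "\<bar>l\<bar> \<le> \<Lambda>" for x l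
  proof -
    have "open ({0<..<1::real} \<times> (UNIV :: (real \<times> real) set))" by (intro open_Times) auto
    then have "isCont (\<lambda>(x, s, l). F x s l) (x, 0, l)"
      using F_cont x by (simp add: continuous_on_eq_continuous_at)
    moreover have "((\<lambda>s. (x, s, l)) \<longlongrightarrow> (x, 0, l)) (at 0)" by (intro tendsto_intros)
    ultimately have "((\<lambda>s. F x s l) \<longlongrightarrow> F x 0 l) (at 0)"
      using isCont_tendsto_compose[of "(x, 0, l)" "\<lambda>(x, s, l). F x s l" "\<lambda>s. (x, s, l)"] by simp
    then have 1: "((\<lambda>s. \<bar>F x s l\<bar>) \<longlongrightarrow> \<bar>F x 0 l\<bar>) (at 0)" by (rule tendsto_rabs)
    have 2: "((\<lambda>s. (M + \<eta>) * \<bar>phi p s\<bar>) \<longlongrightarrow> (M + \<eta>) * \<bar>phi p 0\<bar>) (at 0)"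
      by (intro tendsto_intros p)
    have "0 < \<sigma>" using \<delta>(1) by (simp add: \<sigma>_def)
    then have "\<forall>\<^sub>F s in at 0. \<bar>F x s l\<bar> \<le> (M + \<eta>) * \<bar>phi p s\<bar>"
      unfolding eventually_at using nonzero[OF x l] by (intro exI[of _ \<sigma>]) auto
    then have "\<bar>F x 0 l\<bar> \<le> (M + \<eta>) * \<bar>phi p 0\<bar>"
      by (rule tendsto_le[OF _ 2 1, rotated]) simp
    then show ?thesis by simp
  qed
  show thesis
  proof (rule that[of \<sigma>])
    show "0 < \<sigma>" using \<delta>(1) by (simp add: \<sigma>_def)
    show "\<bar>F x s l\<bar> \<le> (M + \<eta>) * \<bar>phi p s\<bar>" if "x \<in> {0<..<1}" "\<bar>l\<bar> \<le> \<Lambda>" "\<bar>s\<bar> \<le> \<sigma>" for x l s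
      using nonzero[OF that] zero[OF that(1,2)] by (cases "s = 0") auto
  qed
qed

lemma F_0: "x \<in> {0<..<1} \<Longrightarrow> F x 0 l = 0"
proof -
  assume x: "x \<in> {0<..<1}"
  obtain \<sigma> where "0 < \<sigma>" "\<And>x l' s. x \<in> {0<..<1} \<Longrightarrow> \<bar>l'\<bar> \<le> \<bar>l\<bar> \<Longrightarrow> \<bar>s\<bar> \<le> \<sigma> \<Longrightarrow> \<bar>F x s l'\<bar> \<le> (M + 1) * \<bar>phi p s\<bar>"
    using F_small[of 1 "\<bar>l\<bar>"] by auto
  from this(2)[OF x, of l 0] this(1) show ?thesis by simp
qed

definition rhs :: "real \<Rightarrow> real \<Rightarrow> real \<Rightarrow> real" where
  "rhs x s l = l * a x * phi p s + F x s l"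

text \<open>
  \<open>F(x,s,l)\<close> may blow up as \<open>x\<close> tends to \<open>0\<close> or \<open>1\<close> if \<open>s\<close> stays away from \<open>0\<close>. Elements of
  \<open>E\<close> of norm at most \<open>R\<close> lie below the tent \<open>R min(x, 1 - x)\<close>, so the values of \<open>s\<close> above it can
  be cut off. The cut-off never reaches below \<open>\<delta>\<close>: shooting trajectories that are uniformly small
  but violate the condition at \<open>1\<close> still solve the original equation.
\<close>

definition cap :: "real \<Rightarrow> real \<Rightarrow> real \<Rightarrow> real" where
  "cap R \<delta> x = max \<delta> (R * min x (1 - x))"

definition cut :: "real \<Rightarrow> real \<Rightarrow> real \<Rightarrow> real \<Rightarrow> real" where
  "cut R \<delta> x s = max (- cap R \<delta> x) (min (cap R \<delta> x) s)"

definition field :: "real \<Rightarrow> real \<Rightarrow> real \<Rightarrow> real \<Rightarrow> real \<Rightarrow> real" where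
  "field R \<delta> x s l = rhs x (cut R \<delta> x s) l"

lemma field_eq: "\<bar>s\<bar> \<le> cap R \<delta> x \<Longrightarrow> field R \<delta> x s l = rhs x s l"
  by (auto simp: field_def cut_def abs_le_iff)

lemma rhs_continuous: "continuous_on ({0<..<1} \<times> UNIV \<times> UNIV) (\<lambda>(x, s, l). rhs x s l)"
proof -
  have "continuous_on ({0<..<1} \<times> UNIV \<times> UNIV) (\<lambda>z :: real \<times> real \<times> real. a (fst z))"
    by (rule continuous_on_compose2[OF a_cont]) (auto intro!: continuous_intros)
  then show ?thesis using F_cont unfolding rhs_def case_prod_unfold
    by (intro continuous_intros p)
qed

lemma field_bounded:
  assumes R: "0 < R" and \<Lambda>: "0 \<le> \<Lambda>"
  obtains \<delta> C B where "0 < \<delta>" "bounded_field p (field R \<delta>) C B \<Lambda>"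
proof -
  obtain \<delta> where \<delta>: "0 < \<delta>"
    "\<And>x l s. x \<in> {0<..<1} \<Longrightarrow> \<bar>l\<bar> \<le> \<Lambda> \<Longrightarrow> \<bar>s\<bar> \<le> \<delta> \<Longrightarrow> \<bar>F x s l\<bar> \<le> (M + 1) * \<bar>phi p s\<bar>"
    using F_small[of 1 \<Lambda>] by auto
  obtain hi where hi: "\<And>x. x \<in> {0..1} \<Longrightarrow> a x \<le> hi" using a_bounds by blast
  have hi0: "0 \<le> hi" using hi[of 0] a_pos[of 0] by simp
  define x0 where "x0 = \<delta> / R"
  have x0: "0 < x0" using R \<delta> by (simp add: x0_def)
  let ?K = "{x0..1 - x0} \<times> {-R..R} \<times> {-\<Lambda>..\<Lambda>}"
  have "continuous_on ?K (\<lambda>(x, s, l). F x s l)"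
    by (rule continuous_on_subset[OF F_cont]) (use x0 in auto)
  then have "compact ((\<lambda>(x, s, l). F x s l) ` ?K)"
    by (intro compact_continuous_image compact_Times) auto
  then obtain B0 where B0: "0 < B0" "\<forall>y\<in>(\<lambda>(x, s, l). F x s l) ` ?K. norm y \<le> B0"
    using compact_imp_bounded bounded_pos by blast
  have FB: "\<bar>F x s l\<bar> \<le> B0" if "x \<in> {x0..1 - x0}" "\<bar>s\<bar> \<le> R" "\<bar>l\<bar> \<le> \<Lambda>" for x s l
  proof -
    have "(x, s, l) \<in> ?K" using that by (auto simp: abs_le_iff)
    then have "F x s l \<in> (\<lambda>(x, s, l). F x s l) ` ?K" by force
    then show ?thesis using B0(2) by auto
  qed
  define D where "D = (M + 1) + B0 / \<delta> powr (p - 1)"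
  define C where "C = \<Lambda> * hi + D"
  define B where "B = C * (max \<delta> R) powr (p - 1)"
  have D: "M + 1 \<le> D" "B0 / \<delta> powr (p - 1) \<le> D" using B0(1) M by (auto simp: D_def)
  then have C0: "0 \<le> C" using M \<Lambda> hi0 by (auto simp: C_def)
  have cut: "\<bar>cut R \<delta> x s\<bar> \<le> \<bar>s\<bar>" "\<bar>cut R \<delta> x s\<bar> \<le> cap R \<delta> x" for x s
  proof -
    have "0 < cap R \<delta> x" using \<delta>(1) by (simp add: cap_def less_max_iff_disj)
    then show "\<bar>cut R \<delta> x s\<bar> \<le> \<bar>s\<bar>" "\<bar>cut R \<delta> x s\<bar> \<le> cap R \<delta> x"
      by (auto simp: cut_def abs_if max_def min_def)
  qed
  have capR: "cap R \<delta> x \<le> max \<delta> R" if "x \<in> {0<..<1}" for x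
  proof -
    have "R * min x (1 - x) \<le> R * 1" using R that by (intro mult_left_mono) auto
    then show ?thesis by (auto simp: cap_def)
  qed
  have Fcut: "\<bar>F x (cut R \<delta> x s) l\<bar> \<le> D * \<bar>phi p (cut R \<delta> x s)\<bar>"
    if x: "x \<in> {0<..<1}" and l: "\<bar>l\<bar> \<le> \<Lambda>" for x s l
  proof (cases "\<bar>cut R \<delta> x s\<bar> \<le> \<delta>")
    case True
    show ?thesis using \<delta>(2)[OF x l True] D(1) by (meson abs_ge_zero mult_right_mono order_trans)
  next
    case False
    let ?c = "cut R \<delta> x s"
    have "\<delta> < R * min x (1 - x)" using False cut(2)[of x s] by (auto simp: cap_def)
    then have "x0 < min x (1 - x)"
      unfolding x0_def using R by (simp only: divide_less_eq mult.commute if_True)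
    moreover have "\<bar>?c\<bar> \<le> R"
    proof -
      have "cap R \<delta> x = R * min x (1 - x)" using \<open>\<delta> < R * min x (1 - x)\<close> by (simp add: cap_def)
      also have "\<dots> \<le> R * 1" using R x by (intro mult_left_mono) auto
      finally show ?thesis using cut(2)[of x s] by simp
    qed
    ultimately have "\<bar>F x ?c l\<bar> \<le> B0" using l by (intro FB) auto
    also have "\<dots> = B0 / \<delta> powr (p - 1) * \<delta> powr (p - 1)" using \<delta>(1) by simp
    also have "\<dots> \<le> D * \<bar>?c\<bar> powr (p - 1)"
      using False \<delta>(1) p B0(1) D M by (intro mult_mono powr_mono2) auto
    finally show ?thesis by (simp add: abs_phi)
  qed
  have "bounded_field p (field R \<delta>) C B \<Lambda>"
  proof
    have "continuous_on ({0<..<1} \<times> UNIV \<times> UNIV)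
        (\<lambda>z. (fst z, cut R \<delta> (fst z) (fst (snd z)), snd (snd z)))"
      unfolding cut_def cap_def by (intro continuous_intros)
    moreover have "(\<lambda>z. (fst z, cut R \<delta> (fst z) (fst (snd z)), snd (snd z))) ` ({0<..<1} \<times> UNIV \<times> UNIV)
        \<subseteq> {0<..<1} \<times> UNIV \<times> UNIV" by auto
    ultimately show "continuous_on ({0<..<1} \<times> UNIV \<times> UNIV) (\<lambda>(x, s, l). field R \<delta> x s l)"
      using continuous_on_compose2[OF rhs_continuous] unfolding field_def case_prod_unfold by fastforce
    fix x s l :: real assume x: "x \<in> {0<..<1}" and l: "\<bar>l\<bar> \<le> \<Lambda>"
    let ?c = "cut R \<delta> x s"
    have "\<bar>l * a x\<bar> \<le> \<Lambda> * hi"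
      unfolding abs_mult using l x hi[of x] a_pos[of x] \<Lambda> by (intro mult_mono) auto
    then have "\<bar>l * a x * phi p ?c\<bar> \<le> (\<Lambda> * hi) * \<bar>phi p ?c\<bar>"
      unfolding abs_mult[of "l * a x"] by (rule mult_right_mono) simp
    then have *: "\<bar>field R \<delta> x s l\<bar> \<le> C * \<bar>phi p ?c\<bar>"
      using Fcut[OF x l, of s] unfolding field_def rhs_def C_def distrib_right by linarith
    have "\<bar>phi p ?c\<bar> \<le> \<bar>phi p s\<bar>"
      unfolding abs_phi using cut[of x s] p by (intro powr_mono2) auto
    then show "\<bar>field R \<delta> x s l\<bar> \<le> C * \<bar>phi p s\<bar>"
      using * C0 by (meson mult_left_mono order_trans)
    have "\<bar>phi p ?c\<bar> \<le> (max \<delta> R) powr (p - 1)"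
      unfolding abs_phi using cut(2)[of x s] capR[OF x] p by (intro powr_mono2) auto
    then show "\<bar>field R \<delta> x s l\<bar> \<le> B"
      using * C0 unfolding B_def by (meson mult_left_mono order_trans)
  qed (use p C0 in auto)
  then show thesis using that \<delta>(1) by blast
qed

lemma plap_solution_iff_rhs:
  "plap_solution p a F l e \<longleftrightarrow> trajectory p rhs l (fn e) (\<lambda>x. phi p (dfn e x))"
  using plap_solution_iff_trajectory[OF p, of a F l e] unfolding rhs_def [abs_def] .

lemma fn_below_cap:
  assumes "norm e \<le> R" "x \<in> {0<..<1}" shows "\<bar>fn e x\<bar> \<le> cap R \<delta> x"
proof -
  have "\<bar>fn e x\<bar> \<le> norm e * min x (1 - x)" using assms(2) by (intro fn_tent_bound) auto
  also have "\<dots> \<le> R * min x (1 - x)" using assms by (intro mult_right_mono) auto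
  finally show ?thesis by (simp add: cap_def)
qed

lemma plap_solution_iff_field:
  assumes "norm e \<le> R"
  shows "plap_solution p a F l e \<longleftrightarrow> trajectory p (field R \<delta>) l (fn e) (\<lambda>x. phi p (dfn e x))"
  unfolding plap_solution_iff_rhs
  using field_eq[OF fn_below_cap[OF assms]] by (auto elim!: trajectory_cong)

lemma zero_solution: "plap_solution p a F l 0"
proof -
  have "trajectory p rhs l (\<lambda>_. 0) (\<lambda>_. 0)"
    by (auto simp: trajectory_def rhs_def F_0 intro!: derivative_eq_intros)
  then show ?thesis unfolding plap_solution_iff_rhs
    by (rule trajectory_cong_values) (auto simp: zero_c1_zero.rep_eq dfn_0)
qed

lemma to_c1_fn: "to_c1 (fn e) = e"
  using to_c1(1)[of "fn e" "dfn e"] fn_has_derivative continuous_on_dfn by (intro fn_eqI) auto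

text \<open>
  Bounded solutions also solve the truncated equation, whose field is bounded, so their momenta are
  equi-Lipschitz. The limit obeys the same norm bound, and there the truncation has no effect.
\<close>

lemma solutions_compact:
  assumes sol: "\<And>n. plap_solution p a F (L n) (E n)"
    and L: "\<And>n. \<bar>L n\<bar> \<le> \<Lambda>" and E: "\<And>n. norm (E n) \<le> R"
  obtains r l e where "strict_mono (r :: nat \<Rightarrow> nat)" "(\<lambda>n. L (r n)) \<longlonglongrightarrow> l" "(\<lambda>n. E (r n)) \<longlonglongrightarrow> e"
    "plap_solution p a F l e"
proof -
  have \<Lambda>: "0 \<le> \<Lambda>" using L[of 0] by simp
  define R' where "R' = max R 1"
  have R': "0 < R'" "\<And>n. norm (E n) \<le> R'" using E by (auto simp: R'_def le_max_iff_disj)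
  obtain \<delta> C B where "0 < \<delta>" and bf: "bounded_field p (field R' \<delta>) C B \<Lambda>"
    by (rule field_bounded[OF R'(1) \<Lambda>])
  interpret bf: bounded_field p "field R' \<delta>" C B \<Lambda> by (rule bf)
  have "L n \<in> {-\<Lambda>..\<Lambda>}" for n using L[of n] by (auto simp: abs_le_iff)
  then obtain l r0 where r0: "l \<in> {-\<Lambda>..\<Lambda>}" "strict_mono r0" "(L \<circ> r0) \<longlonglongrightarrow> l"
    using compact_Icc[of "-\<Lambda>" \<Lambda>] unfolding compact_def by metis
  define U where "U n = fn (E (r0 n))" for n
  define V where "V n x = phi p (dfn (E (r0 n)) x)" for n x
  have tr: "trajectory p (field R' \<delta>) (L (r0 n)) (U n) (V n)" for n
    unfolding U_def V_def [abs_def] using sol plap_solution_iff_field[OF R'(2)] by blast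
  have cV: "continuous_on {0..1} (V n)" for n using tr[of n] by (simp add: trajectory_def)
  have dV: "(V n has_real_derivative - field R' \<delta> x (U n x) (L (r0 n))) (at x)" if "x \<in> {0<..<1}" for n x
    using tr[of n] that by (simp add: trajectory_def)
  have dU: "(U n has_real_derivative phi (conj_exp p) (V n x)) (at x within {0..1})" if "x \<in> {0..1}" for n x
    using tr[of n] that by (simp add: trajectory_def)
  obtain r1 u v where r1: "strict_mono (r1 :: nat \<Rightarrow> nat)"
    "uniform_limit {0..1} (\<lambda>i. U (r1 i)) u sequentially"
    "uniform_limit {0..1} (\<lambda>i. V (r1 i)) v sequentially"
    "uniform_limit {0..1} (\<lambda>i x. phi (conj_exp p) (V (r1 i) x)) (\<lambda>x. phi (conj_exp p) (v x)) sequentially"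
    "continuous_on {0..1} v" "u 0 = 0"
    "\<And>x. x \<in> {0..1} \<Longrightarrow> (u has_real_derivative phi (conj_exp p) (v x)) (at x within {0..1})"
  proof (rule phase_curves_compact[where U = U and V = V, OF p dU _ cV dV])
    show "U n 0 = 0" for n by (simp add: U_def)
    show "\<bar>field R' \<delta> x (U n x) (L (r0 n))\<bar> \<le> B" if "x \<in> {0<..<1}" for n x
      by (rule bf.h_bdd[OF that L])
    show "\<bar>V n 0\<bar> \<le> R' powr (p - 1)" for n
      unfolding V_def abs_phi using norm_c1_upper[of 0 0 "E (r0 n)"] R'(2)[of "r0 n"] p
      by (intro powr_mono2) auto
  qed (assumption, assumption, rule that)
  have cu: "continuous_on {0..1} u"
    using r1(7) DERIV_continuous continuous_on_eq_continuous_within by blast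
  have Ll: "(\<lambda>n. L (r0 (r1 n))) \<longlonglongrightarrow> l"
    using LIMSEQ_subseq_LIMSEQ[OF r0(3) r1(1)] by (simp add: comp_def)
  have dv: "(v has_real_derivative - field R' \<delta> x (u x) l) (at x)" if x: "x \<in> {0<..<1}" for x
  proof (rule limit_equation[where V = "\<lambda>n. V (r1 n)" and kl = "\<lambda>x. field R' \<delta> x (u x) l", OF cV dV _ _ _ x])
    show "(\<lambda>n. V (r1 n) x) \<longlonglongrightarrow> v x" if "x \<in> {0..1}" for x
      using tendsto_uniform_limitI[OF r1(3) that] .
    show "continuous_on {0<..<1} (\<lambda>x. field R' \<delta> x (u x) l)"
      by (intro bf.continuous_on_h continuous_on_subset[OF cu] continuous_intros) auto
    fix r :: "nat \<Rightarrow> nat" and \<xi> :: "nat \<Rightarrow> real" and x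
    assume r: "strict_mono r" and x: "x \<in> {0<..<1}" and \<xi>: "\<xi> \<longlonglongrightarrow> x"
    have "\<forall>\<^sub>F i in sequentially. \<xi> i \<in> {0<..<1}"
      by (rule topological_tendstoD[OF \<xi>]) (use x in auto)
    then have ev: "\<forall>\<^sub>F i in sequentially. \<xi> i \<in> {0..1}" by eventually_elim auto
    have "uniform_limit {0..1} (\<lambda>i. U (r1 (r i))) u sequentially"
      by (rule filterlim_compose[OF r1(2) filterlim_subseq[OF r]])
    then have "(\<lambda>i. U (r1 (r i)) (\<xi> i)) \<longlonglongrightarrow> u x"
      by (rule uniform_limit_diagonal[OF _ cu _ \<xi> ev]) (use x in auto)
    moreover have "(\<lambda>i. L (r0 (r1 (r i)))) \<longlonglongrightarrow> l"
      using LIMSEQ_subseq_LIMSEQ[OF Ll r] by (simp add: comp_def)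
    ultimately show "(\<lambda>i. field R' \<delta> (\<xi> i) (U (r1 (r i)) (\<xi> i)) (L (r0 (r1 (r i))))) \<longlonglongrightarrow> field R' \<delta> x (u x) l"
      by (intro bf.tendsto_h x \<xi>)
  qed
  have tr_lim: "trajectory p (field R' \<delta>) l u v" using r1 dv unfolding trajectory_def by auto
  have "(\<lambda>n. U (r1 n) 1) \<longlonglongrightarrow> u 1" using tendsto_uniform_limitI[OF r1(2), of 1] by simp
  then have u1: "u 1 = 0" by (simp add: U_def LIMSEQ_const_iff)
  have "(\<lambda>n. to_c1 (U (r1 n))) \<longlonglongrightarrow> to_c1 u"
  proof (rule to_c1_tendsto[OF r1(2,4) _ _ _ r1(6) _ r1(7)])
    show "continuous_on {0..1} (\<lambda>x. phi (conj_exp p) (V (r1 n) x))" for n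
      by (intro continuous_intros conj_exp_gt_1 p cV)
    show "continuous_on {0..1} (\<lambda>x. phi (conj_exp p) (v x))"
      by (intro continuous_intros conj_exp_gt_1 p r1(5))
  qed (use dU in \<open>auto simp: U_def\<close>)
  then have El: "(\<lambda>n. E (r0 (r1 n))) \<longlonglongrightarrow> to_c1 u" by (simp add: U_def to_c1_fn)
  have "norm (to_c1 u) \<le> R'"
    using R'(2) by (intro LIMSEQ_le_const2[OF tendsto_norm[OF El]]) auto
  have "trajectory p (field R' \<delta>) l (fn (to_c1 u)) (\<lambda>x. phi p (dfn (to_c1 u) x))"
    by (rule trajectory_cong_values[OF tr_lim]) (use trajectory_to_c1[OF p tr_lim u1] in auto)
  then have "plap_solution p a F l (to_c1 u)"
    using plap_solution_iff_field[OF \<open>norm (to_c1 u) \<le> R'\<close>] by blast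
  moreover have "strict_mono (r0 \<circ> r1)" using r0(2) r1(1) by (rule strict_mono_o)
  ultimately show thesis using that[of "r0 \<circ> r1" l "to_c1 u"] Ll El by simp
qed

text \<open>
  A limit of functions in \<open>S\<^sub>k\<^sup>+\<close> can leave \<open>S\<^sub>k\<^sup>+\<close> only through a degenerate zero, and nontrivial
  solutions have none. In terms of the angle: it converges, and its value at \<open>1\<close> is always \<open>k\<pi>\<close>.
\<close>

lemma S_plus_limit:
  assumes sol: "\<And>n. plap_solution p a F (L n) (E n)" and S: "\<And>n. E n \<in> S_plus k" and k: "1 \<le> k"
    and L: "L \<longlonglongrightarrow> l" and E: "E \<longlonglongrightarrow> e" and sol_lim: "plap_solution p a F l e" and e: "e \<noteq> 0"
  shows "e \<in> S_plus k"
proof -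
  obtain b where b: "\<And>n. norm (E n) \<le> b"
    using convergent_imp_bounded[OF E] unfolding bounded_iff by auto
  obtain c where c: "\<And>n. norm (L n) \<le> c"
    using convergent_imp_bounded[OF L] unfolding bounded_iff by auto
  define R where "R = max 1 (max b (norm e))"
  define \<Lambda> where "\<Lambda> = max c \<bar>l\<bar>"
  have R: "0 < R" "\<And>n. norm (E n) \<le> R" "norm e \<le> R" using b by (auto simp: R_def le_max_iff_disj)
  have \<Lambda>: "0 \<le> \<Lambda>" "\<And>n. \<bar>L n\<bar> \<le> \<Lambda>" "\<bar>l\<bar> \<le> \<Lambda>"
    using c c[of 0] by (auto simp: \<Lambda>_def le_max_iff_disj intro: order_trans[OF abs_ge_zero])
  obtain \<delta> C B where "0 < \<delta>" and bf: "bounded_field p (field R \<delta>) C B \<Lambda>"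
    by (rule field_bounded[OF R(1) \<Lambda>(1)])
  interpret bf: bounded_field p "field R \<delta>" C B \<Lambda> by (rule bf)
  have tr: "trajectory p (field R \<delta>) (L n) (fn (E n)) (\<lambda>x. phi p (dfn (E n) x))" for n
    using sol plap_solution_iff_field[OF R(2)] by blast
  have tr_lim: "trajectory p (field R \<delta>) l (fn e) (\<lambda>x. phi p (dfn e x))"
    using sol_lim plap_solution_iff_field[OF R(3)] by blast
  have "\<exists>\<theta>. polar (fn (E n)) (\<lambda>x. phi p (dfn (E n) x)) \<theta> \<and> \<theta> 1 = of_nat k * pi" for n
    using angle_of_S_plus[OF p bf.trajectory_half_linear[OF tr \<Lambda>(2)] bf.coef_bound[OF \<Lambda>(2)] S k] by metis
  then obtain \<Theta> where \<Theta>: "\<And>n. polar (fn (E n)) (\<lambda>x. phi p (dfn (E n) x)) (\<Theta> n)"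
    "\<And>n. \<Theta> n 1 = of_nat k * pi" by metis
  have dist: "\<bar>fn (E n) x - fn e x\<bar> \<le> norm (E n - e)" "\<bar>dfn (E n) x - dfn e x\<bar> \<le> norm (E n - e)"
    if "x \<in> {0..1}" for n x
    using norm_c1_upper[OF that that, of "E n - e"] that by (auto simp: fn_diff dfn_diff)
  have small: "\<forall>\<^sub>F n in sequentially. norm (E n - e) < \<epsilon>" if "0 < \<epsilon>" for \<epsilon>
    using tendstoD[OF E that] by (simp add: dist_norm)
  have U: "uniform_limit {0..1} (\<lambda>n. fn (E n)) (fn e) sequentially"
    unfolding uniform_limit_iff dist_real_def
    by (intro allI impI eventually_mono[OF small]) (use dist(1) le_less_trans in blast)+
  have W: "uniform_limit {0..1} (\<lambda>n. dfn (E n)) (dfn e) sequentially"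
    unfolding uniform_limit_iff dist_real_def
    by (intro allI impI eventually_mono[OF small]) (use dist(2) le_less_trans in blast)+
  have V: "uniform_limit {0..1} (\<lambda>n x. phi p (dfn (E n) x)) (\<lambda>x. phi p (dfn e x)) sequentially"
  proof (rule uniform_limit_phi[OF p W])
    show "\<bar>dfn (E n) x\<bar> \<le> R" if "x \<in> {0..1}" for n x
      using norm_c1_upper[OF that that, of "E n"] R(2)[of n] by linarith
    show "\<bar>dfn e x\<bar> \<le> R" if "x \<in> {0..1}" for x
      using norm_c1_upper[OF that that, of e] R(3) by linarith
  qed
  obtain y where y: "y \<in> {0..1}" "fn e y \<noteq> 0"
    using e fn_eqI[of e 0] by (auto simp: zero_c1_zero.rep_eq)
  have "phi p (dfn e 0) \<noteq> 0"
    using bf.trajectory_nonvanishing[OF tr_lim \<Lambda>(3) y(1), of 0] y(2) by auto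
  moreover have "0 \<le> phi p (dfn e 0)"
  proof (rule LIMSEQ_le_const)
    show "(\<lambda>n. phi p (dfn (E n) 0)) \<longlonglongrightarrow> phi p (dfn e 0)"
      using tendsto_uniform_limitI[OF V, of 0] by simp
    have "0 \<le> phi p (dfn (E n) 0)" for n
      using polarE[OF \<Theta>(1)[of n], of 0] polar_at_0[OF \<Theta>(1)[of n]]
      by (metis atLeastAtMost_iff cos_zero less_imp_le mult.right_neutral order_refl zero_le_one)
    then show "\<exists>N. \<forall>n\<ge>N. 0 \<le> phi p (dfn (E n) 0)" by blast
  qed
  ultimately have "0 < phi p (dfn e 0)" by linarith
  then obtain \<theta> where \<theta>: "polar (fn e) (\<lambda>x. phi p (dfn e x)) \<theta>"
    by (rule bf.trajectory_polar[OF tr_lim \<Lambda>(3)])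
  have "(\<lambda>n. \<Theta> n 1) \<longlonglongrightarrow> \<theta> 1"
    by (rule polar_limit[OF bf.trajectory_continuous[OF tr_lim \<Lambda>(3)] \<theta> \<Theta>(1) U V])
  then have "\<theta> 1 = of_nat k * pi" by (simp add: \<Theta>(2) LIMSEQ_const_iff)
  then show ?thesis by (rule S_plus_of_angle[OF bf.trajectory_half_linear[OF tr_lim \<Lambda>(3)] \<theta>])
qed

text \<open>
  For small solutions the coefficient \<open>l a + F/\<phi>\<^sub>p(u)\<close> differs from \<open>l a\<close> by little more than
  \<open>M \<le> d a\<close>. If \<open>l\<close> is outside \<open>I\<^sub>k\<close> it therefore lies strictly on one side of \<open>\<lambda>\<^sub>k a\<close>, and Sturm
  comparison with the eigenfunction decides on which side of \<open>k\<pi>\<close> the angle is.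
\<close>

lemma small_angle:
  assumes k: "1 \<le> k" and \<eta>: "0 < \<eta>"
  obtains \<sigma> where "0 < \<sigma>"
    "\<And>l u v \<theta>. \<bar>l\<bar> \<le> \<Lambda> \<Longrightarrow> trajectory p rhs l u v \<Longrightarrow> polar u v \<theta> \<Longrightarrow> (\<forall>x\<in>{0..1}. \<bar>u x\<bar> \<le> \<sigma>) \<Longrightarrow>
       (plap_eig p a k + M / a0 + \<eta> < l \<longrightarrow> of_nat k * pi < \<theta> 1) \<and>
       (l < plap_eig p a k - M / a0 - \<eta> \<longrightarrow> \<theta> 1 < of_nat k * pi)"
proof -
  let ?\<mu> = "plap_eig p a k"
  obtain w z \<omega> where w: "half_linear p (\<lambda>x. ?\<mu> * a x) w z" "polar w z \<omega>" "\<omega> 1 = of_nat k * pi"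
    using eigen_class_plap_eig[OF k] unfolding eigen_class_def by blast
  have "0 < \<eta> * a0" using \<eta> a0_pos by simp
  then obtain \<sigma> where \<sigma>: "0 < \<sigma>" "\<And>x l s. x \<in> {0<..<1} \<Longrightarrow> \<bar>l\<bar> \<le> \<Lambda> \<Longrightarrow> \<bar>s\<bar> \<le> \<sigma> \<Longrightarrow>
      \<bar>F x s l\<bar> \<le> (M + \<eta> * a0) * \<bar>phi p s\<bar>"
    using F_small[of "\<eta> * a0" \<Lambda>] by metis
  show thesis
  proof (rule that[OF \<sigma>(1)])
    fix l u v \<theta>
    assume l: "\<bar>l\<bar> \<le> \<Lambda>" and tr: "trajectory p rhs l u v" and pol: "polar u v \<theta>"
      and small: "\<forall>x\<in>{0..1}. \<bar>u x\<bar> \<le> \<sigma>"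
    define q where "q x = l * a x + F x (u x) l / phi p (u x)" for x
    have hl: "half_linear p q u v"
    proof -
      have "rhs x (u x) l = q x * phi p (u x)" if "x \<in> {0<..<1}" for x
        using F_0[OF that] by (cases "u x = 0") (auto simp: rhs_def q_def distrib_right)
      then show ?thesis using tr unfolding trajectory_def half_linear_def by auto
    qed
    have q: "\<bar>q x - l * a x\<bar> \<le> M + \<eta> * a0" if "x \<in> {0<..<1}" for x
      using \<sigma>(2)[OF that l, of "u x"] small that \<open>0 < \<eta> * a0\<close> M
      by (cases "u x = 0") (auto simp: q_def abs_divide divide_le_eq)
    have gap: "M + \<eta> * a0 \<le> (M / a0 + \<eta>) * a x" if "x \<in> {0<..<1}" for x
    proof -
      have "(M / a0 + \<eta>) * a0 \<le> (M / a0 + \<eta>) * a x"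
        using that a_ge[of x] M a0_pos \<eta> by (intro mult_left_mono) auto
      then show ?thesis using a0_pos by (simp add: distrib_right)
    qed
    show "(?\<mu> + M / a0 + \<eta> < l \<longrightarrow> of_nat k * pi < \<theta> 1) \<and> (l < ?\<mu> - M / a0 - \<eta> \<longrightarrow> \<theta> 1 < of_nat k * pi)"
    proof (intro conjI impI)
      assume l: "?\<mu> + M / a0 + \<eta> < l"
      have "?\<mu> * a x < q x" if x: "x \<in> {0<..<1}" for x
      proof -
        have "(M / a0 + \<eta>) * a x < (l - ?\<mu>) * a x"
          using l a_pos[of x] x by (intro mult_strict_right_mono) auto
        then have "M + \<eta> * a0 < l * a x - ?\<mu> * a x" using gap[OF x] by (simp add: left_diff_distrib)
        then show ?thesis using q[OF x] by linarith
      qed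
      then show "of_nat k * pi < \<theta> 1"
        by (intro sturm_angle_strict[OF p w(1,2) hl pol]) (use w(3) in auto)
    next
      assume l: "l < ?\<mu> - M / a0 - \<eta>"
      have less: "q x < ?\<mu> * a x" if x: "x \<in> {0<..<1}" for x
      proof -
        have "(M / a0 + \<eta>) * a x < (?\<mu> - l) * a x"
          using l a_pos[of x] x by (intro mult_strict_right_mono) auto
        then have "M + \<eta> * a0 < ?\<mu> * a x - l * a x" using gap[OF x] by (simp add: left_diff_distrib)
        then show ?thesis using q[OF x] by linarith
      qed
      show "\<theta> 1 < of_nat k * pi"
      proof (rule ccontr)
        assume "\<not> ?thesis"
        then have "of_nat k * pi < \<omega> 1"
          by (intro sturm_angle_strict[OF p hl pol w(1,2)]) (use less in auto)
        then show False using w(3) by simp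
      qed
    qed
  qed
qed

section \<open>The set of nodal solutions and the bifurcation interval\<close>

lemma solution_setD:
  assumes "(l, e) \<in> solution_set p a F"
  shows "plap_solution p a F l e"
proof -
  obtain z where z: "\<And>n. z n \<in> {(l, u). u \<noteq> 0 \<and> plap_solution p a F l u}" "z \<longlonglongrightarrow> (l, e)"
    using assms unfolding solution_set_def closure_sequential by auto
  define L where "L n = fst (z n)" for n
  define E where "E n = snd (z n)" for n
  have sol: "plap_solution p a F (L n) (E n)" for n using z(1)[of n] by (auto simp: L_def E_def)
  have L: "L \<longlonglongrightarrow> l" and E: "E \<longlonglongrightarrow> e"
    using tendsto_fst[OF z(2)] tendsto_snd[OF z(2)] by (auto simp: L_def [abs_def] E_def [abs_def])
  obtain b c where "\<And>n. norm (E n) \<le> b" "\<And>n. \<bar>L n\<bar> \<le> c"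
    using convergent_imp_bounded[OF E] convergent_imp_bounded[OF L] unfolding bounded_iff by auto
  then obtain r l' e' where r: "strict_mono (r :: nat \<Rightarrow> nat)" "(\<lambda>n. L (r n)) \<longlonglongrightarrow> l'" "(\<lambda>n. E (r n)) \<longlonglongrightarrow> e'"
    "plap_solution p a F l' e'"
    using solutions_compact[of L E c b] sol by blast
  have "l' = l" "e' = e"
    using LIMSEQ_unique[OF r(2)] LIMSEQ_unique[OF r(3)] LIMSEQ_subseq_LIMSEQ[OF L r(1)]
      LIMSEQ_subseq_LIMSEQ[OF E r(1)] by (auto simp: comp_def)
  then show ?thesis using r(4) by simp
qed

lemma zero_not_in_S_plus: "0 \<notin> S_plus k"
  by (auto simp: S_plus_def zero_c1_zero.rep_eq dfn_0)

lemma nodal_solution_iff: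
  "(l, e) \<in> nodal_solution_set p a F (S_plus k) \<longleftrightarrow> plap_solution p a F l e \<and> e \<in> S_plus k"
proof
  assume *: "plap_solution p a F l e \<and> e \<in> S_plus k"
  then have "e \<noteq> 0" using zero_not_in_S_plus by metis
  then have "(l, e) \<in> {(l, u). u \<noteq> 0 \<and> plap_solution p a F l u}" using * by simp
  then show "(l, e) \<in> nodal_solution_set p a F (S_plus k)"
    using * closure_subset[of "{(l, u). u \<noteq> 0 \<and> plap_solution p a F l u}"]
    unfolding nodal_solution_set_def solution_set_def by auto
qed (use solution_setD in \<open>auto simp: nodal_solution_set_def\<close>)

definition branch :: "nat \<Rightarrow> (real \<times> c1_zero) set" where
  "branch k = nodal_solution_set p a F (S_plus k) \<union>
     {plap_eig p a k - M / a0 .. plap_eig p a k + M / a0} \<times> {0}"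

lemma branch_iff:
  "(l, e) \<in> branch k \<longleftrightarrow> plap_solution p a F l e \<and> e \<in> S_plus k \<or>
     e = 0 \<and> \<bar>l - plap_eig p a k\<bar> \<le> M / a0"
  unfolding branch_def using nodal_solution_iff by (auto simp: abs_le_iff)

lemma branch_solution: "(l, e) \<in> branch k \<Longrightarrow> plap_solution p a F l e"
  unfolding branch_iff using zero_solution by auto

text \<open>
  Small solutions with \<open>l\<close> outside \<open>I\<^sub>k\<close> are not in \<open>S\<^sub>k\<^sup>+\<close>, so limits of nodal solutions on the
  trivial line stay in \<open>I\<^sub>k \<times> {0}\<close>.
\<close>

lemma branch_closed:
  assumes k: "1 \<le> k"
  shows "closed (branch k)"
  unfolding closed_sequential_limits
proof (intro allI impI)
  fix z le assume *: "(\<forall>n. z n \<in> branch k) \<and> z \<longlonglongrightarrow> le"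
  obtain l e where le: "le = (l, e)" by (cases le)
  define L where "L n = fst (z n)" for n
  define E where "E n = snd (z n)" for n
  have br: "(L n, E n) \<in> branch k" for n using * by (simp add: L_def E_def)
  then have sol: "plap_solution p a F (L n) (E n)" for n by (rule branch_solution)
  have L: "L \<longlonglongrightarrow> l" and E: "E \<longlonglongrightarrow> e"
    using * tendsto_fst[of z le] tendsto_snd[of z le] by (auto simp: L_def [abs_def] E_def [abs_def] le)
  obtain b c where bc: "\<And>n. norm (E n) \<le> b" "\<And>n. \<bar>L n\<bar> \<le> c"
    using convergent_imp_bounded[OF E] convergent_imp_bounded[OF L] unfolding bounded_iff by auto
  have "(l, e) \<in> branch k"
  proof (cases "e = 0")
    case False
    obtain r l' e' where r: "strict_mono (r :: nat \<Rightarrow> nat)" "(\<lambda>n. L (r n)) \<longlonglongrightarrow> l'" "(\<lambda>n. E (r n)) \<longlonglongrightarrow> e'"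
      "plap_solution p a F l' e'"
      using solutions_compact[of L E c b] sol bc by blast
    have "l' = l" "e' = e"
      using LIMSEQ_unique[OF r(2)] LIMSEQ_unique[OF r(3)] LIMSEQ_subseq_LIMSEQ[OF L r(1)]
        LIMSEQ_subseq_LIMSEQ[OF E r(1)] by (auto simp: comp_def)
    then have sol_lim: "plap_solution p a F l e" using r(4) by simp
    have "\<forall>\<^sub>F n in sequentially. E n \<noteq> 0" by (rule tendsto_imp_eventually_ne[OF E False])
    then obtain N where N: "\<And>n. N \<le> n \<Longrightarrow> E n \<noteq> 0" unfolding eventually_sequentially by blast
    have "E (n + N) \<in> S_plus k" for n using br[of "n + N"] N[of "n + N"] by (simp add: branch_iff)
    then have "e \<in> S_plus k"
      by (rule S_plus_limit[OF sol _ k LIMSEQ_ignore_initial_segment[OF L]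
            LIMSEQ_ignore_initial_segment[OF E] sol_lim False])
    then show ?thesis using sol_lim by (simp add: branch_iff)
  next
    case True
    show ?thesis
    proof (rule ccontr)
      assume "\<not> ?thesis"
      then have out: "M / a0 < \<bar>l - plap_eig p a k\<bar>" using True by (simp add: branch_iff)
      define \<eta> where "\<eta> = (\<bar>l - plap_eig p a k\<bar> - M / a0) / 2"
      have \<eta>: "0 < \<eta>" "M / a0 + \<eta> < \<bar>l - plap_eig p a k\<bar>" using out by (auto simp: \<eta>_def field_simps)
      obtain \<sigma> where \<sigma>: "0 < \<sigma>"
        "\<And>l u v \<theta>. \<bar>l\<bar> \<le> c \<Longrightarrow> trajectory p rhs l u v \<Longrightarrow> polar u v \<theta> \<Longrightarrow> (\<forall>x\<in>{0..1}. \<bar>u x\<bar> \<le> \<sigma>) \<Longrightarrow>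
           (plap_eig p a k + M / a0 + \<eta> < l \<longrightarrow> of_nat k * pi < \<theta> 1) \<and>
           (l < plap_eig p a k - M / a0 - \<eta> \<longrightarrow> \<theta> 1 < of_nat k * pi)"
        by (rule small_angle[OF k \<eta>(1)]) blast
      have "\<forall>\<^sub>F n in sequentially. M / a0 + \<eta> < \<bar>L n - plap_eig p a k\<bar>"
        using \<eta>(2) by (intro order_tendstoD(1)[where y = "\<bar>l - plap_eig p a k\<bar>"] tendsto_intros L)
      moreover have "\<forall>\<^sub>F n in sequentially. norm (E n) < \<sigma>"
        using tendstoD[OF E \<sigma>(1)] True by simp
      ultimately obtain n where n: "M / a0 + \<eta> < \<bar>L n - plap_eig p a k\<bar>" "norm (E n) < \<sigma>"
        using eventually_happens'[OF sequentially_bot eventually_conj] by blast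
      then have S: "E n \<in> S_plus k" using br[of n] \<eta>(1) by (auto simp: branch_iff)
      have \<Lambda>: "0 \<le> c" using bc(2)[of 0] by simp
      define R where "R = max b 1"
      have R: "0 < R" "norm (E n) \<le> R" using bc(1)[of n] by (auto simp: R_def)
      obtain \<delta> C B where "0 < \<delta>" and bf: "bounded_field p (field R \<delta>) C B c"
        by (rule field_bounded[OF R(1) \<Lambda>])
      interpret bf: bounded_field p "field R \<delta>" C B c by (rule bf)
      have tr: "trajectory p (field R \<delta>) (L n) (fn (E n)) (\<lambda>x. phi p (dfn (E n) x))"
        using sol plap_solution_iff_field[OF R(2)] by blast
      obtain \<theta> where \<theta>: "polar (fn (E n)) (\<lambda>x. phi p (dfn (E n) x)) \<theta>" "\<theta> 1 = of_nat k * pi"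
        by (rule angle_of_S_plus[OF p bf.trajectory_half_linear[OF tr bc(2)] bf.coef_bound[OF bc(2)] S k])
      have "\<forall>x\<in>{0..1}. \<bar>fn (E n) x\<bar> \<le> \<sigma>"
        using norm_c1_upper[of _ _ "E n"] n(2) by (smt (verit, best))
      moreover have "trajectory p rhs (L n) (fn (E n)) (\<lambda>x. phi p (dfn (E n) x))"
        using sol[of n] unfolding plap_solution_iff_rhs .
      ultimately show False using \<sigma>(2)[OF bc(2) _ \<theta>(1)] n(1) \<theta>(2) by (smt (verit, best))
    qed
  qed
  then show "le \<in> branch k" by (simp add: le)
qed

lemma branch_compact:
  assumes k: "1 \<le> k"
  shows "compact (branch k \<inter> cball 0 R)"
  unfolding compact_def
proof (intro allI impI)
  fix z :: "nat \<Rightarrow> real \<times> c1_zero" assume z: "\<forall>n. z n \<in> branch k \<inter> cball 0 R"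
  define L where "L n = fst (z n)" for n
  define E where "E n = snd (z n)" for n
  have sol: "plap_solution p a F (L n) (E n)" for n
    using z branch_solution[of "L n" "E n" k] by (simp add: L_def E_def)
  have "\<bar>L n\<bar> \<le> R" "norm (E n) \<le> R" for n
  proof -
    have "norm (z n) \<le> R" using z by simp
    then show "\<bar>L n\<bar> \<le> R" "norm (E n) \<le> R"
      using norm_fst_le[of "L n" "E n"] norm_snd_le[of "E n" "L n"] by (auto simp: L_def E_def)
  qed
  then obtain r l e where r: "strict_mono (r :: nat \<Rightarrow> nat)" "(\<lambda>n. L (r n)) \<longlonglongrightarrow> l" "(\<lambda>n. E (r n)) \<longlonglongrightarrow> e"
    "plap_solution p a F l e"
    using solutions_compact[of L E R R] sol by blast
  have lim: "(\<lambda>n. z (r n)) \<longlonglongrightarrow> (l, e)"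
    using tendsto_Pair[OF r(2,3)] by (simp add: L_def E_def)
  moreover have "closed (branch k \<inter> cball 0 R)" using branch_closed[OF k] by (intro closed_Int) auto
  ultimately have "(l, e) \<in> branch k \<inter> cball 0 R"
    using closed_sequentially[of _ "\<lambda>n. z (r n)" "(l, e)"] z by blast
  then show "\<exists>l\<in>branch k \<inter> cball 0 R. \<exists>r. strict_mono r \<and> (z \<circ> r) \<longlonglongrightarrow> l"
    using lim r(1) by (auto simp: comp_def)
qed

end

section \<open>Unboundedness of the component\<close>

context plap_problem
begin

text \<open>
  For the shooting family let \<open>m\<close> be the distance to \<open>K\<close> minus \<open>\<delta>\<close>, increased by the defect
  \<open>|u(1)|\<close> and capped at \<open>1\<close>. A common zero of \<open>\<theta>(1) - k\<pi>\<close> and \<open>m\<close> is sought by the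
  Poincare--Miranda theorem in the rectangle of parameters \<open>(l,\<alpha>)\<close>. To obtain the boundary signs,
  \<open>\<theta>(1) - k\<pi>\<close> is deformed into \<open>l - \<lambda>\<^sub>k\<close> where \<open>m\<close> increases to \<open>1\<close>, and below a small slope
  \<open>\<epsilon>\<close>, where everything is frozen at \<open>\<alpha> = \<epsilon>\<close>, \<open>m\<close> is pushed down to negative values. Spurious
  zeros created in this way would have \<open>m > 0\<close> and \<open>\<alpha> = \<epsilon>\<close>. They do not survive the limit: small
  trajectories with \<open>m \<ge> 0\<close> have \<open>l\<close> outside \<open>I\<^sub>k\<close>, and there \<open>\<theta>(1) - k\<pi>\<close> and \<open>l - \<lambda>\<^sub>k\<close> have
  the same sign.
\<close>

lemma branch_meets_level:
  assumes k: "1 \<le> k" and K: "bounded K"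
    and I: "{plap_eig p a k - M / a0 .. plap_eig p a k + M / a0} \<times> {0} \<subseteq> K"
    and \<delta>: "0 < \<delta>" "\<delta> \<le> 1"
  shows "\<exists>z\<in>branch k. infdist z K = \<delta>"
proof -
  define \<mu> where "\<mu> = plap_eig p a k"
  define d where "d = M / a0"
  have d: "0 < d" using M a0_pos by (simp add: d_def)
  have IK: "(l, 0) \<in> K" if "\<bar>l - \<mu>\<bar> \<le> d" for l
    using I that by (auto simp: \<mu>_def d_def abs_le_iff)
  obtain R0 where R0: "\<And>z. z \<in> K \<Longrightarrow> norm z \<le> R0" using K unfolding bounded_iff by blast
  have \<mu>K: "(\<mu>, 0) \<in> K" using IK[of \<mu>] d by simp
  have \<mu>R: "\<bar>\<mu>\<bar> \<le> R0" using R0[OF \<mu>K] by simp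
  have far: "norm z - R0 \<le> infdist z K" for z
  proof -
    have "norm z - R0 \<le> dist z y" if "y \<in> K" for y
      using R0[OF that] norm_triangle_ineq2[of z y] by (simp add: dist_norm)
    moreover have "K \<noteq> {}" using \<mu>K by auto
    ultimately show ?thesis unfolding infdist_notempty[OF \<open>K \<noteq> {}\<close>] by (intro cINF_greatest)
  qed
  \<comment> \<open>Points at distance at most \<open>1\<close> from \<open>K\<close> have norm at most \<open>R0 + 1\<close>, so they are not affected by a
    truncation at \<open>R0 + 2\<close>. Points of norm \<open>R0 + 3\<close> are so far away that \<open>m\<close> has reached its cap.\<close>
  define \<Lambda> where "\<Lambda> = R0 + 3"
  have R: "0 < R0 + 2" and \<Lambda>: "0 \<le> \<Lambda>" using \<mu>R by (auto simp: \<Lambda>_def)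
  obtain \<tau> C B where \<tau>: "0 < \<tau>" and bf: "bounded_field p (field (R0 + 2) \<tau>) C B \<Lambda>"
    by (rule field_bounded[OF R \<Lambda>])
  interpret bf: bounded_field p "field (R0 + 2) \<tau>" C B \<Lambda> by (rule bf)
  define K1 where "K1 = exp ((p + conj_exp p * C) / p)"
  have K1: "1 \<le> K1" using bf.C_nonneg p conj_exp_gt_1[OF p] by (simp add: K1_def)
  have "0 < \<delta> / 2" using \<delta> by simp
  then obtain \<sigma> where \<sigma>: "0 < \<sigma>"
    "\<And>l u v \<theta>. \<bar>l\<bar> \<le> \<Lambda> \<Longrightarrow> trajectory p rhs l u v \<Longrightarrow> polar u v \<theta> \<Longrightarrow> (\<forall>x\<in>{0..1}. \<bar>u x\<bar> \<le> \<sigma>) \<Longrightarrow>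
       (\<mu> + d + \<delta> / 2 < l \<longrightarrow> of_nat k * pi < \<theta> 1) \<and> (l < \<mu> - d - \<delta> / 2 \<longrightarrow> \<theta> 1 < of_nat k * pi)"
    unfolding \<mu>_def d_def by (rule small_angle[OF k]) blast
  \<comment> \<open>Trajectories of initial slope \<open>\<epsilon>\<close> are bounded by \<open>\<epsilon> K1\<close>, and their images in \<open>E\<close> by \<open>4 \<epsilon> K1\<close>.
    Together with \<open>|u(1)|\<close> this must stay below \<open>\<delta>/2\<close>.\<close>
  define \<epsilon> where "\<epsilon> = min (min \<sigma> \<tau>) (\<delta> / 20) / K1"
  have \<epsilon>: "0 < \<epsilon>" using \<sigma>(1) \<tau> \<delta> K1 by (simp add: \<epsilon>_def)
  have \<epsilon>K: "\<epsilon> * K1 \<le> \<sigma>" "\<epsilon> * K1 \<le> \<tau>" "\<epsilon> * K1 \<le> \<delta> / 20"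
    using K1 by (auto simp: \<epsilon>_def)
  have \<epsilon>\<Lambda>: "\<epsilon> \<le> \<Lambda>"
  proof -
    have "\<epsilon> * 1 \<le> \<epsilon> * K1" using K1 \<epsilon> by (intro mult_left_mono) auto
    then show ?thesis using \<epsilon>K(3) \<delta> \<mu>R by (simp add: \<Lambda>_def)
  qed
  let ?P = "{-\<Lambda>..\<Lambda>} \<times> {\<epsilon>..\<Lambda>}"
  obtain U V \<Theta> :: "nat \<Rightarrow> real \<times> real \<Rightarrow> real \<Rightarrow> real"
    where cU: "\<And>n. continuous_on (?P \<times> {0..1}) (\<lambda>(s, x). U n s x)"
    and cV: "\<And>n. continuous_on (?P \<times> {0..1}) (\<lambda>(s, x). V n s x)"
    and c\<Theta>: "\<And>n. continuous_on ?P (\<lambda>s. \<Theta> n s 1)"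
    and U0: "\<And>n s. s \<in> ?P \<Longrightarrow> U n s 0 = 0" and V0: "\<And>n s. s \<in> ?P \<Longrightarrow> V n s 0 = phi p (snd s)"
    and dU: "\<And>n s x. s \<in> ?P \<Longrightarrow> x \<in> {0..1} \<Longrightarrow>
        (U n s has_real_derivative phi (conj_exp p) (V n s x)) (at x within {0..1})"
    and lim: "\<And>m s. strict_mono m \<Longrightarrow> (\<And>n. s n \<in> ?P) \<Longrightarrow>
       \<exists>r l \<alpha> u v \<theta>. strict_mono (r :: nat \<Rightarrow> nat) \<and> (l, \<alpha>) \<in> ?P \<and> (\<lambda>n. s (r n)) \<longlonglongrightarrow> (l, \<alpha>) \<and>
         trajectory p (field (R0 + 2) \<tau>) l u v \<and> v 0 = phi p \<alpha> \<and> polar u v \<theta> \<and>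
         uniform_limit {0..1} (\<lambda>n. U (m (r n)) (s (r n))) u sequentially \<and>
         uniform_limit {0..1} (\<lambda>n x. phi (conj_exp p) (V (m (r n)) (s (r n)) x))
           (\<lambda>x. phi (conj_exp p) (v x)) sequentially \<and>
         (\<lambda>n. \<Theta> (m (r n)) (s (r n)) 1) \<longlonglongrightarrow> \<theta> 1"
    by (rule bf.shooting_family[OF \<epsilon>, of \<Lambda>]) blast
  have cW: "continuous_on (?P \<times> {0..1}) (\<lambda>(s, x). phi (conj_exp p) (V n s x))" for n
    using cV[of n] unfolding case_prod_unfold by (intro continuous_intros conj_exp_gt_1 p)
  have cW1: "continuous_on {0..1} (\<lambda>x. phi (conj_exp p) (V n s x))" if "s \<in> ?P" for n s
  proof -
    have "continuous_on {0..1} (\<lambda>x::real. (s, x))" by (intro continuous_intros)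
    moreover have "(\<lambda>x. (s, x)) ` {0..1} \<subseteq> ?P \<times> {0..1}" using that by auto
    ultimately show ?thesis using continuous_on_compose2[OF cW[of n]] by fastforce
  qed
  define G where "G l e t = min 1 (infdist (l, e) K + \<bar>t\<bar> - \<delta>)" for l :: real and e :: c1_zero and t :: real
  define m where "m n s = G (fst s) (to_c1 (U n s)) (U n s 1)" for n s
  have G1: "G l e t \<le> 1" for l e t by (simp add: G_def)
  have cm: "continuous_on ?P (m n)" for n
  proof -
    have 1: "continuous_on ?P (\<lambda>s. to_c1 (U n s))"
      using to_c1_continuous[OF cU[of n] cW[of n] U0 dU] by simp
    have 2: "continuous_on ?P (\<lambda>s. U n s 1)"
    proof -
      have "continuous_on ?P (\<lambda>s. (s, 1::real))" by (intro continuous_intros)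
      moreover have "(\<lambda>s. (s, 1::real)) ` ?P \<subseteq> ?P \<times> {0..1}" by auto
      ultimately show ?thesis using continuous_on_compose2[OF cU[of n]] by fastforce
    qed
    show ?thesis unfolding m_def [abs_def] G_def by (intro continuous_intros 1 2)
  qed
  have m_side: "m n s = 1" if "\<bar>fst s\<bar> = \<Lambda>" for n s
  proof -
    have "\<Lambda> \<le> norm (fst s, to_c1 (U n s))" using that norm_fst_le[of "fst s" "to_c1 (U n s)"] by simp
    then show ?thesis using far[of "(fst s, to_c1 (U n s))"] \<delta> unfolding m_def G_def \<Lambda>_def by simp
  qed
  have m_top: "m n s = 1" if s: "s \<in> ?P" "snd s = \<Lambda>" for n s
  proof -
    have "dfn (to_c1 (U n s)) 0 = snd s - U n s 1"
      using to_c1(2)[OF U0[OF s(1)] cW1[OF s(1)] dU[OF s(1)], of 0] V0[OF s(1)] p by (simp add: phi_inverse)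
    then have "\<Lambda> \<le> norm (to_c1 (U n s)) + \<bar>U n s 1\<bar>"
      using norm_c1_upper[of 0 0 "to_c1 (U n s)"] s(2) by simp
    moreover have "norm (to_c1 (U n s)) \<le> norm (fst s, to_c1 (U n s))" by (rule norm_snd_le)
    ultimately show ?thesis using far[of "(fst s, to_c1 (U n s))"] \<delta> unfolding m_def G_def \<Lambda>_def by simp
  qed
  \<comment> \<open>\<open>q\<close> freezes the parameters below \<open>\<alpha> = \<epsilon>\<close>.\<close>
  define q where "q z = (fst z, max (snd z) \<epsilon>)" for z :: "real \<times> real"
  let ?Q = "{-\<Lambda>..\<Lambda>} \<times> {0..\<Lambda>}"
  have qP: "q z \<in> ?P" if "z \<in> ?Q" for z using that \<epsilon>\<Lambda> by (auto simp: q_def)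
  have cq: "continuous_on ?Q q" unfolding q_def by (intro continuous_intros)
  define H1 where "H1 n z = (1 - max 0 (m n (q z))) * (\<Theta> n (q z) 1 - of_nat k * pi)
      + max 0 (m n (q z)) * (fst z - \<mu>)" for n z
  define H2 where "H2 n z = m n (q z) - 2 * max 0 (1 - snd z / \<epsilon>)" for n z
  have "\<exists>z\<in>?Q. H1 n z = 0 \<and> H2 n z = 0" for n
  proof (rule poincare_miranda)
    show "- \<Lambda> \<le> \<Lambda>" "0 \<le> \<Lambda>" using \<Lambda> by auto
    have cmq: "continuous_on ?Q (\<lambda>z. m n (q z))"
      by (rule continuous_on_compose2[OF cm cq]) (use qP in blast)
    have c\<Theta>q: "continuous_on ?Q (\<lambda>z. \<Theta> n (q z) 1)"
      by (rule continuous_on_compose2[OF c\<Theta> cq]) (use qP in blast)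
    show "continuous_on ?Q (H1 n)" unfolding H1_def by (intro continuous_intros cmq c\<Theta>q)
    show "continuous_on ?Q (H2 n)" unfolding H2_def using \<epsilon> by (intro continuous_intros cmq) auto
    show "H1 n (- \<Lambda>, y) \<le> 0" "0 \<le> H1 n (\<Lambda>, y)" for y
      using m_side[of "q (- \<Lambda>, y)" n] m_side[of "q (\<Lambda>, y)" n] \<mu>R \<Lambda> by (auto simp: H1_def q_def \<Lambda>_def)
    show "H2 n (x, 0) \<le> 0" for x
    proof -
      have "m n (q (x, 0)) \<le> 1" unfolding m_def by (rule G1)
      then show ?thesis by (simp add: H2_def)
    qed
    show "0 \<le> H2 n (x, \<Lambda>)" if "x \<in> {-\<Lambda>..\<Lambda>}" for x
    proof -
      have "q (x, \<Lambda>) \<in> ?P" using that \<Lambda> by (intro qP) auto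
      then have "m n (q (x, \<Lambda>)) = 1" using \<epsilon>\<Lambda> by (intro m_top) (auto simp: q_def)
      then show ?thesis using \<epsilon> \<epsilon>\<Lambda> by (simp add: H2_def)
    qed
  qed
  then obtain z where z: "\<And>n. z n \<in> ?Q" "\<And>n. H1 n (z n) = 0" "\<And>n. H2 n (z n) = 0" by metis
  define s where "s n = q (z n)" for n
  have sP: "s n \<in> ?P" for n unfolding s_def by (rule qP[OF z(1)])
  have m0: "0 \<le> m n (s n)" and m\<epsilon>: "m n (s n) * (snd (s n) - \<epsilon>) = 0" for n
  proof -
    have eq: "m n (s n) = 2 * max 0 (1 - snd (z n) / \<epsilon>)" using z(3)[of n] by (simp add: H2_def s_def)
    then show "0 \<le> m n (s n)" by simp
    show "m n (s n) * (snd (s n) - \<epsilon>) = 0"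
    proof (cases "\<epsilon> \<le> snd (z n)")
      case True
      then have "1 \<le> snd (z n) / \<epsilon>" using \<epsilon> by simp
      then show ?thesis using eq by simp
    qed (simp add: s_def q_def)
  qed
  have m\<theta>: "(1 - m n (s n)) * (\<Theta> n (s n) 1 - of_nat k * pi) + m n (s n) * (fst (s n) - \<mu>) = 0" for n
    using z(2)[of n] m0[of n] by (simp add: H1_def s_def q_def)
  have "strict_mono (\<lambda>n::nat. n)" by (simp add: strict_mono_def)
  from lim[where s = s, OF this sP] obtain r l \<alpha> u v \<theta> where r: "strict_mono (r :: nat \<Rightarrow> nat)" "(l, \<alpha>) \<in> ?P"
    "(\<lambda>n. s (r n)) \<longlonglongrightarrow> (l, \<alpha>)" and tr: "trajectory p (field (R0 + 2) \<tau>) l u v"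
    and v0: "v 0 = phi p \<alpha>" and pol: "polar u v \<theta>"
    and Ulim: "uniform_limit {0..1} (\<lambda>n. U (r n) (s (r n))) u sequentially"
    and Wlim: "uniform_limit {0..1} (\<lambda>n x. phi (conj_exp p) (V (r n) (s (r n)) x))
           (\<lambda>x. phi (conj_exp p) (v x)) sequentially"
    and \<Theta>lim: "(\<lambda>n. \<Theta> (r n) (s (r n)) 1) \<longlonglongrightarrow> \<theta> 1"
    by blast
  have l: "\<bar>l\<bar> \<le> \<Lambda>" using r(2) by auto
  have u0: "u 0 = 0" and du: "\<And>x. x \<in> {0..1} \<Longrightarrow> (u has_real_derivative phi (conj_exp p) (v x)) (at x within {0..1})"
    and cv: "continuous_on {0..1} v"
    using tr by (auto simp: trajectory_def)
  have cw: "continuous_on {0..1} (\<lambda>x. phi (conj_exp p) (v x))"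
    by (intro continuous_intros conj_exp_gt_1 p cv)
  define e where "e = to_c1 u"
  have elim: "(\<lambda>n. to_c1 (U (r n) (s (r n)))) \<longlonglongrightarrow> e"
    unfolding e_def by (rule to_c1_tendsto[OF Ulim Wlim U0[OF sP] cW1[OF sP] dU[OF sP] u0 cw du])
  have llim: "(\<lambda>n. fst (s (r n))) \<longlonglongrightarrow> l" and \<alpha>lim: "(\<lambda>n. snd (s (r n))) \<longlonglongrightarrow> \<alpha>"
    using tendsto_fst[OF r(3)] tendsto_snd[OF r(3)] by simp_all
  have u1lim: "(\<lambda>n. U (r n) (s (r n)) 1) \<longlonglongrightarrow> u 1" using tendsto_uniform_limitI[OF Ulim, of 1] by simp
  define ml where "ml = G l e (u 1)"
  have mlim: "(\<lambda>n. m (r n) (s (r n))) \<longlonglongrightarrow> ml"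
    unfolding m_def ml_def G_def by (intro tendsto_intros llim elim u1lim)
  have ml0: "0 \<le> ml" using m0 by (intro LIMSEQ_le_const[OF mlim]) auto
  have ml1: "ml \<le> 1" unfolding ml_def by (rule G1)
  have "(\<lambda>n. m (r n) (s (r n)) * (snd (s (r n)) - \<epsilon>)) \<longlonglongrightarrow> ml * (\<alpha> - \<epsilon>)"
    by (intro tendsto_intros mlim \<alpha>lim)
  then have ml\<epsilon>: "ml * (\<alpha> - \<epsilon>) = 0" by (simp only: m\<epsilon> LIMSEQ_const_iff)
  have "(\<lambda>n. (1 - m (r n) (s (r n))) * (\<Theta> (r n) (s (r n)) 1 - of_nat k * pi)
        + m (r n) (s (r n)) * (fst (s (r n)) - \<mu>)) \<longlonglongrightarrow> (1 - ml) * (\<theta> 1 - of_nat k * pi) + ml * (l - \<mu>)"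
    by (intro tendsto_intros mlim \<Theta>lim llim)
  then have ml\<theta>: "(1 - ml) * (\<theta> 1 - of_nat k * pi) + ml * (l - \<mu>) = 0" by (simp only: m\<theta> LIMSEQ_const_iff)
  \<comment> \<open>The zeros created below \<open>\<alpha> = \<epsilon>\<close> are spurious.\<close>
  have "ml = 0"
  proof (rule ccontr)
    assume "ml \<noteq> 0"
    then have ml: "0 < ml" and \<alpha>: "\<alpha> = \<epsilon>" using ml0 ml\<epsilon> by auto
    have v\<epsilon>: "v 0 = phi p \<epsilon>" using v0 \<alpha> by simp
    have small: "\<bar>u x\<bar> \<le> \<epsilon> * K1" "\<bar>phi (conj_exp p) (v x)\<bar> \<le> \<epsilon> * K1" if "x \<in> {0..1}" for x
      unfolding K1_def
      using half_linear_small[OF p bf.trajectory_half_linear[OF tr l] bf.coef_bound[OF l] u0 v\<epsilon> \<epsilon> that bf.C_nonneg]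
      by auto
    have ne: "norm e \<le> 4 * (\<epsilon> * K1)"
    proof -
      have "norm e = norm (to_c1 u - to_c1 (fn 0))" by (simp add: e_def to_c1_fn)
      also have "\<dots> \<le> 4 * (\<epsilon> * K1)"
        using fn_has_derivative[of _ 0] continuous_on_dfn[of 0] small
        by (intro norm_to_c1_diff_le[OF u0 cw du, where w' = "dfn 0"]) (auto simp: zero_c1_zero.rep_eq dfn_0)
      finally show ?thesis .
    qed
    have "d + \<delta> / 2 < \<bar>l - \<mu>\<bar>"
    proof (rule ccontr)
      assume "\<not> ?thesis"
      then have near: "\<bar>l - \<mu>\<bar> \<le> d + \<delta> / 2" by simp
      define l' where "l' = max (\<mu> - d) (min (\<mu> + d) l)"
      have l': "\<bar>l' - \<mu>\<bar> \<le> d" "\<bar>l - l'\<bar> \<le> \<delta> / 2"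
        using near d \<delta> by (auto simp: l'_def abs_le_iff max_def min_def)
      have "infdist (l, e) K \<le> dist (l, e) (l', 0)" by (rule infdist_le[OF IK[OF l'(1)]])
      also have "\<dots> \<le> \<bar>l - l'\<bar> + norm e"
        using norm_Pair_le[of "l - l'" e] by (simp add: dist_norm)
      finally have "infdist (l, e) K + \<bar>u 1\<bar> < \<delta>"
        using l'(2) ne small(1)[of 1] \<epsilon>K(3) \<delta> by simp
      then have "ml < 0" by (simp add: ml_def G_def)
      then show False using ml by simp
    qed
    moreover have "trajectory p rhs l u v"
    proof (rule trajectory_cong[OF tr])
      fix x :: real assume "x \<in> {0<..<1}"
      then have "\<bar>u x\<bar> \<le> \<tau>" using small(1)[of x] \<epsilon>K(2) by auto
      then show "field (R0 + 2) \<tau> x (u x) l = rhs x (u x) l"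
        by (intro field_eq) (simp add: cap_def)
    qed
    moreover have "\<forall>x\<in>{0..1}. \<bar>u x\<bar> \<le> \<sigma>" using order_trans[OF small(1) \<epsilon>K(1)] by blast
    ultimately have cases: "\<mu> < l \<and> of_nat k * pi < \<theta> 1 \<or> l < \<mu> \<and> \<theta> 1 < of_nat k * pi"
      using \<sigma>(2)[OF l _ pol] d \<delta> by (cases "\<mu> \<le> l") auto
    then show False
    proof
      assume *: "\<mu> < l \<and> of_nat k * pi < \<theta> 1"
      then have "0 < ml * (l - \<mu>)" "0 \<le> (1 - ml) * (\<theta> 1 - of_nat k * pi)" using ml ml1 by auto
      then show False using ml\<theta> by linarith
    next
      assume *: "l < \<mu> \<and> \<theta> 1 < of_nat k * pi"
      then have "ml * (l - \<mu>) < 0" "(1 - ml) * (\<theta> 1 - of_nat k * pi) \<le> 0"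
        using ml ml1 by (auto simp: mult_less_0_iff mult_le_0_iff)
      then show False using ml\<theta> by linarith
    qed
  qed
  then have \<theta>1: "\<theta> 1 = of_nat k * pi" using ml\<theta> by simp
  have "\<exists>j::int. \<theta> 1 = of_int j * pi" using \<theta>1 by (intro exI[of _ "int k"]) simp
  then have u1: "u 1 = 0" using polar_zero_iff[OF pol, of 1] by simp
  have level: "infdist (l, e) K = \<delta>" using \<open>ml = 0\<close> u1 by (auto simp: ml_def G_def min_def split: if_splits)
  have "norm e \<le> norm (l, e)" by (rule norm_snd_le)
  then have eR: "norm e \<le> R0 + 2" using far[of "(l, e)"] level \<delta>(2) by linarith
  note e_vals = trajectory_to_c1[OF p tr u1, folded e_def]
  have tr_e: "trajectory p (field (R0 + 2) \<tau>) l (fn e) (\<lambda>x. phi p (dfn e x))"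
    by (rule trajectory_cong_values[OF tr]) (use e_vals in auto)
  have pol_e: "polar (fn e) (\<lambda>x. phi p (dfn e x)) \<theta>"
    by (rule polar_cong_values[OF pol]) (use e_vals in auto)
  have "e \<in> S_plus k"
    by (rule S_plus_of_angle[OF bf.trajectory_half_linear[OF tr_e l] pol_e \<theta>1])
  moreover have "plap_solution p a F l e" using plap_solution_iff_field[OF eR] tr_e by blast
  ultimately have "(l, e) \<in> branch k" by (simp add: branch_iff)
  then show ?thesis using level by blast
qed

theorem branch_component_unbounded:
  assumes k: "1 \<le> k"
  shows "\<not> bounded (connected_component_set (branch k) (plap_eig p a k, 0))"
    and "{plap_eig p a k - M / a0 .. plap_eig p a k + M / a0} \<times> {0}
      \<subseteq> connected_component_set (branch k) (plap_eig p a k, 0)"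
    and "(plap_eig p a k, 0) \<in> branch k"
proof -
  let ?I = "{plap_eig p a k - M / a0 .. plap_eig p a k + M / a0} \<times> {0 :: c1_zero}"
  let ?D = "connected_component_set (branch k) (plap_eig p a k, 0)"
  have "0 < M / a0" using M a0_pos by simp
  then have base: "(plap_eig p a k, 0) \<in> ?I" by simp
  have "connected ?I" by (intro connected_Times) auto
  then show ID: "?I \<subseteq> ?D"
    using base by (intro connected_component_maximal) (auto simp: branch_def)
  show mem: "(plap_eig p a k, 0) \<in> branch k" using base by (simp add: branch_def)
  show "\<not> bounded ?D"
  proof
    assume "bounded ?D"
    then obtain K \<delta> where K: "compact K" "?D \<subseteq> K" "0 < \<delta>" "\<delta> \<le> 1"
      "\<And>z. z \<in> branch k \<Longrightarrow> infdist z K \<noteq> \<delta>"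
      using bounded_component_separated[OF branch_closed[OF k] branch_compact[OF k] mem] by metis
    have "?I \<subseteq> K" using ID K(2) by (rule order_trans)
    then show False
      using branch_meets_level[OF k compact_imp_bounded[OF K(1)] _ K(3,4)] K(5) by blast
  qed
qed

end

text \<open>The negative branch of \<open>F\<close> is the mirror image of the positive branch of \<open>-F(x,-s,l)\<close>.\<close>

lemma plap_solution_reflect:
  assumes p: "1 < p" and sol: "plap_solution p a (\<lambda>x s l. - F x (- s) l) l e"
  shows "plap_solution p a F l (- e)"
proof -
  let ?v = "\<lambda>x. phi p (dfn e x)"
  have tr: "trajectory p (\<lambda>x s l. l * a x * phi p s + - F x (- s) l) l (fn e) ?v"
    using sol unfolding plap_solution_iff_trajectory[OF p, of a "\<lambda>x s l. - F x (- s) l" l e] .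
  have "trajectory p (\<lambda>x s l. l * a x * phi p s + F x s l) l (\<lambda>x. - fn e x) (\<lambda>x. - ?v x)"
    unfolding trajectory_def
  proof (intro conjI ballI)
    show "continuous_on {0..1} (\<lambda>x. - ?v x)" using tr by (auto simp: trajectory_def intro: continuous_intros)
    fix x :: real assume "x \<in> {0..1}"
    then have "((\<lambda>x. - fn e x) has_real_derivative - phi (conj_exp p) (?v x)) (at x within {0..1})"
      using tr by (intro DERIV_minus) (simp add: trajectory_def)
    then show "((\<lambda>x. - fn e x) has_real_derivative phi (conj_exp p) (- ?v x)) (at x within {0..1})"
      by simp
  next
    fix x :: real assume "x \<in> {0<..<1}"
    then have "((\<lambda>x. - ?v x) has_real_derivative - (- (l * a x * phi p (fn e x) + - F x (- fn e x) l))) (at x)"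
      using tr by (intro DERIV_minus) (simp add: trajectory_def)
    then show "((\<lambda>x. - ?v x) has_real_derivative - (l * a x * phi p (- fn e x) + F x (- fn e x) l)) (at x)"
      by (rule DERIV_cong) simp
  qed simp
  then show ?thesis
    unfolding plap_solution_iff_trajectory[OF p]
    by (rule trajectory_cong_values) (auto simp: fn_uminus dfn_uminus)
qed

lemma nodal_solution_reflect:
  assumes p: "1 < p" and z: "(l, e) \<in> nodal_solution_set p a (\<lambda>x s l. - F x (- s) l) (S_plus k)"
  shows "(l, - e) \<in> nodal_solution_set p a F (S_minus k)"
proof -
  define T where "T z = (fst z, - snd z)" for z :: "real \<times> c1_zero"
  let ?A = "{(l, u). u \<noteq> 0 \<and> plap_solution p a (\<lambda>x s l. - F x (- s) l) l u}"
  let ?B = "{(l, u). u \<noteq> 0 \<and> plap_solution p a F l u}"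
  have "T ` ?A \<subseteq> ?B" using plap_solution_reflect[OF p] by (auto simp: T_def)
  then have "T ` ?A \<subseteq> closure ?B" using closure_subset by (rule order_trans)
  then have "T ` closure ?A \<subseteq> closure ?B"
    by (intro image_closure_subset) (auto simp: T_def [abs_def] intro!: continuous_intros)
  moreover have "(l, e) \<in> closure ?A" "e \<in> S_plus k"
    using z by (auto simp: nodal_solution_set_def solution_set_def)
  ultimately have "(l, - e) \<in> closure ?B" "- e \<in> S_minus k"
    by (auto simp: T_def image_subset_iff S_minus_def)
  then show ?thesis by (simp add: nodal_solution_set_def solution_set_def)
qed

theorem theorem1p1:
  fixes p M a0 d :: real
    and a :: "real \<Rightarrow> real"
    and F f g :: "real \<Rightarrow> real \<Rightarrow> real \<Rightarrow> real"
    and I :: "nat \<Rightarrow> real set"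
  assumes p: "1 < p"
    and a_cont: "continuous_on {0..1} a"
    and a_pos: "\<And>x. x \<in> {0..1} \<Longrightarrow> 0 < a x"
    and a0: "a0 = (INF x\<in>{0..1}. a x)"
    and F_cont: "continuous_on ({0<..<1} \<times> UNIV \<times> UNIV) (\<lambda>(x, s, l). F x s l)"
    and F_eq: "\<And>x s l. x \<in> {0<..<1} \<Longrightarrow> F x s l = f x s l + g x s l"
    and M: "0 < M"
    and f: "\<And>x s l. x \<in> {0<..<1} \<Longrightarrow> 0 < \<bar>s\<bar> \<Longrightarrow> \<bar>s\<bar> \<le> 1 \<Longrightarrow> \<bar>f x s l\<bar> \<le> M * \<bar>phi p s\<bar>"
    and g: "\<And>L \<epsilon>. bounded L \<Longrightarrow> 0 < \<epsilon> \<Longrightarrow>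
       \<exists>\<delta>>0. \<forall>x\<in>{0<..<1}. \<forall>l\<in>L. \<forall>s. 0 < \<bar>s\<bar> \<and> \<bar>s\<bar> < \<delta> \<longrightarrow> \<bar>g x s l\<bar> \<le> \<epsilon> * \<bar>s\<bar> powr (p - 1)"
    and d: "d = M / a0"
    and I: "\<And>k. I k = {plap_eig p a k - d .. plap_eig p a k + d}"
  shows "\<forall>k\<ge>1.
      (\<exists>D. D \<in> components (nodal_solution_set p a F (S_plus k) \<union> I k \<times> {0}) \<and>
           I k \<times> {0} \<subseteq> D \<and> \<not> bounded D \<and> D \<subseteq> UNIV \<times> S_plus k \<union> I k \<times> {0}) \<and>
      (\<exists>D. D \<in> components (nodal_solution_set p a F (S_minus k) \<union> I k \<times> {0}) \<and>
           I k \<times> {0} \<subseteq> D \<and> \<not> bounded D \<and> D \<subseteq> UNIV \<times> S_minus k \<union> I k \<times> {0})"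
proof (intro allI impI conjI)
  fix k :: nat assume k: "1 \<le> k"
  let ?F' = "\<lambda>x s l. - F x (- s) l"
  interpret pos: plap_problem p a F f g M a0
    by unfold_locales (fact p a_cont a_pos a0 F_cont F_eq M f g)+
  interpret neg: plap_problem p a ?F' "\<lambda>x s l. - f x (- s) l" "\<lambda>x s l. - g x (- s) l" M a0
  proof
    show "a0 = (INF x\<in>{0..1}. a x)" "0 < M" by (fact a0 M)+
    have "continuous_on ({0<..<1} \<times> UNIV \<times> UNIV) (\<lambda>z :: real \<times> real \<times> real. (fst z, - fst (snd z), snd (snd z)))"
      by (intro continuous_intros)
    moreover have "(\<lambda>z :: real \<times> real \<times> real. (fst z, - fst (snd z), snd (snd z))) ` ({0<..<1} \<times> UNIV \<times> UNIV)
        \<subseteq> {0<..<1} \<times> UNIV \<times> UNIV" by auto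
    ultimately have "continuous_on ({0<..<1} \<times> UNIV \<times> UNIV) (\<lambda>z. F (fst z) (- fst (snd z)) (snd (snd z)))"
      using continuous_on_compose2[OF F_cont] by fastforce
    then show "continuous_on ({0<..<1} \<times> UNIV \<times> UNIV) (\<lambda>(x, s, l). ?F' x s l)"
      unfolding case_prod_unfold by (intro continuous_intros)
    show "?F' x s l = - f x (- s) l + - g x (- s) l" if "x \<in> {0<..<1}" for x s l
      using F_eq[OF that] by simp
    show "\<bar>- f x (- s) l\<bar> \<le> M * \<bar>phi p s\<bar>" if "x \<in> {0<..<1}" "0 < \<bar>s\<bar>" "\<bar>s\<bar> \<le> 1" for x s l
      using f[of x "- s" l] that by simp
    fix L :: "real set" and \<epsilon> :: real assume "bounded L" "0 < \<epsilon>"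
    from g[OF this] obtain \<delta> where \<delta>: "\<delta> > 0"
      "\<And>x l s. x \<in> {0<..<1} \<Longrightarrow> l \<in> L \<Longrightarrow> 0 < \<bar>s\<bar> \<Longrightarrow> \<bar>s\<bar> < \<delta> \<Longrightarrow> \<bar>g x s l\<bar> \<le> \<epsilon> * \<bar>s\<bar> powr (p - 1)" by blast
    show "\<exists>\<delta>>0. \<forall>x\<in>{0<..<1}. \<forall>l\<in>L. \<forall>s. 0 < \<bar>s\<bar> \<and> \<bar>s\<bar> < \<delta> \<longrightarrow>
        \<bar>- g x (- s) l\<bar> \<le> \<epsilon> * \<bar>s\<bar> powr (p - 1)"
      using \<delta>(1) \<delta>(2)[of _ _ "- _"] by (intro exI[of _ \<delta>]) auto
  qed
  let ?z = "(plap_eig p a k, 0 :: c1_zero)"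
  have Ik: "I k = {plap_eig p a k - M / a0 .. plap_eig p a k + M / a0}" by (simp add: I d)
  have pos_branch: "nodal_solution_set p a F (S_plus k) \<union> I k \<times> {0} = pos.branch k"
    by (simp add: pos.branch_def Ik)
  show "\<exists>D. D \<in> components (nodal_solution_set p a F (S_plus k) \<union> I k \<times> {0}) \<and>
           I k \<times> {0} \<subseteq> D \<and> \<not> bounded D \<and> D \<subseteq> UNIV \<times> S_plus k \<union> I k \<times> {0}"
  proof (intro exI conjI)
    let ?D = "connected_component_set (pos.branch k) ?z"
    note D = pos.branch_component_unbounded[OF k]
    show "?D \<in> components (nodal_solution_set p a F (S_plus k) \<union> I k \<times> {0})"
      using D(3) by (auto simp: pos_branch components_def)
    show "I k \<times> {0} \<subseteq> ?D" "\<not> bounded ?D" using D(1,2) by (simp_all add: Ik)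
    have "?D \<subseteq> nodal_solution_set p a F (S_plus k) \<union> I k \<times> {0}"
      unfolding pos_branch by (rule connected_component_subset)
    then show "?D \<subseteq> UNIV \<times> S_plus k \<union> I k \<times> {0}" by (auto simp: nodal_solution_set_def)
  qed
  let ?X = "nodal_solution_set p a F (S_minus k) \<union> I k \<times> {0}"
  define T where "T z = (fst z, - snd z)" for z :: "real \<times> c1_zero"
  show "\<exists>D. D \<in> components ?X \<and> I k \<times> {0} \<subseteq> D \<and> \<not> bounded D \<and> D \<subseteq> UNIV \<times> S_minus k \<union> I k \<times> {0}"
  proof (intro exI conjI)
    let ?D = "connected_component_set ?X ?z"
    let ?C = "connected_component_set (neg.branch k) ?z"
    note C = neg.branch_component_unbounded[OF k]
    have CX: "T ` ?C \<subseteq> ?X"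
    proof -
      have "T ` neg.branch k \<subseteq> ?X"
        using nodal_solution_reflect[OF p] by (auto simp: neg.branch_def T_def Ik)
      then show ?thesis using connected_component_subset[of "neg.branch k" ?z] by blast
    qed
    have zC: "?z \<in> ?C" using C(3) by simp
    have "T ?z = ?z" by (simp add: T_def)
    then have zT: "?z \<in> T ` ?C" using zC by (metis imageI)
    have "connected (T ` ?C)"
      by (intro connected_continuous_image) (auto simp: T_def intro!: continuous_intros)
    then have TD: "T ` ?C \<subseteq> ?D" using zT CX by (intro connected_component_maximal)
    show "?D \<in> components ?X" using zT CX by (auto simp: components_def)
    have "T ` (I k \<times> {0}) \<subseteq> ?D" using C(2) TD unfolding Ik by blast
    then show "I k \<times> {0} \<subseteq> ?D" by (auto simp: T_def image_subset_iff)
    show "\<not> bounded ?D"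
    proof
      assume "bounded ?D"
      then have "bounded (T ` ?C)" using TD by (rule bounded_subset)
      moreover have "norm (T z) = norm z" for z by (simp add: T_def norm_prod_def)
      ultimately have "bounded ?C" by (auto simp: bounded_iff)
      then show False using C(1) by simp
    qed
    have "?D \<subseteq> ?X" by (rule connected_component_subset)
    then show "?D \<subseteq> UNIV \<times> S_minus k \<union> I k \<times> {0}" by (auto simp: nodal_solution_set_def)
  qed
qed

end
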